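(* For $r=1,\ldots,28$ let $N_r$ be the number of distinct (i.e. pairwise non-equivalent) matroid structures on subsets of the form $\{l_{i_1},\ldots,l_{i_r}\}$ with $1\le i_1<\cdots<i_r\le 28$, where $\pm l_1,\ldots,\pm l_{28}$ are the 28 pairs of minimal vectors of $E_7^\ast$ and $l_{i_k}$ is a representative of the pair $\pm l_{i_k}$. Then $N_r\ge n_r$, where $n_r$ is given by: $n_1=1$, $n_2=1$, $n_3=1$, $n_4=2$, $n_5=2$, $n_6=4$, $n_7=6$, $n_8=11$, $n_9=19$, $n_{10}=37$, $n_{11}=52$, $n_{12}=80$, $n_{13}=95$, $n_{14}=102$, $n_{15}=100$, $n_{16}=90$, $n_{17}=70$, $n_{18}=54$, $n_{19}=37$, $n_{20}=23$, $n_{21}=16$, $n_{22}=10$, $n_{23}=5$, $n_{24}=3$, $n_{25}=2$, $n_{26}=1$, $n_{27}=1$, $n_{28}=1$.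
   Context: $E_7^\ast$ is the dual lattice of the root lattice $E_7$; it has exactly 56 minimal vectors, of norm $\frac32$, forming 28 pairs $\pm l_1,\ldots,\pm l_{28}$. It can be represented in $\mathbb{Q}^8$ so that the minimal vectors are $\pm\frac14(1,1,1,1,1,1,-3,-3)$ and the vectors obtained by permuting coordinates. A matroid on a finite set $E$ is a pair $(E,\mathcal{I})$ with $\mathcal I\subset 2^E$ (the independent sets) nonempty, closed under taking subsets, and satisfying the augmentation axiom. The matroid structure on $\{l_{i_1},\ldots,l_{i_r}\}$ is the one whose independent sets are the subsets linearly independent over $\mathbb{Q}$ (it does not depend on the choice of representatives). Two matroids $(E_1,\mathcal I_1),(E_2,\mathcal I_2)$ are equivalent if there is a bijection $\varphi:E_1\to E_2$ such that $I\in\mathcal I_1$ if and only if $\varphi(I)\in\mathcal I_2$; equivalent matroids are regarded as the same matroid structure. *)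

theory Defs
  imports "HOL-Analysis.Analysis"
begin

section \<open>Lattices in rational Euclidean space\<close>

definition ip :: "rat ^ 'n \<Rightarrow> rat ^ 'n \<Rightarrow> rat" where
  "ip x y = (\<Sum>i\<in>UNIV. x $ i * y $ i)"

definition dual_lattice :: "(rat ^ 'n) set \<Rightarrow> (rat ^ 'n) set" where
  "dual_lattice L = {y \<in> vec.span L. \<forall>x\<in>L. ip x y \<in> \<int>}"

text \<open>As usual for lattices, the norm of \<open>v\<close> is \<open>ip v v\<close>, not its square root.\<close>

definition min_vectors :: "(rat ^ 'n) set \<Rightarrow> (rat ^ 'n) set" where
  "min_vectors L = {v \<in> L - {0}. \<forall>w \<in> L - {0}. ip v v \<le> ip w w}"

definition E8_lattice :: "(rat ^ 8) set" where
  "E8_lattice = {x. ((\<forall>i. x $ i \<in> \<int>) \<or> (\<forall>i. x $ i - 1/2 \<in> \<int>)) \<and> (\<Sum>i\<in>UNIV. x $ i) / 2 \<in> \<int>}"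

text \<open>
  The standard coordinates for \<open>E\<^sub>7\<close>: the vectors of \<open>E\<^sub>8\<close> orthogonal to the root
  \<open>(1/2, ..., 1/2)\<close>. It has rank 7, so its dual is taken in the hyperplane of coordinate sum 0.
\<close>

definition E7_lattice :: "(rat ^ 8) set" where
  "E7_lattice = {x \<in> E8_lattice. ip x (\<chi> i. 1/2) = 0}"

definition E7_dual :: "(rat ^ 8) set" where
  "E7_dual = dual_lattice E7_lattice"


section \<open>Matroids\<close>

type_synonym 'a matroid_structure = "'a set \<times> 'a set set"

definition is_matroid :: "'a matroid_structure \<Rightarrow> bool" where
  "is_matroid M \<longleftrightarrow> (case M of (E, \<I>) \<Rightarrow>
     finite E \<and> \<I> \<subseteq> Pow E \<and> \<I> \<noteq> {} \<and>
     (\<forall>A B. B \<in> \<I> \<and> A \<subseteq> B \<longrightarrow> A \<in> \<I>) \<and>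
     (\<forall>A B. A \<in> \<I> \<and> B \<in> \<I> \<and> card A < card B \<longrightarrow> (\<exists>x \<in> B - A. insert x A \<in> \<I>)))"

definition matroid_equiv :: "'a matroid_structure \<Rightarrow> 'b matroid_structure \<Rightarrow> bool" where
  "matroid_equiv M M' \<longleftrightarrow> (case M of (E, \<I>) \<Rightarrow> case M' of (E', \<I>') \<Rightarrow>
     (\<exists>\<phi>. bij_betw \<phi> E E' \<and> (\<forall>I. I \<subseteq> E \<longrightarrow> (I \<in> \<I> \<longleftrightarrow> \<phi> ` I \<in> \<I>'))))"

definition linear_matroid :: "(rat ^ 'n) set \<Rightarrow> (rat ^ 'n) matroid_structure" where
  "linear_matroid S = (S, {I. I \<subseteq> S \<and> vec.independent I})"

lemma is_matroid_linear_matroid: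
  assumes "finite S"
  shows "is_matroid (linear_matroid S)"
proof -
  have "\<exists>x \<in> B - A. insert x A \<subseteq> S \<and> vec.independent (insert x A)"
    if A: "A \<subseteq> S" "vec.independent A" and B: "B \<subseteq> S" "vec.independent B" and "card A < card B"
    for A B
  proof -
    have "\<not> B \<subseteq> vec.span A"
      using vec.independent_span_bound[of A B] A B assms \<open>card A < card B\<close> finite_subset by fastforce
    then obtain x where "x \<in> B" "x \<notin> vec.span A" by blast
    then show ?thesis
      using A B vec.independent_insertI by (intro bexI[of _ x]) (auto dest: vec.span_base)
  qed
  then show ?thesis
    using assms vec.independent_empty
    by (auto simp: is_matroid_def linear_matroid_def dest: vec.independent_mono)
qed


section \<open>Counting matroid structures\<close>

definition matroid_structures :: "(nat \<Rightarrow> rat ^ 'n) \<Rightarrow> nat \<Rightarrow> nat \<Rightarrow> (rat ^ 'n) matroid_structure set" where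
  "matroid_structures l n r = {linear_matroid (l ` J) | J. J \<subseteq> {1..n} \<and> card J = r}"

definition num_matroid_structures :: "(nat \<Rightarrow> rat ^ 'n) \<Rightarrow> nat \<Rightarrow> nat \<Rightarrow> nat" where
  "num_matroid_structures l n r =
     card (matroid_structures l n r //
       {(M, M'). M \<in> matroid_structures l n r \<and> M' \<in> matroid_structures l n r \<and> matroid_equiv M M'})"


section \<open>Agreement with the explicit list of minimal vectors\<close>

lemma sum_if_mem: "(\<Sum>i\<in>UNIV. if i \<in> A then f i else 0) = sum f A" for f :: "8 \<Rightarrow> rat"
  by (simp add: sum.If_cases)

definition E7_min_vec :: "8 \<Rightarrow> 8 \<Rightarrow> rat ^ 8" where
  "E7_min_vec a b = (\<chi> i. if i \<in> {a, b} then - 3/4 else 1/4)"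

lemma E7_lattice_iff: "x \<in> E7_lattice \<longleftrightarrow>
   ((\<forall>i. x $ i \<in> \<int>) \<or> (\<forall>i. x $ i - 1/2 \<in> \<int>)) \<and> (\<Sum>i\<in>UNIV. x $ i) = 0"
proof -
  have "ip x (\<chi> i. 1/2) = (\<Sum>i\<in>UNIV. x $ i) / 2"
    by (simp add: ip_def sum_divide_distrib)
  then show ?thesis by (auto simp: E7_lattice_def E8_lattice_def)
qed

lemma E7_dualD:
  assumes y: "y \<in> E7_dual"
  shows "(\<Sum>i\<in>UNIV. y $ i) = 0" "y $ i - y $ j \<in> \<int>" "4 * y $ k \<in> \<int>"
proof -
  have sp: "y \<in> vec.span E7_lattice" and ip: "\<And>x. x \<in> E7_lattice \<Longrightarrow> ip x y \<in> \<int>"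
    using y by (auto simp: E7_dual_def dual_lattice_def)
  show s0: "(\<Sum>i\<in>UNIV. y $ i) = 0"
    using sp
  proof (induction rule: vec.span_induct_alt)
    case base then show ?case by simp
  next
    case (step c x z)
    then show ?case by (simp add: sum.distrib E7_lattice_iff flip: sum_distrib_left)
  qed
  have d: "y $ i - y $ j \<in> \<int>" for i j
  proof (cases "i = j")
    case False
    let ?x = "axis i 1 - axis j 1 :: rat ^ 8"
    have e: "?x $ k = (if k = i then 1 else 0) - (if k = j then 1 else 0)" for k
      by (auto simp: axis_def)
    have "?x \<in> E7_lattice"
      unfolding E7_lattice_iff e by (auto simp: sum_subtractf)
    moreover have "ip ?x y = y $ i - y $ j"
      unfolding ip_def e by (simp add: left_diff_distrib sum_subtractf if_distrib[of "\<lambda>t. t * _"] cong: if_cong)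
    ultimately show ?thesis using ip by metis
  qed auto
  then show "y $ i - y $ j \<in> \<int>" .
  obtain S :: "8 set" where S: "card S = 4"
    using obtain_subset_with_card_n[of 4 "UNIV :: 8 set"] by auto
  let ?x = "(\<chi> i. (if i \<in> S then 1 else 0) - 1/2) :: rat ^ 8"
  have "?x \<in> E7_lattice"
    unfolding E7_lattice_iff using S by (auto simp: sum_subtractf sum_if_mem)
  then have "ip ?x y \<in> \<int>" by (rule ip)
  moreover have "ip ?x y = (\<Sum>i\<in>S. y $ i)"
    using s0 by (simp add: ip_def left_diff_distrib sum_subtractf if_distrib[of "\<lambda>t. t * _"]
        sum_if_mem flip: sum_divide_distrib cong: if_cong)
  moreover have "(\<Sum>i\<in>S. y $ i) = 4 * y $ k + (\<Sum>i\<in>S. y $ i - y $ k)"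
    using S by (simp add: sum_subtractf)
  moreover have "(\<Sum>i\<in>S. y $ i - y $ k) \<in> \<int>" using d by (intro Ints_sum)
  ultimately have "ip ?x y - (\<Sum>i\<in>S. y $ i - y $ k) \<in> \<int>" "4 * y $ k = ip ?x y - (\<Sum>i\<in>S. y $ i - y $ k)"
    by (blast intro: Ints_diff, linarith)
  then show "4 * y $ k \<in> \<int>" by (simp only:)
qed

lemma Ints_consecutive_nonneg: "(x::rat) \<in> \<int> \<Longrightarrow> x * (x + 1) \<ge> 0"
proof (elim Ints_cases)
  fix n :: int assume "x = of_int n"
  moreover have "n * (n + 1) \<ge> 0"
    by (cases "n \<ge> 0") (auto simp: zero_le_mult_iff)
  ultimately show ?thesis by (metis of_int_0_le_iff of_int_1 of_int_add of_int_mult)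
qed

lemma quarter_coset:
  assumes "(\<Sum>i\<in>UNIV. y $ i) = 0" "\<And>i. y $ i - 1/4 \<in> \<int>"
  shows "ip y y \<ge> 3/2" "ip y y = 3/2 \<Longrightarrow> \<exists>a b. a \<noteq> b \<and> y = E7_min_vec a b"
proof -
  let ?f = "\<lambda>i. (y $ i - 1/4) * (y $ i + 3/4)"
  have nn: "?f i \<ge> 0" for i
    using Ints_consecutive_nonneg[OF assms(2)[of i]] by (simp add: algebra_simps)
  have "(\<Sum>i\<in>UNIV. ?f i) = (\<Sum>i\<in>UNIV. y $ i * y $ i + y $ i / 2 - 3/16)"
    by (intro sum.cong) (auto simp: field_simps)
  also have "\<dots> = ip y y - 3/2"
    using assms(1) by (simp add: sum_subtractf sum.distrib ip_def flip: sum_divide_distrib)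
  finally have eq: "(\<Sum>i\<in>UNIV. ?f i) = ip y y - 3/2" .
  then show "ip y y \<ge> 3/2" using sum_nonneg[of UNIV ?f] nn by simp
  assume "ip y y = 3/2"
  then have "\<forall>i. ?f i = 0" using eq sum_nonneg_eq_0_iff[of UNIV ?f] nn by simp
  then have v: "y $ i = 1/4 \<or> y $ i = -3/4" for i by (auto simp: add_eq_0_iff)
  define A where "A = {i. y $ i = -3/4}"
  have y: "y $ i = 1/4 - (if i \<in> A then 1 else 0)" for i using v[of i] by (auto simp: A_def)
  have "0 = (\<Sum>i\<in>(UNIV::8 set). 1/4 - (if i \<in> A then 1 else 0 :: rat))"
    using assms(1) unfolding y by simp
  also have "\<dots> = 2 - of_nat (card A)" by (simp add: sum_subtractf sum_if_mem)
  finally have "card A = 2" by (metis eq_iff_diff_eq_0 of_nat_eq_iff of_nat_numeral)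
  then obtain a b where "A = {a, b}" "a \<noteq> b" by (auto simp: card_2_iff)
  then show "\<exists>a b. a \<noteq> b \<and> y = E7_min_vec a b"
    using y by (intro exI[of _ a] exI[of _ b]) (auto simp: E7_min_vec_def vec_eq_iff)
qed

lemma Ints_square_ge_1: "(x::rat) \<in> \<int> \<Longrightarrow> x \<noteq> 0 \<Longrightarrow> x * x \<ge> 1"
  using Ints_nonzero_abs_ge1[of x] mult_mono[of 1 "\<bar>x\<bar>" 1 "\<bar>x\<bar>"] by simp

lemma E7_dual_min_norm:
  assumes "y \<in> E7_dual" "y \<noteq> 0"
  shows "ip y y \<ge> 3/2 \<and> (ip y y = 3/2 \<longrightarrow> (\<exists>a b. a \<noteq> b \<and> (y = E7_min_vec a b \<or> y = - E7_min_vec a b)))"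
proof -
  note D = E7_dualD[OF assms(1)]
  obtain m where m: "4 * y $ 1 = of_int m" using D(3)[of 1] Ints_cases by blast
  define n where "n = m div 4"
  define t where "t = m mod 4"
  have "m = 4 * n + t" by (simp add: n_def t_def)
  then have "y $ 1 = of_int n + of_int t / 4" using m by simp
  then have T: "y $ i - of_int t / 4 \<in> \<int>" for i
    proof -
    have "y $ i - of_int t / 4 = (y $ i - y $ 1) + of_int n" using \<open>y $ 1 = _\<close> by linarith
    then show ?thesis using D(2)[of i 1] by (simp only: Ints_add Ints_of_int)
  qed
  have "0 \<le> t" "t < 4" unfolding t_def by simp_all
  then have "t = 0 \<or> t = 1 \<or> t = 2 \<or> t = 3" by linarith
  then consider "t = 0" | "t = 1" | "t = 2" | "t = 3" by blast
  then show ?thesis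
  proof cases
    case 1
    then have I: "y $ i \<in> \<int>" for i using T[of i] by simp
    obtain j where j: "y $ j \<noteq> 0" using assms(2) by (auto simp: vec_eq_iff)
    have "(\<Sum>i\<in>UNIV. y $ i) = y $ j + (\<Sum>i\<in>UNIV-{j}. y $ i)" by (simp add: sum.remove)
    then have "(\<Sum>i\<in>UNIV-{j}. y $ i) \<noteq> 0" using D(1) j by auto
    then obtain k where k: "k \<noteq> j" "y $ k \<noteq> 0" by (auto elim: sum.not_neutral_contains_not_neutral)
    have "(\<Sum>i\<in>{j,k}. y $ i * y $ i) \<le> ip y y" unfolding ip_def by (rule sum_mono2) auto
    then have "y $ j * y $ j + y $ k * y $ k \<le> ip y y" using k(1) by simp
    then have "ip y y \<ge> 2" using Ints_square_ge_1[OF I j] Ints_square_ge_1[OF I k(2)] by linarith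
    then show ?thesis by simp
  next
    case 2
    then show ?thesis using quarter_coset[of y] D(1) T by auto
  next
    case 3
    have "1/4 \<le> y $ i * y $ i" for i
    proof -
      have "0 \<le> (y $ i - 1/2) * (y $ i - 1/2 + 1)"
        using T[of i] 3 by (intro Ints_consecutive_nonneg) simp
      also have "\<dots> = y $ i * y $ i - 1/4" by (simp add: algebra_simps)
      finally show ?thesis by simp
    qed
    then have "(\<Sum>i\<in>(UNIV::8 set). 1/4) \<le> ip y y" unfolding ip_def by (intro sum_mono)
    then have "ip y y \<ge> 2" by simp
    then show ?thesis by simp
  next
    case 4
    have "(- y) $ i - 1/4 \<in> \<int>" for i
    proof -
      have "(- y) $ i - 1/4 = - (y $ i - 3/4) - 1" by simp
      moreover have "y $ i - 3/4 \<in> \<int>" using T[of i] 4 by simp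
      ultimately show ?thesis by (simp only: Ints_1 Ints_diff Ints_minus)
    qed
    moreover have "(\<Sum>i\<in>UNIV. (- y) $ i) = 0" using D(1) by (simp add: sum_negf)
    moreover have "ip (- y) (- y) = ip y y" by (simp add: ip_def)
    ultimately have "ip y y \<ge> 3/2" "ip y y = 3/2 \<Longrightarrow> \<exists>a b. a \<noteq> b \<and> - y = E7_min_vec a b"
      using quarter_coset[of "- y"] by simp_all
    then show ?thesis by (auto simp: minus_equation_iff[of y] eq_commute[of _ y])
  qed
qed

lemma E7_min_vec_props:
  assumes "a \<noteq> b"
  shows "(\<Sum>i\<in>UNIV. E7_min_vec a b $ i) = 0" "ip (E7_min_vec a b) (E7_min_vec a b) = 3/2" "E7_min_vec a b \<in> E7_dual" "- E7_min_vec a b \<in> E7_dual"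
    "E7_min_vec a b \<noteq> 0"
proof -
  have e: "E7_min_vec a b $ i = 1/4 - (if i \<in> {a, b} then 1 else 0)" for i by (simp add: E7_min_vec_def)
  have c: "card {a, b} = 2" using assms by simp
  show s: "(\<Sum>i\<in>UNIV. E7_min_vec a b $ i) = 0" unfolding e using c by (simp add: sum_subtractf sum_if_mem del: insert_iff)
  have "E7_min_vec a b $ i * E7_min_vec a b $ i = 1/16 + (if i \<in> {a, b} then 1/2 else 0)" for i by (simp add: e)
  then have "ip (E7_min_vec a b) (E7_min_vec a b) = (\<Sum>i\<in>UNIV. 1/16 + (if i \<in> {a, b} then 1/2 else 0))"
    unfolding ip_def by simp
  then show "ip (E7_min_vec a b) (E7_min_vec a b) = 3/2"
    using c by (simp add: sum.distrib sum_if_mem del: insert_iff)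
  have "(4::rat) *s E7_min_vec a b \<in> E7_lattice"
  proof -
    have "(\<Sum>i\<in>UNIV. ((4::rat) *s E7_min_vec a b) $ i) = 0" using s by (simp flip: sum_distrib_left)
    moreover have "((4::rat) *s E7_min_vec a b) $ i \<in> \<int>" for i by (simp add: E7_min_vec_def)
    ultimately show ?thesis unfolding E7_lattice_iff by blast
  qed
  then have "(1/4::rat) *s ((4::rat) *s E7_min_vec a b) \<in> vec.span E7_lattice"
    by (intro vec.span_scale vec.span_base)
  then have sp: "E7_min_vec a b \<in> vec.span E7_lattice" by simp
  have ip: "ip x (E7_min_vec a b) = - (x $ a + x $ b)" if "x \<in> E7_lattice" for x
  proof -
    have "ip x (E7_min_vec a b) = (\<Sum>i\<in>UNIV. x $ i / 4 - (if i \<in> {a, b} then x $ i else 0))"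
      unfolding ip_def e by (intro sum.cong) (auto simp: algebra_simps)
    also have "\<dots> = - (\<Sum>i\<in>{a,b}. x $ i)"
      using that by (simp add: E7_lattice_iff sum_subtractf sum_if_mem del: insert_iff flip: sum_divide_distrib)
    finally show ?thesis using assms by simp
  qed
  have "x $ a + x $ b \<in> \<int>" if xE: "x \<in> E7_lattice" for x
  proof -
    consider "x $ a \<in> \<int>" "x $ b \<in> \<int>" | "x $ a - 1/2 \<in> \<int>" "x $ b - 1/2 \<in> \<int>"
      using xE unfolding E7_lattice_iff by blast
    then show ?thesis
    proof cases
      case 2
      have "x $ a + x $ b = (x $ a - 1/2) + (x $ b - 1/2) + 1" by simp
      then show ?thesis using 2 by (metis Ints_1 Ints_add)
    qed auto
  qed
  then have I: "ip x (E7_min_vec a b) \<in> \<int>" if "x \<in> E7_lattice" for x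
    unfolding ip[OF that] using Ints_minus \<open>\<And>x. x \<in> E7_lattice \<Longrightarrow> x $ a + x $ b \<in> \<int>\<close> that by blast
  then show "E7_min_vec a b \<in> E7_dual" using sp by (simp add: E7_dual_def dual_lattice_def)
  have "ip x (- E7_min_vec a b) = - ip x (E7_min_vec a b)" for x by (simp add: ip_def sum_negf)
  then show "- E7_min_vec a b \<in> E7_dual"
    using sp I vec.span_neg by (simp add: E7_dual_def dual_lattice_def)
  have "E7_min_vec a b $ i \<noteq> 0" for i by (simp add: E7_min_vec_def)
  then show "E7_min_vec a b \<noteq> 0" by (metis zero_index)
qed

lemma min_vectors_E7_dual:
  "min_vectors E7_dual = {v. \<exists>a b. a \<noteq> b \<and> (v = E7_min_vec a b \<or> v = - E7_min_vec a b)}"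
proof -
  have n: "ip (- y) (- y) = ip y y" for y :: "rat^8" by (simp add: ip_def)
  have "(0::8) \<noteq> 1" by simp
  note p = E7_min_vec_props[OF this]
  show ?thesis
  proof safe
    fix v assume "v \<in> min_vectors E7_dual"
    then have v: "v \<in> E7_dual" "v \<noteq> 0" "ip v v \<le> 3/2" using p unfolding min_vectors_def
      by (auto dest!: bspec[of _ _ "E7_min_vec 0 1"])
    then show "\<exists>a b. a \<noteq> b \<and> (v = E7_min_vec a b \<or> v = - E7_min_vec a b)"
      using E7_dual_min_norm by (metis order_antisym)
  next
    fix a b :: 8 assume ab: "a \<noteq> b"
    have "ip (E7_min_vec a b) (E7_min_vec a b) \<le> ip w w" if "w \<in> E7_dual" "w \<noteq> 0" for w
      using E7_dual_min_norm[OF that] E7_min_vec_props(2)[OF ab] by linarith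
    then show "E7_min_vec a b \<in> min_vectors E7_dual" "- E7_min_vec a b \<in> min_vectors E7_dual"
      using E7_min_vec_props(3-5)[OF ab] n by (auto simp: min_vectors_def)
  qed
qed

lemma card_E7_min_pairs: "card {{v, - v} | v. v \<in> min_vectors E7_dual} = 28"
proof -
  define A where "A = {K :: 8 set. card K = 2}"
  define w where "w K = ((\<chi> i. if i \<in> K then - 3/4 else 1/4) :: rat ^ 8)" for K :: "8 set"
  have "K = L" if "{w K, - w K} = {w L, - w L}" "K \<in> A" "L \<in> A" for K L
  proof -
    have "w K = w L \<or> w K = - w L" using that by (auto simp: doubleton_eq_iff)
    then show ?thesis
    proof
      assume "w K = w L" then show ?thesis by (auto simp: w_def vec_eq_iff split: if_splits)
    next
      assume *: "w K = - w L"
      have "False" if "i \<notin> K" "i \<notin> L" for i using arg_cong[OF *, of "\<lambda>v. v $ i"] that by (simp add: w_def)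
      then have "UNIV \<subseteq> K \<union> L" by auto
      then have "card (UNIV :: 8 set) \<le> card (K \<union> L)" by (intro card_mono) auto
      also have "\<dots> \<le> 4" using card_Un_le[of K L] that by (auto simp: A_def)
      finally show ?thesis by simp
    qed
  qed
  then have "card ((\<lambda>K. {w K, - w K}) ` A) = card A" by (intro card_image inj_onI)
  moreover have "card A = 28"
    using n_subsets[of "UNIV :: 8 set" 2] by (simp add: A_def choose_two)
  moreover have "(\<lambda>K. {w K, - w K}) ` A = {{v, - v} | v. v \<in> min_vectors E7_dual}"
  proof safe
    fix K assume "K \<in> A"
    then obtain a b where "a \<noteq> b" "K = {a,b}" by (auto simp: A_def card_2_iff)
    then show "\<exists>v. {w K, - w K} = {v, - v} \<and> v \<in> min_vectors E7_dual"
      unfolding min_vectors_E7_dual by (intro exI[of _ "E7_min_vec a b"]) (auto simp: E7_min_vec_def w_def)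
  next
    fix v assume "v \<in> min_vectors E7_dual"
    then obtain a b where "a \<noteq> b" "v = E7_min_vec a b \<or> v = - E7_min_vec a b" unfolding min_vectors_E7_dual by auto
    then show "{v, - v} \<in> (\<lambda>K. {w K, - w K}) ` A"
      by (intro image_eqI[of _ _ "{a,b}"]) (auto simp: A_def E7_min_vec_def w_def)
  qed
  ultimately show ?thesis by simp
qed

lemma E7_min_pairs_enumeration:
  "\<exists>l. bij_betw (\<lambda>i. {l i, - l i}) {1..28::nat} {{v, - v} | v. v \<in> min_vectors E7_dual}"
proof -
  define P where "P = {{v, - v} | v. v \<in> min_vectors E7_dual}"
  have c: "card P = 28" unfolding P_def by (rule card_E7_min_pairs)
  have "finite P" by (rule card_ge_0_finite) (simp add: c)
  then obtain h where h: "bij_betw h {1..28::nat} P"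
    using ex_bij_betw_nat_finite_1[of P] unfolding c by blast
  have "\<exists>v. h i = {v, - v}" if "i \<in> {1..28}" for i
  proof -
    have "h i \<in> P" using h that by (rule bij_betw_apply)
    then show ?thesis unfolding P_def by blast
  qed
  then have "\<forall>i\<in>{1..28}. \<exists>v. h i = {v, - v}" by blast
  from bchoice[OF this] obtain l where l: "\<forall>i\<in>{1..28}. h i = {l i, - l i}" by blast
  have "bij_betw (\<lambda>i. {l i, - l i}) {1..28} P"
    using h bij_betw_cong[of "{1..28}" h "\<lambda>i. {l i, - l i}" P] l by simp
  then show ?thesis unfolding P_def by blast
qed

end

theory Submission
  imports Defs
begin

text \<open>
  The 28 pairs of minimal vectors are labelled by the edges of the complete graph on 8 vertices: the
  edge says where the two coordinates \<open>-3/4\<close> are. Two vectors of different pairs have inner product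
  \<open>\<plusminus>1/2\<close>, positive exactly if the edges meet, so the 28 lines are equiangular. Which linear relations
  hold is governed by the triples whose three signs have product \<open>-1\<close>; this product does not
  change when vectors are replaced by their negatives, and \<open>neg\<close> is the resulting two-graph.

  Matroids are told apart by counting circuits. Four numbers are used: the number of circuits of
  size 6, the sum of the fourth powers of the numbers of 4-circuits through each element, the number
  of circuits of size 7, and the sum of the squares of the numbers of 6-circuits through each
  element. Equivalent matroids agree in them (\<open>circuit_invariant_equiv\<close>), so \<open>N\<^sub>r\<close> is at least the number of
  values that they take (\<open>card_circuit_invariants_le\<close>), and it suffices to list \<open>n\<^sub>r\<close> subsets with different
  values. The lists are \<open>certificate_1\<close> to \<open>certificate_28\<close>; each one is in strictly ascending lexicographic
  order of the first two numbers and one of the others, so that only neighbours have to be compared.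

  What remains is to understand the short circuits well enough to count them. Reducing a primitive
  integer relation modulo 2 shows that the points with odd coefficient form a set, of even size,
  half of whose sum lies in the dual lattice (\<open>dep_imp_half\<close>). As no nonzero dual vector has norm
  below \<open>3/2\<close>, such a set has at least 4 points, and one of exactly 4 points has a vanishing sum with
  suitable signs (\<open>half_4_imp_balanced\<close>). It follows that the circuits of size 4 and 6 are exactly the sets
  of that size with a vanishing signed sum (\<open>circuit_4_iff_balanced\<close>, \<open>circuit_6_iff_balanced\<close>),
  and that the circuits of size 7 arise from six points without negative triple by adding a point
  whose signs split the six evenly (\<open>card_circuits_7\<close>).

  Circuits of size 6 are counted through their negative triples. A negative triple has exactly one
  point that completes it to a 4-circuit. In a 6-circuit a negative triple and its complement are
  completed by the same point, there are always 8 negative triples, and conversely two disjoint triples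
  completed by the same point form a 6-circuit. Hence 8 times the number of 6-circuits is the number of
  ordered pairs of disjoint triples with the same completing point (\<open>eight_circuits_6\<close>), and since two
  such triples meet in at most one point this is a quadratic expression in the numbers of triples
  completed by \<open>x\<close> that contain \<open>y\<close> (\<open>eight_circuits_6_sum\<close>). Those numbers are read off from the
  sizes of 63 classes of pairs (\<open>card_completed_through\<close>), because \<open>{x, y, a, b}\<close> is a 4-circuit exactly if
  \<open>{x, y}\<close> and \<open>{a, b}\<close> are in the same class (\<open>balanced_iff_pair_class\<close>).
\<close>

section \<open>Inner products and the dual lattice\<close>

lemma ip_commute: "ip x y = ip y x"
  by (simp add: ip_def mult.commute)

lemma ip_add_left: "ip (x + y) z = ip x z + ip y z"
  by (simp add: ip_def distrib_right sum.distrib)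

lemma ip_scale_left: "ip (c *s x) y = c * ip x y"
  by (simp add: ip_def sum_distrib_left mult.assoc)

lemma ip_uminus_left: "ip (- x) y = - ip x y"
  by (simp add: ip_def sum_negf)

lemma ip_zero_left: "ip 0 y = 0"
  by (simp add: ip_def)

lemma ip_sum_left: "ip (\<Sum>i\<in>A. f i) y = (\<Sum>i\<in>A. ip (f i) y)"
  by (induction A rule: infinite_finite_induct) (simp_all add: ip_zero_left ip_add_left)

lemma ip_add_right: "ip z (x + y) = ip z x + ip z y"
  by (simp add: ip_def distrib_left sum.distrib)

lemma ip_scale_right: "ip y (c *s x) = c * ip y x"
  by (simp add: ip_def sum_distrib_left mult.left_commute)

lemma ip_uminus_right: "ip y (- x) = - ip y x"
  by (simp add: ip_def sum_negf)

lemma ip_zero_right: "ip y 0 = 0"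
  by (simp add: ip_def)

lemma ip_sum_right: "ip y (\<Sum>i\<in>A. f i) = (\<Sum>i\<in>A. ip y (f i))"
  by (induction A rule: infinite_finite_induct) (simp_all add: ip_zero_right ip_add_right)

lemmas ip_linear = ip_add_left ip_scale_left ip_uminus_left ip_zero_left
  ip_add_right ip_scale_right ip_uminus_right ip_zero_right

lemma ip_self_eq_0D: "ip x x = 0 \<Longrightarrow> x = 0"
  unfolding ip_def by (subst (asm) sum_nonneg_eq_0_iff) (auto simp: vec_eq_iff)

lemma E7_dual_add: "x \<in> E7_dual \<Longrightarrow> y \<in> E7_dual \<Longrightarrow> x + y \<in> E7_dual"
  by (auto simp: E7_dual_def dual_lattice_def ip_add_right intro: vec.span_add)

lemma E7_dual_uminus: "x \<in> E7_dual \<Longrightarrow> - x \<in> E7_dual"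
  by (auto simp: E7_dual_def dual_lattice_def ip_uminus_right intro: vec.span_neg)

lemma E7_dual_zero: "0 \<in> E7_dual"
  by (auto simp: E7_dual_def dual_lattice_def ip_zero_right intro: vec.span_zero)

lemma E7_dual_scale_int: "x \<in> E7_dual \<Longrightarrow> of_int k *s x \<in> E7_dual"
  by (auto simp: E7_dual_def dual_lattice_def ip_scale_right intro: vec.span_scale)

lemma E7_dual_diff: "x \<in> E7_dual \<Longrightarrow> y \<in> E7_dual \<Longrightarrow> x - y \<in> E7_dual"
  using E7_dual_add[OF _ E7_dual_uminus, of x y] by simp

lemma E7_dual_sum: "(\<And>i. i \<in> A \<Longrightarrow> f i \<in> E7_dual) \<Longrightarrow> (\<Sum>i\<in>A. f i) \<in> E7_dual"
  by (induction A rule: infinite_finite_induct) (auto intro: E7_dual_zero E7_dual_add)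

lemma E7_dual_short_eq_0: "y \<in> E7_dual \<Longrightarrow> ip y y < 3/2 \<Longrightarrow> y = 0"
  using E7_dual_min_norm[of y] by fastforce

section \<open>The minimal vectors as edges of a complete graph\<close>

text \<open>
  Edges of the complete graph on \<open>{0..7}\<close>, as 8-bit numbers with two bits set: intersections and
  symmetric differences of edges become bit operations on numerals.
\<close>

definition masks :: "nat list" where
  "masks = [2 ^ a + 2 ^ b. b \<leftarrow> [0..<8], a \<leftarrow> [0..<b]]"

definition ends :: "nat \<Rightarrow> nat set" where
  "ends i = {k. bit (masks ! i) k}"

text \<open>
  The numeral type that indexes coordinates is matched with \<open>{0..7}\<close> by an arbitrary bijection;
  the root lattice is invariant under permutations of coordinates.
\<close>

definition vtx :: "nat \<Rightarrow> 8" where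
  "vtx = (SOME f. bij_betw f {..<8} UNIV)"

definition pt :: "nat \<Rightarrow> rat ^ 8" where
  "pt i = (\<chi> v. if v \<in> vtx ` ends i then - 3/4 else 1/4)"

lemma bij_vtx: "bij_betw vtx {..<8} UNIV"
proof -
  have "\<exists>f. bij_betw f {..<8::nat} (UNIV :: 8 set)"
    by (intro finite_same_card_bij) auto
  then show ?thesis unfolding vtx_def by (rule someI_ex)
qed

lemma sum_vtx: "(\<Sum>v\<in>UNIV. f v) = (\<Sum>k<8. f (vtx k))"
  using sum.reindex_bij_betw[OF bij_vtx, of f] by simp

lemma vtx_eq_iff: "j < 8 \<Longrightarrow> k < 8 \<Longrightarrow> vtx j = vtx k \<longleftrightarrow> j = k"
  using bij_vtx by (auto simp: bij_betw_def inj_on_def)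

lemma masks_literal: "masks = [3, 5, 6, 9, 10, 12, 17, 18, 20, 24, 33, 34, 36, 40, 48,
   65, 66, 68, 72, 80, 96, 129, 130, 132, 136, 144, 160, 192]"
  by (simp add: masks_def upt_conv_Cons)

lemma length_masks: "length masks = 28" and distinct_masks: "distinct masks"
  by (simp_all add: masks_literal)

lemma set_masks: "set masks = {2 ^ a + 2 ^ b |a b. a < b \<and> b < 8}"
  unfolding masks_def by (auto; blast)

lemma bit_two_powers: "a \<noteq> b \<Longrightarrow> bit (2 ^ a + 2 ^ b :: nat) k \<longleftrightarrow> k = a \<or> k = b"
  by (subst disjunctive_add) (auto simp: bit_or_iff bit_exp_iff)

lemma ends_obtain:
  assumes "i < 28"
  obtains a b where "a < b" "b < 8" "ends i = {a, b}" "masks ! i = 2 ^ a + 2 ^ b"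
proof -
  have "masks ! i \<in> set masks" using assms length_masks by simp
  then obtain a b where "a < b" "b < 8" "masks ! i = 2 ^ a + 2 ^ b" unfolding set_masks by auto
  moreover from this have "ends i = {a, b}" unfolding ends_def by (auto simp: bit_two_powers)
  ultimately show ?thesis using that by blast
qed

lemma card_ends: "i < 28 \<Longrightarrow> card (ends i) = 2"
  by (erule ends_obtain) auto

lemma ends_subset: "i < 28 \<Longrightarrow> ends i \<subseteq> {..<8}"
  by (erule ends_obtain) auto

lemma ends_inj: "i < 28 \<Longrightarrow> j < 28 \<Longrightarrow> ends i = ends j \<Longrightarrow> i = j"
proof -
  assume "i < 28" "j < 28" "ends i = ends j"
  then have "masks ! i = masks ! j" by (auto simp: ends_def set_eq_iff bit_eq_iff)
  then show "i = j" using \<open>i < 28\<close> \<open>j < 28\<close> distinct_masks length_masks by (simp add: nth_eq_iff_index_eq)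
qed

lemma ends_surj: "a < b \<Longrightarrow> b < 8 \<Longrightarrow> \<exists>i<28. ends i = {a, b}"
proof -
  assume ab: "a < b" "b < 8"
  then have "2 ^ a + 2 ^ b \<in> set masks" unfolding set_masks by blast
  then obtain i where "i < 28" "masks ! i = 2 ^ a + 2 ^ b" unfolding in_set_conv_nth length_masks by blast
  moreover from this ab have "ends i = {a, b}" unfolding ends_def by (auto simp: bit_two_powers)
  ultimately show ?thesis by blast
qed

lemma pt_vtx: "i < 28 \<Longrightarrow> k < 8 \<Longrightarrow> pt i $ vtx k = 1/4 - of_bool (k \<in> ends i)"
  using ends_subset[of i] vtx_eq_iff by (auto simp: pt_def image_iff subset_iff)

lemma pt_eq_min_vec: "i < 28 \<Longrightarrow> \<exists>a b. a \<noteq> b \<and> pt i = E7_min_vec a b"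
proof (erule ends_obtain)
  fix a b assume "a < b" "b < 8" "ends i = {a, b}"
  then show ?thesis using vtx_eq_iff[of a b]
    by (intro exI[of _ "vtx a"] exI[of _ "vtx b"]) (auto simp: pt_def E7_min_vec_def vec_eq_iff)
qed

lemma pt_in_E7_dual: "i < 28 \<Longrightarrow> pt i \<in> E7_dual"
  using pt_eq_min_vec[of i] E7_min_vec_props by auto

lemma min_vec_eq_pt:
  assumes "a \<noteq> b" shows "\<exists>i<28. E7_min_vec a b = pt i"
proof -
  have *: "\<exists>j<8. v = vtx j" for v
    using bij_vtx unfolding bij_betw_def by blast
  obtain j k where jk: "j < 8" "k < 8" "a = vtx j" "b = vtx k"
    using *[of a] *[of b] by blast
  then consider "j < k" | "k < j" using assms by fastforce
  then have "\<exists>i<28. ends i = {j, k}"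
    using ends_surj[of j k] ends_surj[of k j] jk(1,2) by (metis insert_commute)
  then obtain i where "i < 28" "ends i = {j, k}" by blast
  then show ?thesis unfolding jk pt_def E7_min_vec_def by (intro exI[of _ i]) simp
qed

lemma short_vector_eq_pt:
  assumes "y \<in> E7_dual" "ip y y = 3/2"
  shows "\<exists>i<28. y = pt i \<or> y = - pt i"
proof -
  have "y \<noteq> 0" using assms(2) by (auto simp: ip_zero_left)
  then obtain a b where "a \<noteq> b" "y = E7_min_vec a b \<or> y = - E7_min_vec a b"
    using E7_dual_min_norm assms by blast
  then show ?thesis using min_vec_eq_pt by metis
qed

text \<open>
  Twice the inner product of two different points; on the diagonal the value is \<open>1\<close>, while twice
  the norm is \<open>3\<close>.
\<close>

definition sg :: "nat \<Rightarrow> nat \<Rightarrow> rat" where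
  "sg i j = (if ends i \<inter> ends j = {} then - 1 else 1)"

lemma sg_commute: "sg i j = sg j i"
  by (simp add: sg_def Int_commute)

lemma sg_cases: "sg i j = 1 \<or> sg i j = - 1"
  by (simp add: sg_def)

lemma ip_pt_card:
  assumes "i < 28" "j < 28"
  shows "ip (pt i) (pt j) = of_nat (card (ends i \<inter> ends j)) - 1/2"
proof -
  have c: "(\<Sum>k<8. of_bool (k \<in> A)) = (of_nat (card A) :: rat)" if "A \<subseteq> {..<8}" for A :: "nat set"
    using that by (simp add: sum.If_cases of_bool_def Int_absorb1)
  have "ip (pt i) (pt j) = (\<Sum>k<8. (1/4 - of_bool (k \<in> ends i)) * (1/4 - of_bool (k \<in> ends j)))"
    using assms by (simp add: ip_def sum_vtx pt_vtx)
  also have "\<dots> = (\<Sum>k<8. 1/16 - of_bool (k \<in> ends i) / 4 - of_bool (k \<in> ends j) / 4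
      + of_bool (k \<in> ends i \<inter> ends j))"
    by (intro sum.cong) auto
  also have "\<dots> = 1/2 - of_nat (card (ends i)) / 4 - of_nat (card (ends j)) / 4 + of_nat (card (ends i \<inter> ends j))"
    unfolding sum.distrib sum_subtractf sum_divide_distrib[symmetric]
    by (subst (1 2 3) c) (use assms ends_subset in \<open>auto dest: subsetD\<close>)
  finally show ?thesis using assms by (simp add: card_ends)
qed

lemma ip_pt_same: "i < 28 \<Longrightarrow> ip (pt i) (pt i) = 3/2"
  by (simp add: ip_pt_card card_ends)

lemma ip_pt:
  assumes "i < 28" "j < 28" "i \<noteq> j"
  shows "ip (pt i) (pt j) = sg i j / 2"
proof (cases "ends i \<inter> ends j = {}")
  case True then show ?thesis using assms by (simp add: ip_pt_card sg_def)
next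
  case False
  have fin: "finite (ends i)" "finite (ends j)"
    using assms by (auto intro: card_ge_0_finite simp: card_ends)
  have "card (ends i \<inter> ends j) \<noteq> 2"
  proof
    assume "card (ends i \<inter> ends j) = 2"
    then have "ends i \<inter> ends j = ends i" "ends i \<inter> ends j = ends j"
      using assms fin by (intro card_subset_eq; simp add: card_ends)+
    then show False using ends_inj assms by metis
  qed
  moreover have "card (ends i \<inter> ends j) \<le> 2" "card (ends i \<inter> ends j) \<noteq> 0"
    using card_mono[of "ends i" "ends i \<inter> ends j"] assms fin False by (auto simp: card_ends)
  ultimately have "card (ends i \<inter> ends j) = 1" by linarith
  then show ?thesis using assms False by (simp add: ip_pt_card sg_def)
qed

section \<open>Relations modulo two\<close>

text \<open>
  The class of the sum of \<open>S\<close> in the dual lattice modulo twice the lattice vanishes.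
\<close>

definition half :: "nat set \<Rightarrow> bool" where
  "half S \<longleftrightarrow> (1/2) *s (\<Sum>i\<in>S. pt i) \<in> E7_dual"

definition signing :: "(nat \<Rightarrow> rat) \<Rightarrow> bool" where
  "signing e \<longleftrightarrow> (\<forall>i. e i = 1 \<or> e i = - 1)"

definition balanced :: "nat set \<Rightarrow> bool" where
  "balanced S \<longleftrightarrow> (\<exists>e. signing e \<and> (\<Sum>i\<in>S. e i *s pt i) = 0)"

definition dep :: "nat set \<Rightarrow> bool" where
  "dep S \<longleftrightarrow> (\<exists>c. (\<exists>i\<in>S. c i \<noteq> 0) \<and> (\<Sum>i\<in>S. c i *s pt i) = 0)"

text \<open>
  The product of the three signs is unchanged when a vector is replaced by its negative, since two
  of the signs change.
\<close>

definition neg :: "nat \<Rightarrow> nat \<Rightarrow> nat \<Rightarrow> bool" where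
  "neg i j k \<longleftrightarrow> i \<noteq> j \<and> j \<noteq> k \<and> i \<noteq> k \<and> sg i j * sg j k * sg i k = - 1"

lemma signing_square: "signing e \<Longrightarrow> e i * e i = 1"
  unfolding signing_def by (metis minus_mult_minus mult_1)

lemma sg_square: "sg i j * sg i j = 1"
  using sg_cases[of i j] by auto

lemma signed_sg_cases: "signing e \<Longrightarrow> e i * sg i j = 1 \<or> e i * sg i j = - 1"
  using sg_cases[of i j] unfolding signing_def by (metis mult.left_neutral mult_minus1 minus_minus)

lemma signed_signed_sg_cases: "signing e \<Longrightarrow> e i * e j * sg i j = 1 \<or> e i * e j * sg i j = - 1"
  using sg_cases[of i j] unfolding signing_def by (metis mult.left_neutral mult_minus1 minus_minus)

text \<open>
  A change of sign alters the half sum by a lattice vector. This permits choosing the signs so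
  that the half sum is short.
\<close>

lemma half_signing_iff:
  assumes "S \<subseteq> {..<28}" "signing e"
  shows "half S \<longleftrightarrow> (1/2) *s (\<Sum>i\<in>S. e i *s pt i) \<in> E7_dual"
proof -
  define d where "d = (\<Sum>i\<in>S. ((1 - e i) / 2) *s pt i)"
  have d: "d \<in> E7_dual" unfolding d_def
  proof (rule E7_dual_sum)
    fix i assume "i \<in> S"
    then have "pt i \<in> E7_dual" using assms(1) pt_in_E7_dual by auto
    then show "((1 - e i) / 2) *s pt i \<in> E7_dual"
      using assms(2) E7_dual_zero unfolding signing_def by (elim allE[of _ i] disjE) auto
  qed
  have eq: "(1/2) *s (\<Sum>i\<in>S. pt i) = (1/2) *s (\<Sum>i\<in>S. e i *s pt i) + d"
    unfolding d_def vec.scale_sum_right sum.distrib[symmetric]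
    by (intro sum.cong refl) (simp add: vec_eq_iff field_simps)
  show ?thesis
  proof
    assume "half S"
    then have "(1/2) *s (\<Sum>i\<in>S. e i *s pt i) + d - d \<in> E7_dual"
      unfolding half_def eq using d by (rule E7_dual_diff)
    then show "(1/2) *s (\<Sum>i\<in>S. e i *s pt i) \<in> E7_dual" by (simp only: add_diff_cancel)
  next
    assume "(1/2) *s (\<Sum>i\<in>S. e i *s pt i) \<in> E7_dual"
    then show "half S" unfolding half_def eq using d by (rule E7_dual_add)
  qed
qed

lemma half_diff:
  assumes "finite S" "T \<subseteq> S" "half S" "half T"
  shows "half (S - T)"
  using E7_dual_diff[of "(1/2) *s (\<Sum>i\<in>S. pt i)" "(1/2) *s (\<Sum>i\<in>T. pt i)"] assms
  by (simp add: half_def sum_diff vec.scale_right_diff_distrib)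

lemma balanced_imp_half: "S \<subseteq> {..<28} \<Longrightarrow> balanced S \<Longrightarrow> half S"
  by (auto simp: balanced_def half_signing_iff E7_dual_zero)

lemma two_ip_sum_pt:
  assumes "S \<subseteq> {..<28}" "j \<in> S"
  shows "2 * ip (\<Sum>i\<in>S. c i *s pt i) (pt j) = 3 * c j + (\<Sum>i\<in>S - {j}. c i * sg i j)"
proof -
  have fin: "finite S" using assms(1) finite_subset by blast
  have "2 * ip (\<Sum>i\<in>S. c i *s pt i) (pt j) = 2 * (\<Sum>i\<in>S. c i * ip (pt i) (pt j))"
    by (simp add: ip_sum_left ip_scale_left)
  also have "\<dots> = 2 * (c j * ip (pt j) (pt j)) + 2 * (\<Sum>i\<in>S - {j}. c i * ip (pt i) (pt j))"
    using sum.remove[OF fin assms(2), of "\<lambda>i. c i * ip (pt i) (pt j)"] by (simp add: distrib_left)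
  also have "(\<Sum>i\<in>S - {j}. c i * ip (pt i) (pt j)) = (\<Sum>i\<in>S - {j}. c i * sg i j / 2)"
    using assms by (intro sum.cong refl) (auto simp: ip_pt subset_iff)
  finally show ?thesis using assms by (simp add: ip_pt_same subset_iff flip: sum_divide_distrib)
qed

lemma gram_row:
  assumes "S \<subseteq> {..<28}" "(\<Sum>i\<in>S. c i *s pt i) = 0" "j \<in> S"
  shows "3 * c j + (\<Sum>i\<in>S - {j}. c i * sg i j) = 0"
  unfolding two_ip_sum_pt[OF assms(1,3), symmetric] assms(2) by (simp add: ip_zero_left)

text \<open>A combination of vectors that is orthogonal to each of them has norm zero.\<close>

lemma gram_rows_imp_zero:
  assumes "S \<subseteq> {..<28}" "\<And>j. j \<in> S \<Longrightarrow> 3 * c j + (\<Sum>i\<in>S - {j}. c i * sg i j) = 0"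
  shows "(\<Sum>i\<in>S. c i *s pt i) = 0"
proof -
  have "ip (\<Sum>i\<in>S. c i *s pt i) (pt j) = 0" if "j \<in> S" for j
    using two_ip_sum_pt[OF assms(1) that, of c] assms(2)[OF that] by simp
  then have "ip (\<Sum>i\<in>S. c i *s pt i) (\<Sum>i\<in>S. c i *s pt i) = 0"
    by (subst ip_sum_right) (simp add: ip_scale_right)
  then show ?thesis by (rule ip_self_eq_0D)
qed

lemma common_denominator:
  assumes "finite S"
  shows "\<exists>D::int. D \<noteq> 0 \<and> (\<forall>i\<in>S. \<exists>k. of_int D * c i = (of_int k :: rat))"
  using assms
proof (induction S)
  case empty then show ?case by (auto intro: exI[of _ 1])
next
  case (insert x S)
  then obtain D where D: "D \<noteq> 0" "\<forall>i\<in>S. \<exists>k. of_int D * c i = (of_int k :: rat)" by blast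
  obtain p q where pq: "quotient_of (c x) = (p, q)" by fastforce
  then have q: "q > 0" "c x = of_int p / of_int q" using quotient_of_denom_pos quotient_of_div by blast+
  have A: "\<exists>k. of_int (D * q) * c i = (of_int k :: rat)" if "i \<in> insert x S" for i
  proof (cases "i = x")
    case True
    have "of_int (D * q) * c i = (of_int (D * p) :: rat)" unfolding True q(2) using q(1) by simp
    then show ?thesis by (rule exI)
  next
    case False
    then have "i \<in> S" using that by simp
    from bspec[OF D(2) this] obtain k where k: "of_int D * c i = (of_int k :: rat)" by (rule exE)
    have "of_int (D * q) * c i = of_int q * (of_int D * c i)" by (simp only: of_int_mult mult_ac)
    also have "\<dots> = of_int (q * k)" unfolding k by (simp only: of_int_mult)
    finally show ?thesis by (rule exI)
  qed
  have B: "D * q \<noteq> 0" using D(1) q(1) by simp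
  show ?case by (rule exI[of _ "D * q"], intro conjI B ballI A)
qed

lemma dep_obtain_primitive:
  assumes "finite S" "dep S"
  obtains k :: "nat \<Rightarrow> int" where "\<exists>i\<in>S. odd (k i)" "(\<Sum>i\<in>S. of_int (k i) *s pt i) = 0"
proof -
  obtain c i0 where c: "i0 \<in> S" "c i0 \<noteq> 0" "(\<Sum>i\<in>S. c i *s pt i) = 0"
    using assms(2) unfolding dep_def by blast
  obtain D :: int where D: "D \<noteq> 0" "\<forall>i\<in>S. \<exists>k. of_int D * c i = (of_int k :: rat)"
    using common_denominator[OF assms(1)] by blast
  from bchoice[OF D(2)] obtain m where m: "\<And>i. i \<in> S \<Longrightarrow> of_int D * c i = of_int (m i)" by blast
  have m0: "m i0 \<noteq> 0" using m[OF c(1)] D(1) c(2) by auto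
  define g where "g = Gcd (m ` S)"
  have g: "g \<noteq> 0" using m0 c(1) by (auto simp: g_def)
  define k where "k i = m i div g" for i
  have mk: "m i = g * k i" if "i \<in> S" for i using that by (simp add: k_def g_def)
  have "(\<Sum>i\<in>S. of_int (m i) *s pt i) = of_int D *s (\<Sum>i\<in>S. c i *s pt i)"
    by (simp add: vec.scale_sum_right m)
  then have "of_int g *s (\<Sum>i\<in>S. of_int (k i) *s pt i) = 0"
    using c(3) by (simp add: vec.scale_sum_right mk)
  then have z: "(\<Sum>i\<in>S. of_int (k i) *s pt i) = 0" using g by simp
  have "\<exists>i\<in>S. odd (k i)"
  proof (rule ccontr)
    assume "\<not> (\<exists>i\<in>S. odd (k i))"
    then have "2 * g dvd m i" if "i \<in> S" for i using mk[OF that] that by (auto simp: mult.commute[of 2])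
    then have "2 * g dvd Gcd (m ` S)" by (intro Gcd_greatest) blast
    then have "2 * g dvd g" by (simp only: g_def)
    then show False using g dvd_imp_le_int[of g "2 * g"] by simp
  qed
  then show ?thesis using z that by blast
qed

text \<open>
  In a primitive integer relation the even coefficients contribute twice a lattice vector, so the
  half sum over the odd ones is a lattice vector. All coordinates of the points are congruent to
  \<open>1/4\<close> modulo 1, so the coefficients add up to a multiple of 4; hence an even number of them is
  odd.
\<close>

lemma dep_imp_half:
  assumes "S \<subseteq> {..<28}" "dep S"
  obtains T where "T \<subseteq> S" "T \<noteq> {}" "even (card T)" "half T"
proof -
  have fin: "finite S" using assms(1) finite_subset by blast
  obtain k :: "nat \<Rightarrow> int" where k: "\<exists>i\<in>S. odd (k i)" "(\<Sum>i\<in>S. of_int (k i) *s pt i) = 0"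
    using dep_obtain_primitive[OF fin assms(2)] .
  define T where "T = {i \<in> S. odd (k i)}"
  define h where "h i = (k i - of_bool (odd (k i))) div 2" for i
  have kh: "k i = of_bool (odd (k i)) + 2 * h i" for i unfolding h_def by (cases "even (k i)") (auto simp: elim!: oddE)
  have "0 = (\<Sum>i\<in>S. of_int (of_bool (odd (k i)) + 2 * h i) *s pt i)"
    using k(2) by (simp only: kh[symmetric])
  also have "\<dots> = (\<Sum>i\<in>S. of_bool (odd (k i)) *s pt i) + (\<Sum>i\<in>S. (2 * of_int (h i)) *s pt i)"
    by (simp add: vec.scale_left_distrib sum.distrib)
  also have "(\<Sum>i\<in>S. of_bool (odd (k i)) *s pt i) = (\<Sum>i\<in>T. pt i)"
    unfolding T_def by (rule sum.mono_neutral_cong_right) (use fin in auto)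
  also have "(\<Sum>i\<in>S. (2 * of_int (h i)) *s pt i) = 2 *s (\<Sum>i\<in>S. of_int (h i) *s pt i)"
    by (simp add: vec.scale_sum_right)
  finally have "(\<Sum>i\<in>T. pt i) = - (2 *s (\<Sum>i\<in>S. of_int (h i) *s pt i))"
    by (simp add: eq_neg_iff_add_eq_0)
  then have eq: "(1/2) *s (\<Sum>i\<in>T. pt i) = - (\<Sum>i\<in>S. of_int (h i) *s pt i)"
    by simp
  have "(\<Sum>i\<in>S. of_int (h i) *s pt i) \<in> E7_dual"
    using assms(1) by (intro E7_dual_sum E7_dual_scale_int pt_in_E7_dual) auto
  then have "half T" unfolding half_def eq by (rule E7_dual_uminus)
  moreover have "even (card T)"
  proof -
    have "0 = (\<Sum>i\<in>S. of_int (k i) *s pt i) $ vtx 0" using k(2) by simp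
    also have "\<dots> = (\<Sum>i\<in>S. of_int (k i) * (1/4 - of_bool (0 \<in> ends i)))"
      using assms(1) by (auto intro!: sum.cong simp: pt_vtx subset_iff)
    also have "\<dots> = (\<Sum>i\<in>S. of_int (k i) / 4 - of_int (k i * of_bool (0 \<in> ends i)))"
      by (intro sum.cong) (auto simp: field_simps)
    also have "\<dots> = of_int (\<Sum>i\<in>S. k i) / 4 - of_int (\<Sum>i\<in>S. k i * of_bool (0 \<in> ends i))"
      by (simp add: sum_subtractf sum_divide_distrib)
    finally have "of_int (\<Sum>i\<in>S. k i) = (of_int (4 * (\<Sum>i\<in>S. k i * of_bool (0 \<in> ends i))) :: rat)"
      by simp
    then have "(\<Sum>i\<in>S. k i) = 4 * (\<Sum>i\<in>S. k i * of_bool (0 \<in> ends i))" by (simp only: of_int_eq_iff)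
    then have "even (\<Sum>i\<in>S. k i)" by simp
    then show ?thesis using even_sum_iff[OF fin, of k] by (simp add: T_def)
  qed
  ultimately show ?thesis using that[of T] k(1) by (auto simp: T_def)
qed

text \<open>
  With the right signs the half sum of two points has norm \<open>(3/2 + 3/2 - 1)/4 = 1/2\<close>, too short
  for a nonzero lattice vector, and it is not zero.
\<close>

lemma not_half_pair:
  assumes "a < 28" "b < 28" "a \<noteq> b"
  shows "\<not> half {a, b}"
proof
  assume "half {a, b}"
  define e where "e = (\<lambda>i. if i = b then - sg a b else 1)"
  have e: "signing e" using sg_cases[of a b] by (auto simp: signing_def e_def)
  let ?y = "(1/2) *s (\<Sum>i\<in>{a, b}. e i *s pt i)"
  have "{a, b} \<subseteq> {..<28}" using assms by simp
  from half_signing_iff[OF this e] have "?y \<in> E7_dual" using \<open>half {a, b}\<close> by (rule iffD1)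
  moreover have "ip ?y ?y = 1/2"
  proof -
    have y: "?y = (1/2) *s pt a + (- sg a b / 2) *s pt b" using assms by (simp add: e_def vec_eq_iff)
    show ?thesis unfolding y ip_add_left ip_add_right ip_scale_left ip_scale_right
      using assms sg_square[of a b] by (simp add: ip_pt ip_pt_same sg_commute[of b a] field_simps)
  qed
  ultimately show False using E7_dual_short_eq_0[of ?y] by (auto simp: ip_zero_left)
qed

text \<open>
  For each added vector the sign is chosen so that its inner products with the earlier ones do not
  add up to a positive number. The first and the third choice gain at least 1, because a sum of
  one or three signs is odd.
\<close>

lemma sign_choice:
  fixes p q r x y z :: rat
  assumes "p = 1 \<or> p = - 1" "q = 1 \<or> q = - 1" "r = 1 \<or> r = - 1"
    "x = 1 \<or> x = - 1" "y = 1 \<or> y = - 1" "z = 1 \<or> z = - 1"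
  shows "\<exists>e\<in>{1, -1}. \<exists>f\<in>{1, -1}. \<exists>g\<in>{1, -1}. e * p + f * q + g * r + e * f * x + e * g * y + f * g * z \<le> - 2"
proof -
  define e where "e = - p"
  define f where "f = (if q + e * x > 0 then - 1 else 1 :: rat)"
  define g where "g = (if r + e * y + f * z > 0 then - 1 else 1 :: rat)"
  have mem: "e \<in> {1, - 1}" "f \<in> {1, - 1}" "g \<in> {1, - 1}"
    using assms(1) by (auto simp: e_def f_def g_def)
  have 1: "e * p = - 1" using assms(1) by (auto simp: e_def)
  have 2: "f * (q + e * x) \<le> 0" by (auto simp: f_def)
  have "e * y = 1 \<or> e * y = - 1" using mem(1) assms(5) by auto
  moreover have "f * z = 1 \<or> f * z = - 1" using mem(2) assms(6) by auto
  ultimately have "r + e * y + f * z \<le> - 1 \<or> 1 \<le> r + e * y + f * z" using assms(3) by linarith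
  then have 3: "g * (r + e * y + f * z) \<le> - 1" unfolding g_def by (auto split: if_split)
  have "e * p + f * q + g * r + e * f * x + e * g * y + f * g * z
    = e * p + f * (q + e * x) + g * (r + e * y + f * z)" by (simp add: algebra_simps)
  also have "\<dots> \<le> - 2" using 1 2 3 by linarith
  finally show ?thesis using mem by blast
qed

lemma norm_expand:
  "ip (p + x *s q + y *s r + z *s t) (p + x *s q + y *s r + z *s t) =
    ip p p + x * x * ip q q + y * y * ip r r + z * z * ip t t
    + (x * (2 * ip p q) + y * (2 * ip p r) + z * (2 * ip p t)
     + x * y * (2 * ip q r) + x * z * (2 * ip q t) + y * z * (2 * ip r t))"
  by (simp add: ip_linear ip_commute[of q p] ip_commute[of r p] ip_commute[of t p] ip_commute[of r q]
      ip_commute[of t q] ip_commute[of t r] algebra_simps)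

text \<open>
  Before halving, the norm is \<open>4 * (3/2) = 6\<close> plus a sum of signs that can be made at most \<open>-2\<close>.
  The half sum then has norm at most \<open>4/4 = 1 < 3/2\<close>, so it vanishes.
\<close>

lemma half_4_imp_balanced:
  assumes "S \<subseteq> {..<28}" "card S = 4" "half S"
  shows "balanced S"
proof -
  obtain a b c d where S: "S = {a, b, c, d}" and dist: "distinct [a, b, c, d]"
    using assms(2) by (auto simp: card_Suc_eq numeral_eq_Suc)
  obtain eb ec ed where mem: "eb \<in> {1, - 1}" "ec \<in> {1, - 1}" "ed \<in> {1, - 1}"
    and le: "eb * sg a b + ec * sg a c + ed * sg a d + eb * ec * sg b c + eb * ed * sg b d + ec * ed * sg c d \<le> - 2"
    using sign_choice[OF sg_cases sg_cases sg_cases sg_cases sg_cases sg_cases, of a b a c a d b c b d c d] by blast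
  then have e: "eb = 1 \<or> eb = - 1" "ec = 1 \<or> ec = - 1" "ed = 1 \<or> ed = - 1" by auto
  define e where "e = (\<lambda>i. if i = b then eb else if i = c then ec else if i = d then ed else 1)"
  have sgn: "signing e" using e by (auto simp: signing_def e_def)
  let ?z = "\<Sum>i\<in>S. e i *s pt i"
  have lt: "a < 28" "b < 28" "c < 28" "d < 28" using assms(1) S by auto
  have z: "?z = pt a + eb *s pt b + ec *s pt c + ed *s pt d"
    using dist by (simp add: S e_def add.assoc)
  have sq: "eb * eb = 1" "ec * ec = 1" "ed * ed = 1" using e by auto
  have "ip ?z ?z = 6
     + (eb * sg a b + ec * sg a c + ed * sg a d + eb * ec * sg b c + eb * ed * sg b d + ec * ed * sg c d)"
    unfolding z norm_expand using dist lt by (simp add: ip_pt ip_pt_same sq)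
  then have "ip ?z ?z \<le> 4" using le by linarith
  moreover have "ip ((1/2) *s ?z) ((1/2) *s ?z) = ip ?z ?z / 4" by (simp add: ip_linear)
  moreover have "(1/2) *s ?z \<in> E7_dual" using assms(1,3) half_signing_iff[OF _ sgn] by blast
  ultimately have "(1/2) *s ?z = 0" by (intro E7_dual_short_eq_0) auto
  then have "?z = 0" by simp
  then show ?thesis using sgn unfolding balanced_def by blast
qed

text \<open>In row \<open>j\<close> of the Gram matrix three signs must add up to \<open>-3\<close>.\<close>

lemma balanced_4_signs:
  assumes "S \<subseteq> {..<28}" "card S = 4" "signing e" "(\<Sum>i\<in>S. e i *s pt i) = 0" "i \<in> S" "j \<in> S" "i \<noteq> j"
  shows "e i * e j * sg i j = - 1"
proof -
  have fin: "finite S" using assms(1) finite_subset by blast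
  have "3 * e j + (\<Sum>i\<in>S - {j}. e i * sg i j) = 0" using gram_row assms by blast
  then have "e j * (3 * e j + (\<Sum>i\<in>S - {j}. e i * sg i j)) = 0" by simp
  then have "3 + (\<Sum>i\<in>S - {j}. e i * e j * sg i j) = 0"
    using signing_square[OF assms(3), of j] by (simp add: distrib_left sum_distrib_left mult_ac)
  then have "(\<Sum>i\<in>S - {j}. 1 + e i * e j * sg i j) = 0"
    using assms fin by (simp add: sum.distrib)
  moreover have "1 + e i * e j * sg i j \<ge> 0" for i
    using signed_signed_sg_cases[OF assms(3), of i j] by auto
  ultimately have "\<forall>i\<in>S - {j}. 1 + e i * e j * sg i j = 0"
    using fin by (subst (asm) sum_nonneg_eq_0_iff) auto
  then show ?thesis using assms(5,7) by (simp add: eq_neg_iff_add_eq_0 add.commute)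
qed

lemma signs_neg_iff:
  assumes "signing e" "distinct [i, j, k]"
  shows "neg i j k \<longleftrightarrow> (e i * e j * sg i j) * (e j * e k * sg j k) * (e i * e k * sg i k) = - 1"
proof -
  have "(e i * e j * sg i j) * (e j * e k * sg j k) * (e i * e k * sg i k)
    = (e i * e i) * (e j * e j) * (e k * e k) * (sg i j * sg j k * sg i k)" by (simp add: mult_ac)
  also have "\<dots> = sg i j * sg j k * sg i k" by (simp only: signing_square[OF assms(1)] mult_1)
  finally have eq: "(e i * e j * sg i j) * (e j * e k * sg j k) * (e i * e k * sg i k) = sg i j * sg j k * sg i k" .
  show ?thesis unfolding eq neg_def using assms(2) by simp
qed

lemma balanced_4_neg:
  assumes "S \<subseteq> {..<28}" "card S = 4" "balanced S" "i \<in> S" "j \<in> S" "k \<in> S" "distinct [i, j, k]"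
  shows "neg i j k"
proof -
  obtain e where e: "signing e" "(\<Sum>i\<in>S. e i *s pt i) = 0" using assms(3) unfolding balanced_def by blast
  show ?thesis using balanced_4_signs[OF assms(1,2) e] assms by (simp add: signs_neg_iff[OF e(1)])
qed

lemma neg_commute: "neg i j k \<Longrightarrow> neg j i k" "neg i j k \<Longrightarrow> neg i k j"
  by (auto simp: neg_def sg_commute mult_ac)

text \<open>
  With suitable signs the three vectors have pairwise inner products \<open>-1/2\<close>. Their sum then has
  norm \<open>9/2 - 3 = 3/2\<close>, so it is again a minimal vector, up to sign one of the 28 points.
\<close>

lemma neg_completion:
  assumes "neg a b c" "a < 28" "b < 28" "c < 28"
  obtains x where "x < 28" "x \<notin> {a, b, c}" "balanced {a, b, c, x}"
proof -
  have dist: "a \<noteq> b" "a \<noteq> c" "b \<noteq> c" and n: "sg a b * sg b c * sg a c = - 1"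
    using assms(1) by (auto simp: neg_def)
  define p q where "p = - sg a b" and "q = - sg a c"
  have p: "p = 1 \<or> p = - 1" and q: "q = 1 \<or> q = - 1" using sg_cases[of a b] sg_cases[of a c] by (auto simp: p_def q_def)
  have pq: "p * sg a b = - 1" "q * sg a c = - 1" "p * p = 1" "q * q = 1"
    by (simp_all add: p_def q_def sg_square)
  have pqs: "p * q * sg b c = - 1" using n by (simp add: p_def q_def mult_ac)
  have pq': "q * sg b c = - p" using p pqs by (elim disjE) simp_all
  have pq'': "p * sg b c = - q" using q pqs by (elim disjE) simp_all
  define z where "z = pt a + p *s pt b + q *s pt c"
  have L: "r *s pt k \<in> E7_dual" if "k < 28" "r = 1 \<or> r = - 1" for r k
    using that pt_in_E7_dual[OF that(1)] E7_dual_uminus by auto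
  have "z \<in> E7_dual" unfolding z_def by (intro E7_dual_add pt_in_E7_dual L assms p q)
  moreover have "ip z z = 3/2"
    using norm_expand[of "pt a" p "pt b" q "pt c" 0 0] assms dist pq pqs by (simp add: z_def ip_pt ip_pt_same)
  ultimately obtain x where x: "x < 28" "z = pt x \<or> z = - pt x" using short_vector_eq_pt by blast
  have za: "ip z (pt a) = 1/2"
    unfolding z_def ip_add_left ip_scale_left using assms dist pq by (simp add: ip_pt ip_pt_same sg_commute[of b a] sg_commute[of c a])
  have zb: "ip z (pt b) = p / 2"
    unfolding z_def ip_add_left ip_scale_left using assms dist pq' by (simp add: ip_pt ip_pt_same sg_commute[of c b] p_def)
  have zc: "ip z (pt c) = q / 2"
    unfolding z_def ip_add_left ip_scale_left using assms dist pq'' by (simp add: ip_pt ip_pt_same q_def)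
  have zx: "ip z (pt x) = 3/2 \<or> ip z (pt x) = - 3/2"
    using x by (auto simp: ip_pt_same ip_uminus_left)
  have "x \<noteq> a" using za zx by auto
  moreover have "x \<noteq> b" using zb zx p by auto
  moreover have "x \<noteq> c" using zc zx q by auto
  ultimately have notin: "x \<notin> {a, b, c}" by simp
  obtain s where s: "s = 1 \<or> s = - 1" "z + s *s pt x = 0"
  proof (cases "z = pt x")
    case True then show ?thesis using that[of "- 1"] by simp
  next
    case False then show ?thesis using that[of 1] x(2) by simp
  qed
  define e where "e = (\<lambda>i. if i = a then 1 else if i = b then p else if i = c then q else s)"
  have "signing e" using s(1) p q by (simp add: signing_def e_def)
  moreover have "(\<Sum>i\<in>{a, b, c, x}. e i *s pt i) = z + s *s pt x"
    using dist notin by (simp add: e_def z_def add.assoc)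
  then have "(\<Sum>i\<in>{a, b, c, x}. e i *s pt i) = 0" using s(2) by (rule trans)
  ultimately have "balanced {a, b, c, x}" unfolding balanced_def by blast
  then show ?thesis using x(1) notin that by blast
qed

section \<open>Short circuits\<close>

definition completes :: "nat \<Rightarrow> nat set \<Rightarrow> bool" where
  "completes x t \<longleftrightarrow> x < 28 \<and> t \<subseteq> {..<28} \<and> x \<notin> t \<and> card t = 3 \<and> balanced (insert x t)"

definition circuit :: "nat set \<Rightarrow> bool" where
  "circuit S \<longleftrightarrow> dep S \<and> (\<forall>x\<in>S. \<not> dep (S - {x}))"

lemma finite_points: "S \<subseteq> {..<28::nat} \<Longrightarrow> finite S"
  using finite_subset by blast

lemma half_card_ge_4:
  assumes "S \<subseteq> {..<28}" "half S" "even (card S)" "S \<noteq> {}"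
  shows "4 \<le> card S"
proof -
  have "card S \<noteq> 0" using assms finite_points by simp
  moreover have "card S \<noteq> 2"
  proof
    assume "card S = 2"
    then obtain a b where "S = {a, b}" "a \<noteq> b" by (auto simp: card_2_iff)
    then show False using not_half_pair[of a b] assms by simp
  qed
  ultimately show ?thesis using assms(3) by presburger
qed

lemma dep_mono:
  assumes "finite S" "T \<subseteq> S" "dep T"
  shows "dep S"
proof -
  obtain c i where c: "i \<in> T" "c i \<noteq> 0" "(\<Sum>i\<in>T. c i *s pt i) = 0"
    using assms(3) unfolding dep_def by blast
  define d where "d = (\<lambda>i. if i \<in> T then c i else 0)"
  have "(\<Sum>i\<in>S. d i *s pt i) = (\<Sum>i\<in>T. c i *s pt i)"
    by (rule sum.mono_neutral_cong_right) (use assms in \<open>auto simp: d_def\<close>)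
  moreover have "i \<in> S" "d i \<noteq> 0" using c assms by (auto simp: d_def)
  ultimately show ?thesis using c(3) unfolding dep_def by metis
qed

lemma balanced_imp_dep:
  assumes "balanced S" "S \<noteq> {}"
  shows "dep S"
proof -
  obtain e where e: "signing e" "(\<Sum>i\<in>S. e i *s pt i) = 0" using assms(1) unfolding balanced_def by blast
  obtain i where "i \<in> S" using assms(2) by blast
  moreover have "e i \<noteq> 0" using signing_square[OF e(1), of i] by auto
  ultimately show ?thesis using e(2) unfolding dep_def by blast
qed

lemma indep_card_le_3:
  assumes "S \<subseteq> {..<28}" "card S \<le> 3"
  shows "\<not> dep S"
proof
  assume "dep S"
  then obtain T where T: "T \<subseteq> S" "T \<noteq> {}" "even (card T)" "half T" by (rule dep_imp_half[OF assms(1)])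
  then have "4 \<le> card T" using assms(1) by (intro half_card_ge_4) auto
  then show False using card_mono[OF finite_points[OF assms(1)] T(1)] assms(2) by simp
qed

lemma dep_4_iff_balanced:
  assumes "S \<subseteq> {..<28}" "card S = 4"
  shows "dep S \<longleftrightarrow> balanced S"
proof
  assume "dep S"
  then obtain T where T: "T \<subseteq> S" "T \<noteq> {}" "even (card T)" "half T" by (rule dep_imp_half[OF assms(1)])
  then have "4 \<le> card T" using assms(1) by (intro half_card_ge_4) auto
  then have "T = S" using T(1) assms finite_points by (intro card_seteq) auto
  then show "balanced S" using half_4_imp_balanced assms T(4) by blast
next
  assume "balanced S" then show "dep S" using balanced_imp_dep assms(2) by fastforce
qed

lemma circuit_4_iff_balanced:
  assumes "S \<subseteq> {..<28}" "card S = 4"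
  shows "circuit S \<longleftrightarrow> balanced S"
proof -
  have "\<not> dep (S - {x})" if "x \<in> S" for x
  proof (rule indep_card_le_3)
    show "S - {x} \<subseteq> {..<28}" using assms(1) by blast
    show "card (S - {x}) \<le> 3" using that assms(2) by simp
  qed
  then show ?thesis unfolding circuit_def using dep_4_iff_balanced[OF assms] by blast
qed

text \<open>
  Normalise the signs so that all inner products with \<open>i0\<close> are positive; a triple through \<open>i0\<close>
  then determines the sign of each remaining pair.
\<close>

lemma no_neg_signs:
  assumes "i0 \<in> S" "\<And>i j k. i \<in> S \<Longrightarrow> j \<in> S \<Longrightarrow> k \<in> S \<Longrightarrow> \<not> neg i j k"
  obtains e where "signing e" "\<And>i j. i \<in> S \<Longrightarrow> j \<in> S \<Longrightarrow> i \<noteq> j \<Longrightarrow> e i * e j * sg i j = 1"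
proof -
  define e where "e = (\<lambda>i. if i = i0 then 1 else sg i0 i)"
  have "signing e" using sg_cases unfolding signing_def e_def by simp
  moreover have "e i * e j * sg i j = 1" if "i \<in> S" "j \<in> S" "i \<noteq> j" for i j
  proof (cases "i = i0 \<or> j = i0")
    case True
    then show ?thesis using that sg_square[of i0 j] sg_square[of i0 i] sg_commute[of i i0] by (auto simp: e_def)
  next
    case False
    then have "sg i0 i * sg i j * sg i0 j \<noteq> - 1" using assms(2)[OF assms(1) that(1,2)] that(3) by (auto simp: neg_def)
    moreover have "sg i0 i * sg i j * sg i0 j = 1 \<or> sg i0 i * sg i j * sg i0 j = - 1"
      using sg_cases[of i0 i] sg_cases[of i j] sg_cases[of i0 j] by (elim disjE) simp_all
    ultimately show ?thesis using False by (simp add: e_def mult_ac)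
  qed
  ultimately show ?thesis using that by blast
qed

lemma signed_gram_row:
  assumes "S \<subseteq> {..<28}" "(\<Sum>i\<in>S. c i *s pt i) = 0" "j \<in> S" "signing e"
  shows "3 * (e j * c j) + (\<Sum>i\<in>S - {j}. e i * c i * (e i * e j * sg i j)) = 0"
proof -
  have *: "e i * c i * (e i * e j * sg i j) = e j * (c i * sg i j)" for i
    using signing_square[OF assms(4), of i] by (simp add: mult_ac)
  then have "3 * (e j * c j) + (\<Sum>i\<in>S - {j}. e i * c i * (e i * e j * sg i j))
    = e j * (3 * c j + (\<Sum>i\<in>S - {j}. c i * sg i j))"
    unfolding * by (simp add: distrib_left sum_distrib_left mult_ac)
  then show ?thesis using gram_row[OF assms(1-3)] by simp
qed

text \<open>
  After normalising signs the doubled Gram matrix has entries 3 on the diagonal and 1 elsewhere.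
  It is positive definite.
\<close>

lemma no_neg_imp_indep:
  assumes "S \<subseteq> {..<28}" "\<And>i j k. i \<in> S \<Longrightarrow> j \<in> S \<Longrightarrow> k \<in> S \<Longrightarrow> \<not> neg i j k"
  shows "\<not> dep S"
proof
  assume "dep S"
  then obtain c i0 where c: "i0 \<in> S" "c i0 \<noteq> 0" "(\<Sum>i\<in>S. c i *s pt i) = 0" unfolding dep_def by blast
  obtain e where e: "signing e" "\<And>i j. i \<in> S \<Longrightarrow> j \<in> S \<Longrightarrow> i \<noteq> j \<Longrightarrow> e i * e j * sg i j = 1"
    using no_neg_signs[OF c(1) assms(2)] by blast
  have fin: "finite S" using assms(1) by (rule finite_points)
  define s where "s = (\<Sum>i\<in>S. e i * c i)"
  have row: "2 * (e j * c j) + s = 0" if j: "j \<in> S" for j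
  proof -
    have "(\<Sum>i\<in>S - {j}. e i * c i * (e i * e j * sg i j)) = (\<Sum>i\<in>S - {j}. e i * c i)"
      using e(2) j by (intro sum.cong) auto
    then show ?thesis
      using signed_gram_row[OF assms(1) c(3) j e(1)] sum.remove[OF fin j, of "\<lambda>i. e i * c i"]
      unfolding s_def by linarith
  qed
  then have "(\<Sum>j\<in>S. 2 * (e j * c j) + s) = 0" by simp
  then have "2 * s + of_nat (card S) * s = 0" by (simp add: sum.distrib s_def flip: sum_distrib_left)
  then have "(2 + of_nat (card S)) * s = 0" by (simp add: distrib_right)
  moreover have "(2 + of_nat (card S) :: rat) \<noteq> 0" by (metis of_nat_add of_nat_eq_0_iff of_nat_numeral add_is_0 zero_neq_numeral)
  ultimately have "s = 0" by simp
  then have "e i0 * c i0 = 0" using row[OF c(1)] by simp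
  then show False using c(2) signing_square[OF e(1), of i0] by auto
qed

text \<open>
  The difference of the two half sums shows that \<open>{x, y}\<close> has its half sum in the lattice.
\<close>

lemma completes_unique:
  assumes "completes x t" "completes y t"
  shows "x = y"
proof (rule ccontr)
  assume "x \<noteq> y"
  note c = assms[unfolded completes_def]
  have fin: "finite t" using c finite_points by blast
  have h: "half (insert x t)" "half (insert y t)" using c by (auto intro!: balanced_imp_half)
  have eq: "(1/2) *s (\<Sum>i\<in>{x, y}. pt i) = (1/2) *s (\<Sum>i\<in>insert x t. pt i) - (1/2) *s (\<Sum>i\<in>insert y t. pt i) + pt y"
    using c fin \<open>x \<noteq> y\<close> by (simp add: vec_eq_iff field_simps)
  have "(1/2) *s (\<Sum>i\<in>insert x t. pt i) - (1/2) *s (\<Sum>i\<in>insert y t. pt i) + pt y \<in> E7_dual"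
    using h c pt_in_E7_dual unfolding half_def by (intro E7_dual_add E7_dual_diff) auto
  then have "half {x, y}" unfolding half_def eq .
  then show False using not_half_pair[of x y] \<open>x \<noteq> y\<close> c by simp
qed

text \<open>Modulo 2 the sum over \<open>S - t\<close> is the sum over \<open>t\<close>, which is \<open>pt x\<close>.\<close>

lemma completes_complement:
  assumes "S \<subseteq> {..<28}" "card S = 6" "half S" "t \<subseteq> S" "completes x t" "x \<notin> S"
  shows "completes x (S - t)"
proof -
  note c = assms(5)[unfolded completes_def]
  have fin: "finite S" "finite t" using assms(1,4) finite_points by auto
  have eq: "(1/2) *s (\<Sum>i\<in>insert x (S - t). pt i) = (1/2) *s (\<Sum>i\<in>S. pt i) - (1/2) *s (\<Sum>i\<in>insert x t. pt i) + pt x"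
    using c fin assms by (simp add: sum_diff vec_eq_iff field_simps)
  have "(1/2) *s (\<Sum>i\<in>S. pt i) - (1/2) *s (\<Sum>i\<in>insert x t. pt i) + pt x \<in> E7_dual"
    using c assms(3) balanced_imp_half[of "insert x t"] pt_in_E7_dual[of x] unfolding half_def
    by (intro E7_dual_add E7_dual_diff) auto
  then have h: "half (insert x (S - t))" unfolding half_def eq .
  have card: "card (S - t) = 3" using card_Diff_subset[OF fin(2) assms(4)] assms(2) c by simp
  have "balanced (insert x (S - t))"
    using c assms fin card h by (intro half_4_imp_balanced) auto
  then show ?thesis using c assms card by (auto simp: completes_def)
qed

text \<open>Both signed sums can be made equal to \<open>- pt x\<close>; their difference vanishes.\<close>

lemma completes_balanced_union:
  assumes "completes x s" "completes x t" "s \<inter> t = {}"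
  shows "balanced (s \<union> t)"
proof -
  note c = assms(1,2)[unfolded completes_def]
  have fin: "finite s" "finite t" using c finite_points by auto
  obtain e where e: "signing e" "(\<Sum>i\<in>insert x s. e i *s pt i) = 0" using c(1) unfolding balanced_def by blast
  obtain f where f: "signing f" "(\<Sum>i\<in>insert x t. f i *s pt i) = 0" using c(2) unfolding balanced_def by blast
  \<comment> \<open>With these factors \<open>pt x\<close> has coefficient 1 in both
    relations.\<close>
  define g where "g = (\<lambda>i. if i \<in> s then e x * e i else - (f x * f i))"
  have pm: "e i = 1 \<or> e i = - 1" "f i = 1 \<or> f i = - 1" for i using e(1) f(1) by (auto simp: signing_def)
  have "g i = 1 \<or> g i = - 1" for i
    using pm(1)[of x] pm(1)[of i] pm(2)[of x] pm(2)[of i] unfolding g_def by auto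
  then have "signing g" unfolding signing_def by blast
  moreover have "(\<Sum>i\<in>s \<union> t. g i *s pt i) = 0"
  proof -
    have "(\<Sum>i\<in>s. e i *s pt i) = - (e x *s pt x)" "(\<Sum>i\<in>t. f i *s pt i) = - (f x *s pt x)"
      using e(2) f(2) c fin by (simp_all add: eq_neg_iff_add_eq_0 add.commute)
    then have "e x *s (\<Sum>i\<in>s. e i *s pt i) = - pt x" "f x *s (\<Sum>i\<in>t. f i *s pt i) = - pt x"
      using signing_square[OF e(1), of x] signing_square[OF f(1), of x] by simp_all
    then have *: "(\<Sum>i\<in>s. (e x * e i) *s pt i) = - pt x" "(\<Sum>i\<in>t. (f x * f i) *s pt i) = - pt x"
      by (simp_all add: vec.scale_sum_right)
    have "(\<Sum>i\<in>s \<union> t. g i *s pt i) = (\<Sum>i\<in>s. g i *s pt i) + (\<Sum>i\<in>t. g i *s pt i)"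
      using fin assms(3) by (rule sum.union_disjoint)
    also have "(\<Sum>i\<in>s. g i *s pt i) = - pt x" unfolding *(1)[symmetric] by (intro sum.cong) (auto simp: g_def)
    also have "(\<Sum>i\<in>t. g i *s pt i) = (\<Sum>i\<in>t. - ((f x * f i) *s pt i))"
      using assms(3) by (intro sum.cong) (auto simp: g_def)
    also have "\<dots> = pt x" unfolding sum_negf *(2) by simp
    finally show ?thesis by simp
  qed
  ultimately show ?thesis unfolding balanced_def by blast
qed

lemma neg_imp_completes:
  assumes "neg a b c" "a < 28" "b < 28" "c < 28"
  obtains x where "completes x {a, b, c}"
proof -
  obtain x where x: "x < 28" "x \<notin> {a, b, c}" "balanced {a, b, c, x}" using neg_completion[OF assms] .
  have "insert x {a, b, c} = {a, b, c, x}" by auto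
  then have "completes x {a, b, c}" using x assms by (simp add: completes_def neg_def)
  then show ?thesis using that by blast
qed

lemma completes_imp_neg:
  assumes "completes x t" "i \<in> t" "j \<in> t" "k \<in> t" "distinct [i, j, k]"
  shows "neg i j k"
  using assms finite_points[of t] by (intro balanced_4_neg[of "insert x t"]) (auto simp: completes_def)

lemma circuit_no_balanced_4:
  assumes "S \<subseteq> {..<28}" "circuit S" "B \<subseteq> S" "card B = 4" "balanced B"
  shows "B = S"
proof (rule ccontr)
  assume "B \<noteq> S"
  then obtain x where "x \<in> S" "x \<notin> B" using assms(3) by blast
  then have x: "x \<in> S" "B \<subseteq> S - {x}" using assms(3) by auto
  have D: "dep B" using assms(5) by (rule balanced_imp_dep) (use assms(4) in auto)
  have "dep (S - {x})" by (rule dep_mono[OF _ x(2) D]) (simp add: finite_points[OF assms(1)])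
  then show False using assms(2) x(1) unfolding circuit_def by blast
qed

lemma circuit_completion_outside:
  assumes "S \<subseteq> {..<28}" "circuit S" "card S > 4" "t \<subseteq> S" "completes x t"
  shows "x \<notin> S"
proof
  assume "x \<in> S"
  have "card (insert x t) = 4" using assms(5) finite_points[of t] by (auto simp: completes_def)
  then have "insert x t = S" using assms \<open>x \<in> S\<close> by (intro circuit_no_balanced_4) (auto simp: completes_def)
  then show False using \<open>card (insert x t) = 4\<close> assms(3) by simp
qed

lemma half_6_with_neg_imp_balanced:
  assumes "S \<subseteq> {..<28}" "card S = 6" "half S" "a \<in> S" "b \<in> S" "c \<in> S" "neg a b c"
    "\<And>x. completes x {a, b, c} \<Longrightarrow> x \<notin> S"
  shows "balanced S"
proof -
  have lt: "a < 28" "b < 28" "c < 28" using assms by auto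
  obtain x where x: "completes x {a, b, c}" using neg_imp_completes[OF assms(7) lt] .
  have sub: "{a, b, c} \<subseteq> S" using assms by simp
  have "balanced ({a, b, c} \<union> (S - {a, b, c}))"
    using completes_complement[OF assms(1-3) sub x assms(8)[OF x]] by (intro completes_balanced_union[OF x]) auto
  moreover have "{a, b, c} \<union> (S - {a, b, c}) = S" using sub by blast
  ultimately show ?thesis by simp
qed

text \<open>
  A circuit of size 6 contains no balanced quadruple, so the set of odd coefficients is
  everything. It has a negative triple, whose completing point lies outside and also completes the
  complement. Conversely, if a balanced set of size 6 had a dependent proper subset, it would
  contain a set of size 4 with half sum in the lattice; removing it leaves a pair with the same
  property.
\<close>

lemma circuit_6_iff_balanced:
  assumes "S \<subseteq> {..<28}" "card S = 6"
  shows "circuit S \<longleftrightarrow> balanced S"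
proof
  assume circ: "circuit S"
  then have "dep S" unfolding circuit_def by blast
  then obtain T where T: "T \<subseteq> S" "T \<noteq> {}" "even (card T)" "half T" by (rule dep_imp_half[OF assms(1)])
  have fin: "finite S" using assms(1) by (rule finite_points)
  have "4 \<le> card T" using T assms(1) by (intro half_card_ge_4) auto
  moreover have "card T \<noteq> 4"
  proof
    assume 4: "card T = 4"
    then have "balanced T" using T assms(1) by (intro half_4_imp_balanced) auto
    then show False using circuit_no_balanced_4[OF assms(1) circ T(1) 4] 4 assms(2) by simp
  qed
  moreover have "card T \<le> 6" using card_mono[OF fin T(1)] assms(2) by simp
  ultimately have "card T = 6" using T(3) by presburger
  then have "T = S" using T(1) fin assms(2) by (intro card_seteq) auto
  moreover have "\<exists>a\<in>S. \<exists>b\<in>S. \<exists>c\<in>S. neg a b c" using no_neg_imp_indep[OF assms(1)] \<open>dep S\<close> by blast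
  then obtain a b c where abc: "a \<in> S" "b \<in> S" "c \<in> S" "neg a b c" by blast
  ultimately show "balanced S"
    using T(4) circuit_completion_outside[OF assms(1) circ, of "{a, b, c}"] assms
    by (intro half_6_with_neg_imp_balanced[OF assms _ abc]) auto
next
  assume bal: "balanced S"
  have "\<not> dep (S - {x})" if x: "x \<in> S" for x
  proof
    assume "dep (S - {x})"
    have sub: "S - {x} \<subseteq> {..<28}" using assms(1) by blast
    obtain T where T: "T \<subseteq> S - {x}" "T \<noteq> {}" "even (card T)" "half T"
      using \<open>dep (S - {x})\<close> by (rule dep_imp_half[OF sub])
    have fin: "finite S" using assms(1) by (rule finite_points)
    have "4 \<le> card T" using T sub by (intro half_card_ge_4) auto
    moreover have "card T \<le> 5" using card_mono[OF _ T(1)] fin x assms(2) by simp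
    ultimately have "card T = 4" using T(3) by presburger
    moreover have "T \<subseteq> S" using T(1) by blast
    ultimately have "card (S - T) = 2" using card_Diff_subset[of T S] finite_subset[OF _ fin] assms(2) by simp
    then obtain p q where pq: "S - T = {p, q}" "p \<noteq> q" by (auto simp: card_2_iff)
    have "half (S - T)" using half_diff[OF fin \<open>T \<subseteq> S\<close> balanced_imp_half[OF assms(1) bal] T(4)] .
    moreover have "p < 28" "q < 28" using pq(1) assms(1) by auto
    ultimately show False using not_half_pair pq by metis
  qed
  then show "circuit S" using balanced_imp_dep[OF bal] assms(2) unfolding circuit_def by fastforce
qed

section \<open>Counting circuits of size six\<close>

lemma pm_sum_unique_plus:
  fixes v :: "'a \<Rightarrow> rat"
  assumes "finite A" "card A = 5" "\<And>j. j \<in> A \<Longrightarrow> v j = 1 \<or> v j = - 1" "(\<Sum>j\<in>A. v j) = - 3"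
  shows "\<exists>p. {j \<in> A. v j = 1} = {p}"
proof -
  have "(\<Sum>j\<in>A. v j) = (\<Sum>j\<in>A. 2 * of_bool (v j = 1) - 1)"
    using assms(3) by (intro sum.cong) auto
  also have "\<dots> = 2 * of_nat (card {j \<in> A. v j = 1}) - 5"
    using assms(1,2) by (simp add: sum_subtractf sum.If_cases of_bool_def Int_def flip: sum_distrib_left)
  finally have "card {j \<in> A. v j = 1} = 1" using assms(4) by simp
  then show ?thesis by (simp add: card_1_singleton_iff)
qed

text \<open>
  Once the signs are normalised so that the six vectors add up to zero, each of them has positive
  inner product with exactly one other. These partners form three pairs.
\<close>

lemma balanced_6_partner:
  assumes "S \<subseteq> {..<28}" "card S = 6" "signing e" "(\<Sum>i\<in>S. e i *s pt i) = 0" "j \<in> S"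
  shows "\<exists>p. {i \<in> S - {j}. e i * e j * sg i j = 1} = {p}"
proof (rule pm_sum_unique_plus)
  have fin: "finite S" using assms(1) by (rule finite_points)
  then show "finite (S - {j})" by simp
  show "card (S - {j}) = 5" using assms(2,5) by simp
  show "e i * e j * sg i j = 1 \<or> e i * e j * sg i j = - 1" for i
    using assms(3) by (rule signed_signed_sg_cases)
  have "3 * (e j * e j) + (\<Sum>i\<in>S - {j}. e i * e i * (e i * e j * sg i j)) = 0"
    using signed_gram_row[OF assms(1,4,5,3)] .
  then show "(\<Sum>i\<in>S - {j}. e i * e j * sg i j) = - 3"
    by (simp only: signing_square[OF assms(3)]) (simp add: eq_neg_iff_add_eq_0 add.commute)
qed

lemma card_partner_transversals:
  assumes "distinct [a, a', b, b', c, c']"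
  shows "card {t. t \<subseteq> {a, a', b, b', c, c'} \<and> card t = 3 \<and>
      \<not> {a, a'} \<subseteq> t \<and> \<not> {b, b'} \<subseteq> t \<and> \<not> {c, c'} \<subseteq> t} = 8" (is "card ?X = 8")
proof -
  let ?P = "{a, a'} \<times> {b, b'} \<times> {c, c'}"
  let ?f = "\<lambda>(x, y, z). {x, y, z}"
  have "inj_on ?f ?P" using assms by (auto simp: inj_on_def doubleton_eq_iff insert_eq_iff)
  then have "card (?f ` ?P) = 8" using assms by (simp add: card_image)
  moreover have "?f ` ?P = ?X"
  proof (intro equalityI subsetI)
    fix t assume "t \<in> ?f ` ?P" then show "t \<in> ?X" using assms by auto
  next
    fix t assume t: "t \<in> ?X"
    have fin: "finite t" using t finite_subset[of t "{a, a', b, b', c, c'}"] by auto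
    have le: "card (t \<inter> {p, q}) \<le> 1" if "\<not> {p, q} \<subseteq> t" for p q
    proof -
      have "t \<inter> {p, q} \<subseteq> {p} \<or> t \<inter> {p, q} \<subseteq> {q}" using that by auto
      then show ?thesis using card_mono[of "{p}" "t \<inter> {p, q}"] card_mono[of "{q}" "t \<inter> {p, q}"] by auto
    qed
    have "t = (t \<inter> {a, a'}) \<union> (t \<inter> {b, b'}) \<union> (t \<inter> {c, c'})" using t by auto
    then have "card t = card ((t \<inter> {a, a'}) \<union> (t \<inter> {b, b'}) \<union> (t \<inter> {c, c'}))" by simp
    also have "\<dots> = card (t \<inter> {a, a'}) + card (t \<inter> {b, b'}) + card (t \<inter> {c, c'})"
      using fin assms by (subst card_Un_disjoint; (subst card_Un_disjoint)?) auto
    finally have sum: "card (t \<inter> {a, a'}) + card (t \<inter> {b, b'}) + card (t \<inter> {c, c'}) = 3" using t by simp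
    have "card (t \<inter> {a, a'}) \<le> 1" "card (t \<inter> {b, b'}) \<le> 1" "card (t \<inter> {c, c'}) \<le> 1"
      using le t by blast+
    then have one: "card (t \<inter> {a, a'}) = 1" "card (t \<inter> {b, b'}) = 1" "card (t \<inter> {c, c'}) = 1" using sum by linarith+
    obtain x where x: "t \<inter> {a, a'} = {x}" by (rule card_1_singletonE[OF one(1)])
    obtain y where y: "t \<inter> {b, b'} = {y}" by (rule card_1_singletonE[OF one(2)])
    obtain z where z: "t \<inter> {c, c'} = {z}" by (rule card_1_singletonE[OF one(3)])
    note xyz = x y z
    have "t = {x, y, z}" using \<open>t = _ \<union> _ \<union> _\<close> unfolding xyz by auto
    moreover have "x \<in> {a, a'}" "y \<in> {b, b'}" "z \<in> {c, c'}" using xyz by blast+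
    ultimately show "t \<in> ?f ` ?P" by (intro image_eqI[of _ _ "(x, y, z)"]) auto
  qed
  ultimately show ?thesis by simp
qed

lemma ex_not_in_list: "length xs < card S \<Longrightarrow> \<exists>x\<in>S. x \<notin> set xs"
  by (metis List.finite_set card_length card_mono leD order_trans subsetI)

text \<open>
  A triple is negative exactly if it contains no pair of partners: then its three normalised signs
  are \<open>-1\<close>, whereas a triple that contains a pair of partners has one sign \<open>1\<close> and two signs \<open>-1\<close>.
  Triples without partners select one element from each of three pairs.
\<close>

lemma card_neg_triples_balanced_6:
  assumes "S \<subseteq> {..<28}" "card S = 6" "balanced S"
  shows "card {t. t \<subseteq> S \<and> card t = 3 \<and> (\<exists>x. completes x t)} = 8"
proof -
  have fin: "finite S" using assms(1) by (rule finite_points)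
  obtain e where e: "signing e" "(\<Sum>i\<in>S. e i *s pt i) = 0" using assms(3) unfolding balanced_def by blast
  define v where "v = (\<lambda>i j. e i * e j * sg i j)"
  have v_sym: "v i j = v j i" for i j by (simp add: v_def sg_commute mult_ac)
  have v_pm: "v i j = 1 \<or> v i j = - 1" for i j
    unfolding v_def using e(1) by (rule signed_signed_sg_cases)
  have "\<forall>j\<in>S. \<exists>p. {i \<in> S - {j}. v i j = 1} = {p}"
    unfolding v_def using balanced_6_partner[OF assms(1,2) e] by blast
  from bchoice[OF this] obtain p where p0: "\<forall>j\<in>S. {i \<in> S - {j}. v i j = 1} = {p j}" by (rule exE)
  have p: "{i \<in> S - {j}. v i j = 1} = {p j}" if "j \<in> S" for j using p0 that by (rule bspec)
  have pmem: "p j \<in> {i \<in> S - {j}. v i j = 1}" if "j \<in> S" for j unfolding p[OF that] by simp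
  have pS: "p j \<in> S" "p j \<noteq> j" "v (p j) j = 1" if "j \<in> S" for j using pmem[OF that] by simp_all
  have puniq: "i = p j" if "i \<in> S" "j \<in> S" "i \<noteq> j" "v i j = 1" for i j
  proof -
    have "i \<in> {i \<in> S - {j}. v i j = 1}" using that by simp
    then show ?thesis unfolding p[OF that(2)] by simp
  qed
  have pp: "p (p j) = j" if "j \<in> S" for j
    using puniq[of j "p j"] pS[OF that] that v_sym[of j "p j"] by simp
  have ne: "p i \<noteq> p j" if "i \<in> S" "j \<in> S" "i \<noteq> j" for i j using pp that by metis
  obtain a where a: "a \<in> S" using assms(2) by fastforce
  obtain b where b: "b \<in> S" "b \<noteq> a" "b \<noteq> p a"
    using ex_not_in_list[of "[a, p a]" S] assms(2) by auto
  have pb: "p b \<noteq> a" "p b \<noteq> p a" "p b \<noteq> b" using pp[OF b(1)] b pS ne[OF b(1) a] by auto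
  obtain c where c: "c \<in> S" "c \<noteq> a" "c \<noteq> p a" "c \<noteq> b" "c \<noteq> p b"
    using ex_not_in_list[of "[a, p a, b, p b]" S] assms(2) by auto
  have pc: "p c \<noteq> a" "p c \<noteq> p a" "p c \<noteq> b" "p c \<noteq> p b" "p c \<noteq> c"
    using pp[OF c(1)] c pS ne[OF c(1) a] ne[OF c(1) b(1)] by auto
  have dist: "distinct [a, p a, b, p b, c, p c]" using b pb c pc pS[OF a] by auto
  have "S = {a, p a, b, p b, c, p c}"
  proof -
    have "card {a, p a, b, p b, c, p c} = 6" using distinct_card[OF dist] by simp
    then show ?thesis using a b c pS fin assms(2) by (intro card_seteq[symmetric]) auto
  qed
  note S = this
  have neg_iff: "neg i j k \<longleftrightarrow> v i j * v j k * v i k = - 1" if "distinct [i, j, k]" for i j k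
    using signs_neg_iff[OF e(1) that] by (simp add: v_def)
  have "(\<exists>x. completes x t) \<longleftrightarrow> \<not> {a, p a} \<subseteq> t \<and> \<not> {b, p b} \<subseteq> t \<and> \<not> {c, p c} \<subseteq> t"
    if t: "t \<subseteq> S" "card t = 3" for t
  proof
    assume "\<exists>x. completes x t"
    then obtain x where x: "completes x t" by blast
    have "\<not> {j, p j} \<subseteq> t" if j: "j \<in> S" for j
    proof
      assume sub: "{j, p j} \<subseteq> t"
      have "card (t - {j, p j}) = 1"
        using t sub pS[OF j] finite_subset[OF t(1) fin] by (subst card_Diff_subset) auto
      then obtain k where "t - {j, p j} = {k}" by (auto simp: card_1_singleton_iff)
      then have k: "k \<in> t" "k \<noteq> j" "k \<noteq> p j" "k \<in> S" using t by auto
      have d: "distinct [j, p j, k]" using k pS[OF j] by auto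
      have "v k j = - 1" using puniq[of k j] k j v_pm[of k j] by blast
      moreover have "v k (p j) = - 1"
        using puniq[of k "p j"] k pS[OF j] pp[OF j] v_pm[of k "p j"] by auto
      ultimately have "v j (p j) * v (p j) k * v j k = 1" using pS(3)[OF j] v_sym[of j "p j"] v_sym[of "p j" k] v_sym[of j k] by simp
      then have "\<not> neg j (p j) k" unfolding neg_iff[OF d] by simp
      moreover have "neg j (p j) k" using completes_imp_neg[OF x _ _ _ d] sub k by auto
      ultimately show False by blast
    qed
    then show "\<not> {a, p a} \<subseteq> t \<and> \<not> {b, p b} \<subseteq> t \<and> \<not> {c, p c} \<subseteq> t" using a b c by blast
  next
    assume no: "\<not> {a, p a} \<subseteq> t \<and> \<not> {b, p b} \<subseteq> t \<and> \<not> {c, p c} \<subseteq> t"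
    obtain i j k where ijk: "t = {i, j, k}" "distinct [i, j, k]"
      using t(2) by (auto simp: card_Suc_eq numeral_eq_Suc)
    have nop: "p x \<notin> t" if "x \<in> t" for x
    proof
      assume "p x \<in> t"
      moreover have "x \<in> {a, p a, b, p b, c, p c}" using that t(1) S by blast
      ultimately show False using no that pp[OF a] pp[OF b(1)] pp[OF c(1)] by auto
    qed
    have "v x y = - 1" if "x \<in> t" "y \<in> t" "x \<noteq> y" for x y
      using puniq[of x y] nop[OF that(2)] that t(1) v_pm[of x y] by blast
    then have "neg i j k" unfolding neg_iff[OF ijk(2)] using ijk by simp
    moreover have "i < 28" "j < 28" "k < 28" using ijk(1) t(1) assms(1) by auto
    ultimately show "\<exists>x. completes x t" using neg_imp_completes ijk(1) by metis
  qed
  then have "{t. t \<subseteq> S \<and> card t = 3 \<and> (\<exists>x. completes x t)} = {t. t \<subseteq> S \<and> card t = 3 \<and>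
      \<not> {a, p a} \<subseteq> t \<and> \<not> {b, p b} \<subseteq> t \<and> \<not> {c, p c} \<subseteq> t}" by blast
  then show ?thesis using card_partner_transversals[OF dist] S by simp
qed

text \<open>
  Two different members meet in 0 or 1 points, so
  \<open>of_bool (s \<inter> t = {}) + card (s \<inter> t)\<close> is \<open>1\<close> for \<open>s \<noteq> t\<close> and \<open>3\<close> for
  \<open>s = t\<close>; the sum of \<open>card (s \<inter> t)\<close> is obtained by counting the common points first.
\<close>

lemma card_disjoint_pairs:
  assumes "finite F" "\<And>t. t \<in> F \<Longrightarrow> t \<subseteq> J" "finite J" "\<And>t. t \<in> F \<Longrightarrow> card t = 3"
    "\<And>s t. s \<in> F \<Longrightarrow> t \<in> F \<Longrightarrow> s \<noteq> t \<Longrightarrow> card (s \<inter> t) \<le> 1"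
  shows "int (card {(s, t) \<in> F \<times> F. s \<inter> t = {}}) + (\<Sum>y\<in>J. int (card {t \<in> F. y \<in> t})^2)
    = int (card F)^2 + 2 * int (card F)"
proof -
  have J: "int (card {t \<in> F. y \<in> t})^2 = (\<Sum>s\<in>F. \<Sum>t\<in>F. of_bool (y \<in> s \<inter> t))" for y
  proof -
    have "int (card {t \<in> F. y \<in> t}) = (\<Sum>t\<in>F. of_bool (y \<in> t))"
      using assms(1) by (simp add: sum.If_cases of_bool_def Int_def)
    then show ?thesis by (simp add: power2_eq_square sum_product of_bool_conj)
  qed
  have "(\<Sum>y\<in>J. int (card {t \<in> F. y \<in> t})^2) = (\<Sum>s\<in>F. \<Sum>t\<in>F. \<Sum>y\<in>J. of_bool (y \<in> s \<inter> t))"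
    unfolding J by (subst sum.swap) (intro sum.cong refl sum.swap)
  also have "\<dots> = (\<Sum>s\<in>F. \<Sum>t\<in>F. int (card (s \<inter> t)))"
  proof (intro sum.cong refl)
    fix s t assume "s \<in> F" "t \<in> F"
    then have "J \<inter> (s \<inter> t) = s \<inter> t" using assms(2) by blast
    then show "(\<Sum>y\<in>J. of_bool (y \<in> s \<inter> t)) = int (card (s \<inter> t))"
      using assms(3) by (simp add: sum.If_cases of_bool_def Int_def conj_commute)
  qed
  finally have A: "(\<Sum>y\<in>J. int (card {t \<in> F. y \<in> t})^2) = (\<Sum>s\<in>F. \<Sum>t\<in>F. int (card (s \<inter> t)))" .
  have B: "int (card {(s, t) \<in> F \<times> F. s \<inter> t = {}}) = (\<Sum>s\<in>F. \<Sum>t\<in>F. of_bool (s \<inter> t = {}))"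
  proof -
    have "{(s, t) \<in> F \<times> F. s \<inter> t = {}} = (SIGMA s:F. {t \<in> F. s \<inter> t = {}})" by auto
    then show ?thesis using assms(1) by (simp add: sum.If_cases of_bool_def Int_def)
  qed
  have C: "of_bool (s \<inter> t = {}) + int (card (s \<inter> t)) = 1 + 2 * of_bool (s = t)" if "s \<in> F" "t \<in> F" for s t
  proof (cases "s = t")
    case True then show ?thesis using assms(4)[OF that(1)] by (cases "s = {}") auto
  next
    case False
    have "finite (s \<inter> t)" using assms(2)[OF that(1)] assms(3) finite_subset by blast
    then show ?thesis using assms(5)[OF that False] False
      by (cases "s \<inter> t = {}") (auto simp: le_Suc_eq)
  qed
  have "int (card {(s, t) \<in> F \<times> F. s \<inter> t = {}}) + (\<Sum>y\<in>J. int (card {t \<in> F. y \<in> t})^2)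
    = (\<Sum>s\<in>F. \<Sum>t\<in>F. of_bool (s \<inter> t = {}) + int (card (s \<inter> t)))"
    unfolding A B by (simp add: sum.distrib)
  also have "\<dots> = (\<Sum>s\<in>F. \<Sum>t\<in>F. 1 + 2 * of_bool (s = t))" using C by (intro sum.cong) auto
  also have "\<dots> = int (card F)^2 + 2 * int (card F)"
    using assms(1) by (simp add: sum.distrib power2_eq_square of_bool_def algebra_simps flip: sum_distrib_left)
  finally show ?thesis .
qed

definition completed :: "nat set \<Rightarrow> nat \<Rightarrow> nat set set" where
  "completed J x = {t. t \<subseteq> J \<and> completes x t}"

lemma finite_completed: "finite J \<Longrightarrow> finite (completed J x)"
  by (rule finite_subset[of _ "Pow J"]) (auto simp: completed_def)

text \<open>
  If the triples share two points \<open>u\<close>, then \<open>insert x u\<close> is completed by both remaining points,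
  which are therefore equal.
\<close>

lemma card_completed_inter_le_1:
  assumes "s \<in> completed J x" "t \<in> completed J x" "s \<noteq> t"
  shows "card (s \<inter> t) \<le> 1"
proof (rule ccontr)
  have c: "completes x s" "completes x t" using assms by (auto simp: completed_def)
  note d = c[unfolded completes_def]
  have fin: "finite s" "finite t" using d finite_points by auto
  assume "\<not> card (s \<inter> t) \<le> 1"
  then have "card (s \<inter> t) \<ge> 2" by simp
  then obtain u where u: "u \<subseteq> s \<inter> t" "card u = 2" by (rule obtain_subset_with_card_n)
  have sub: "u \<subseteq> s" "u \<subseteq> t" and finu: "finite u" using u fin finite_subset by auto
  have "card (s - u) = 1" "card (t - u) = 1"
    using card_Diff_subset[OF finu sub(1)] card_Diff_subset[OF finu sub(2)] d u by auto
  then obtain p q where pq: "s - u = {p}" "t - u = {q}" by (auto simp: card_1_singleton_iff)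
  have st: "s = insert p u" "t = insert q u" using pq sub by auto
  have pu: "p \<notin> u" "q \<notin> u" "p \<in> s" "q \<in> t" using pq by auto
  have "completes p (insert x u)" "completes q (insert x u)"
    using d pu sub finu u(2) by (auto simp: completes_def st insert_commute)
  then have "p = q" by (rule completes_unique)
  then show False using st assms(3) by simp
qed

text \<open>
  A pair of disjoint triples completed by \<open>x\<close> corresponds to a 6-circuit with one of its 8
  negative triples.
\<close>

lemma eight_circuits_6:
  assumes "J \<subseteq> {..<28}"
  shows "8 * card {S. S \<subseteq> J \<and> card S = 6 \<and> circuit S}
    = (\<Sum>x<28. card {(s, t) \<in> completed J x \<times> completed J x. s \<inter> t = {}})"
proof -
  have fin: "finite J" using assms by (rule finite_points)
  let ?D = "\<lambda>x. {(s, t) \<in> completed J x \<times> completed J x. s \<inter> t = {}}"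
  let ?C = "{S. S \<subseteq> J \<and> card S = 6 \<and> circuit S}"
  let ?N = "\<lambda>S. {t. t \<subseteq> S \<and> card t = 3 \<and> (\<exists>x. completes x t)}"
  have finD: "finite (?D x)" for x
    by (rule finite_subset[of _ "completed J x \<times> completed J x"]) (auto intro: finite_completed fin)
  have "(\<Sum>x<28. card (?D x)) = card (\<Union>x<28. ?D x)"
  proof (subst card_UN_disjoint)
    show "\<forall>x\<in>{..<28}. \<forall>y\<in>{..<28}. x \<noteq> y \<longrightarrow> ?D x \<inter> ?D y = {}"
      using completes_unique by (fastforce simp: completed_def)
  qed (use finD in auto)
  also have "(\<Union>x<28. ?D x) = (\<lambda>(S, t). (t, S - t)) ` (SIGMA S:?C. ?N S)"
  proof (intro equalityI subsetI)
    fix q assume "q \<in> (\<Union>x<28. ?D x)"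
    then obtain x s t where q: "q = (s, t)" "s \<subseteq> J" "t \<subseteq> J" "completes x s" "completes x t" "s \<inter> t = {}"
      by (auto simp: completed_def)
    note d = q(4,5)[unfolded completes_def]
    have bal: "balanced (s \<union> t)" using completes_balanced_union q by blast
    have "card (s \<union> t) = 6" using d q(6) finite_points[of s] finite_points[of t] by (simp add: card_Un_disjoint)
    moreover have "s \<union> t \<subseteq> {..<28}" using d by blast
    ultimately have "s \<union> t \<in> ?C" using circuit_6_iff_balanced bal q by auto
    moreover have "s \<in> ?N (s \<union> t)" using q d by blast
    ultimately show "q \<in> (\<lambda>(S, t). (t, S - t)) ` (SIGMA S:?C. ?N S)"
      using q by (intro image_eqI[of _ _ "(s \<union> t, s)"]) auto
  next
    fix q assume "q \<in> (\<lambda>(S, t). (t, S - t)) ` (SIGMA S:?C. ?N S)"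
    then obtain S t x where q: "q = (t, S - t)" "S \<subseteq> J" "card S = 6" "circuit S" "t \<subseteq> S" "completes x t" by auto
    have S: "S \<subseteq> {..<28}" using q(2) assms by blast
    have "x \<notin> S" using circuit_completion_outside[OF S q(4) _ q(5,6)] q(3) by simp
    moreover have "half S" using circuit_6_iff_balanced[OF S q(3)] q(4) balanced_imp_half[OF S] by blast
    ultimately have "completes x (S - t)" using completes_complement[OF S q(3) _ q(5,6)] by blast
    then show "q \<in> (\<Union>x<28. ?D x)" using q by (auto simp: completed_def completes_def)
  qed
  also have "card \<dots> = card (SIGMA S:?C. ?N S)"
    by (rule card_image) (auto simp: inj_on_def)
  also have "\<dots> = (\<Sum>S\<in>?C. card (?N S))"
  proof (rule card_SigmaI)
    show "finite ?C" using fin by simp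
    show "\<forall>S\<in>?C. finite (?N S)"
      using finite_subset[OF _ fin] by auto
  qed
  also have "\<dots> = (\<Sum>S\<in>?C. 8)"
  proof (rule sum.cong)
    fix S assume "S \<in> ?C"
    then have S: "S \<subseteq> {..<28}" "card S = 6" "circuit S" using assms by auto
    show "card (?N S) = 8" using card_neg_triples_balanced_6[OF S(1,2)] circuit_6_iff_balanced[OF S(1,2)] S(3) by blast
  qed simp
  finally show ?thesis by simp
qed

lemma eight_circuits_6_sum:
  assumes "J \<subseteq> {..<28}"
  shows "8 * int (card {S. S \<subseteq> J \<and> card S = 6 \<and> circuit S})
    = (\<Sum>x<28. int (card (completed J x))^2 + 2 * int (card (completed J x))
        - (\<Sum>y\<in>J. int (card {t \<in> completed J x. y \<in> t})^2))"
proof -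
  have fin: "finite J" using assms by (rule finite_points)
  let ?D = "\<lambda>x. {(s, t) \<in> completed J x \<times> completed J x. s \<inter> t = {}}"
  have pairs: "int (card (?D x)) = int (card (completed J x))^2 + 2 * int (card (completed J x))
      - (\<Sum>y\<in>J. int (card {t \<in> completed J x. y \<in> t})^2)" for x
  proof -
    have "int (card (?D x)) + (\<Sum>y\<in>J. int (card {t \<in> completed J x. y \<in> t})^2)
      = int (card (completed J x))^2 + 2 * int (card (completed J x))"
    proof (rule card_disjoint_pairs)
      show "finite (completed J x)" using fin by (rule finite_completed)
      show "t \<subseteq> J" "card t = 3" if "t \<in> completed J x" for t using that by (simp_all add: completed_def completes_def)
    qed (use fin card_completed_inter_le_1 in auto)
    then show ?thesis by linarith
  qed
  have "8 * int (card {S. S \<subseteq> J \<and> card S = 6 \<and> circuit S}) = (\<Sum>x<28. int (card (?D x)))"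
    using arg_cong[OF eight_circuits_6[OF assms], of int] by simp
  then show ?thesis unfolding pairs .
qed

lemma circuits_4_through:
  assumes "J \<subseteq> {..<28}" "p \<in> J"
  shows "card {S. S \<subseteq> J \<and> card S = 4 \<and> circuit S \<and> p \<in> S} = card (completed J p)"
proof (rule bij_betw_same_card[symmetric])
  show "bij_betw (insert p) (completed J p) {S. S \<subseteq> J \<and> card S = 4 \<and> circuit S \<and> p \<in> S}"
    unfolding bij_betw_def
  proof (intro conjI equalityI subsetI)
    show "inj_on (insert p) (completed J p)"
      by (auto simp: inj_on_def completed_def completes_def insert_ident)
    fix S assume "S \<in> insert p ` completed J p"
    then obtain t where t: "S = insert p t" "t \<subseteq> J" "completes p t" by (auto simp: completed_def)
    then have "card S = 4" "S \<subseteq> {..<28}" using finite_points[of t] by (auto simp: completes_def)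
    then show "S \<in> {S. S \<subseteq> J \<and> card S = 4 \<and> circuit S \<and> p \<in> S}"
      using t assms circuit_4_iff_balanced[of S] by (auto simp: completes_def)
  next
    fix S assume S: "S \<in> {S. S \<subseteq> J \<and> card S = 4 \<and> circuit S \<and> p \<in> S}"
    then have "S \<subseteq> {..<28}" using assms by blast
    then have "balanced S" "insert p (S - {p}) = S" using S circuit_4_iff_balanced[of S] by auto
    then have "completes p (S - {p})" using S \<open>S \<subseteq> {..<28}\<close> by (auto simp: completes_def)
    then show "S \<in> insert p ` completed J p"
      using S \<open>insert p (S - {p}) = S\<close> by (intro image_eqI[of _ _ "S - {p}"]) (auto simp: completed_def)
  qed
qed

lemma sum_card_through:
  assumes "finite J"
  shows "(\<Sum>y\<in>J. card {t \<in> completed J x. y \<in> t}) = 3 * card (completed J x)"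
proof -
  have "(\<Sum>y\<in>J. card {t \<in> completed J x. y \<in> t}) = (\<Sum>y\<in>J. \<Sum>t\<in>completed J x. of_bool (y \<in> t))"
    using finite_completed[OF assms, of x] by (simp add: sum.If_cases of_bool_def Int_def)
  also have "\<dots> = (\<Sum>t\<in>completed J x. \<Sum>y\<in>J. of_bool (y \<in> t))" by (rule sum.swap)
  also have "\<dots> = (\<Sum>t\<in>completed J x. 3)"
  proof (rule sum.cong)
    fix t assume "t \<in> completed J x"
    then have "J \<inter> t = t" "card t = 3" by (auto simp: completed_def completes_def)
    then show "(\<Sum>y\<in>J. of_bool (y \<in> t)) = (3::nat)" using assms by (simp add: sum.If_cases of_bool_def)
  qed simp
  finally show ?thesis by simp
qed

section \<open>Classes of pairs of points\<close>

lemma E7_lattice_subset_dual: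
  assumes "x \<in> E7_lattice"
  shows "x \<in> E7_dual"
proof -
  have "ip z x \<in> \<int>" if z: "z \<in> E7_lattice" for z
  proof -
    have *: "\<exists>p\<in>{0, 1/2}. \<forall>i. w $ i - p \<in> \<int>" "(\<Sum>i\<in>UNIV. w $ i) = 0" if "w \<in> E7_lattice" for w
      using that unfolding E7_lattice_iff by auto
    obtain p where p: "p \<in> {0, 1/2}" "\<forall>i. z $ i - p \<in> \<int>" using *(1)[OF z] by blast
    obtain q where q: "q \<in> {0, 1/2}" "\<forall>i. x $ i - q \<in> \<int>" using *(1)[OF assms] by blast
    have "(\<Sum>i\<in>UNIV. (z $ i - p) * (x $ i - q)) = (\<Sum>i\<in>UNIV. z $ i * x $ i - p * x $ i - q * z $ i + p * q)"
      by (intro sum.cong) (auto simp: algebra_simps)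
    also have "\<dots> = ip z x - p * (\<Sum>i\<in>UNIV. x $ i) - q * (\<Sum>i\<in>UNIV. z $ i) + 8 * (p * q)"
      by (simp add: sum.distrib sum_subtractf ip_def sum_distrib_left)
    also have "\<dots> = ip z x + 8 * (p * q)" using *(2)[OF z] *(2)[OF assms] by simp
    finally have A: "ip z x = (\<Sum>i\<in>UNIV. (z $ i - p) * (x $ i - q)) - 8 * (p * q)" by simp
    have B: "(\<Sum>i\<in>UNIV. (z $ i - p) * (x $ i - q)) \<in> \<int>" using p(2) q(2) by (intro Ints_sum Ints_mult) auto
    have "p = 0 \<or> p = 1/2" "q = 0 \<or> q = 1/2" using p(1) q(1) by blast+
    then have C: "8 * (p * q) \<in> \<int>" by (elim disjE; hypsubst; simp)
    show ?thesis unfolding A using B C by (rule Ints_diff)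
  qed
  then show ?thesis using assms by (simp add: E7_dual_def dual_lattice_def vec.span_base)
qed

text \<open>
  The symmetric difference of the two edges up to complement, represented by the smaller of the
  two masks. There are 63 classes: 28 pairs of vertices \<open>{p, q}\<close>, and the 35 partitions of the
  vertices into two sets of size 4. They correspond to the pairs of roots of \<open>E\<^sub>7\<close>, as
  \<open>pt x\<close> and \<open>pt y\<close> have, for one choice of signs, a root as their difference.
\<close>

definition pair_class :: "nat \<Rightarrow> nat \<Rightarrow> nat" where
  "pair_class i j = min (xor (masks ! i) (masks ! j)) (xor (xor (masks ! i) (masks ! j)) 255)"

lemma pair_class_commute: "pair_class i j = pair_class j i"
  by (simp add: pair_class_def xor.commute)

lemma min_xor_eq_iff:
  "min d (xor d c) = min e (xor e c) \<longleftrightarrow> d = e \<or> d = xor e c" for c d e :: nat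
proof
  assume "min d (xor d c) = min e (xor e c)"
  then consider "d = e" | "d = xor e c" | "xor d c = e" | "xor d c = xor e c"
    by (auto simp: min_def split: if_splits)
  then show "d = e \<or> d = xor e c"
  proof cases
    case 3 then have "d = xor e c" by (metis xor.assoc xor.right_neutral xor_self_eq)
    then show ?thesis ..
  next
    case 4 then have "d = e" by (metis xor.assoc xor.right_neutral xor_self_eq)
    then show ?thesis ..
  qed auto
next
  assume "d = e \<or> d = xor e c"
  then show "min d (xor d c) = min e (xor e c)"
    by (auto simp: xor.assoc min.commute)
qed

lemma bit_255: "bit (255::nat) k \<longleftrightarrow> k < 8"
proof -
  have "(255::nat) = mask 8" by (simp add: mask_eq_exp_minus_1)
  then show ?thesis by (simp only: bit_mask_iff) simp
qed

lemma nat_eq_iff_bits: "m = n \<longleftrightarrow> (\<forall>k. bit m k = bit n k)" for m n :: nat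
  by (auto simp: bit_eq_iff)

lemma bit_masks_iff: "bit (masks ! i) k \<longleftrightarrow> k \<in> ends i"
  by (simp add: ends_def)

lemma pair_class_eq_iff:
  assumes "x < 28" "y < 28" "a < 28" "b < 28"
  shows "pair_class x y = pair_class a b \<longleftrightarrow>
    (\<exists>c. \<forall>k<8. ((k \<in> ends x) \<noteq> (k \<in> ends y)) = (((k \<in> ends a) \<noteq> (k \<in> ends b)) \<noteq> c))"
proof -
  have big: "k \<notin> ends i" if "i < 28" "\<not> k < 8" for i k using ends_subset[OF that(1)] that(2) by auto
  have fin: "(\<forall>k. P k) \<longleftrightarrow> (\<forall>k<8. P k)" if "\<And>k. \<not> k < (8::nat) \<Longrightarrow> P k" for P using that by blast
  have 1: "xor (masks ! x) (masks ! y) = xor (masks ! a) (masks ! b) \<longleftrightarrow>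
      (\<forall>k<8. ((k \<in> ends x) \<noteq> (k \<in> ends y)) = ((k \<in> ends a) \<noteq> (k \<in> ends b)))"
    unfolding nat_eq_iff_bits bit_xor_iff bit_masks_iff by (subst fin) (simp_all add: big assms)
  have 2: "xor (masks ! x) (masks ! y) = xor (xor (masks ! a) (masks ! b)) 255 \<longleftrightarrow>
      (\<forall>k<8. ((k \<in> ends x) \<noteq> (k \<in> ends y)) = (((k \<in> ends a) \<noteq> (k \<in> ends b)) \<noteq> True))"
    unfolding nat_eq_iff_bits bit_xor_iff bit_masks_iff bit_255 by (subst fin) (simp_all add: big assms)
  show ?thesis unfolding pair_class_def min_xor_eq_iff 1 2 ex_bool_eq by (simp only: simp_thms disj_commute)
qed

text \<open>
  For four points the coordinate of the half sum at \<open>k\<close> is \<open>(1 - d)/2\<close>, where \<open>d\<close> is the degree of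
  \<open>k\<close> in the graph formed by the four edges. In a dual vector all coordinates are congruent modulo
  1; a vector of coordinate sum 0 all of whose coordinates are integers, or all half-integers,
  lies in the root lattice.
\<close>

lemma half_iff_degrees_same_parity:
  assumes "S \<subseteq> {..<28}" "card S = 4"
  shows "half S \<longleftrightarrow> (\<exists>c. \<forall>k<8. odd (card {i \<in> S. k \<in> ends i}) = c)"
proof -
  have fin: "finite S" using assms(1) by (rule finite_points)
  let ?y = "(1/2) *s (\<Sum>i\<in>S. pt i)"
  have y: "?y $ vtx k = (1 - of_nat (card {i \<in> S. k \<in> ends i})) / 2" if "k < 8" for k
  proof -
    have "?y $ vtx k = (1/2) * (\<Sum>i\<in>S. 1/4 - of_bool (k \<in> ends i))"
      using assms(1) that by (auto intro!: sum.cong simp: pt_vtx subset_iff)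
    also have "(\<Sum>i\<in>S. 1/4 - of_bool (k \<in> ends i)) = (1 - of_nat (card {i \<in> S. k \<in> ends i}) :: rat)"
      using fin assms(2) by (simp add: sum_subtractf sum.If_cases of_bool_def Int_def)
    finally show ?thesis by simp
  qed
  have all: "(\<forall>v. P v) \<longleftrightarrow> (\<forall>k<8. P (vtx k))" for P
    using bij_vtx unfolding bij_betw_def by (metis UNIV_I imageE lessThan_iff)
  show ?thesis
  proof
    assume "half S"
    then have D: "?y $ v - ?y $ w \<in> \<int>" for v w using E7_dualD(2) unfolding half_def by blast
    have "odd (card {i \<in> S. k \<in> ends i}) = odd (card {i \<in> S. 0 \<in> ends i})" if "k < 8" for k
    proof -
      obtain z :: int where "?y $ vtx 0 - ?y $ vtx k = of_int z" using D Ints_cases by metis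
      then have "of_int (int (card {i \<in> S. k \<in> ends i}) - int (card {i \<in> S. 0 \<in> ends i})) = (of_int (2 * z) :: rat)"
        using y[OF that] y[of 0] by (simp add: field_simps)
      then have "int (card {i \<in> S. k \<in> ends i}) - int (card {i \<in> S. 0 \<in> ends i}) = 2 * z" by (simp only: of_int_eq_iff)
      then show ?thesis by presburger
    qed
    then show "\<exists>c. \<forall>k<8. odd (card {i \<in> S. k \<in> ends i}) = c" by blast
  next
    assume "\<exists>c. \<forall>k<8. odd (card {i \<in> S. k \<in> ends i}) = c"
    then obtain c where c: "\<And>k. k < 8 \<Longrightarrow> odd (card {i \<in> S. k \<in> ends i}) = c" by blast
    have "?y $ vtx k - (if c then 0 else 1/2) \<in> \<int>" if k: "k < 8" for k
    proof (cases c)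
      case True
      then obtain m where "card {i \<in> S. k \<in> ends i} = 2 * m + 1" using c[OF k] by (auto elim: oddE)
      then have "?y $ vtx k = of_int (- int m)" using y[OF k] by simp
      then show ?thesis using True by (simp only: if_True diff_zero Ints_of_int)
    next
      case False
      then obtain m where "card {i \<in> S. k \<in> ends i} = 2 * m" using c[OF k] by (auto elim: evenE)
      then have "?y $ vtx k - 1/2 = of_int (- int m)" using y[OF k] by (simp add: field_simps)
      then show ?thesis using False by (simp only: if_False Ints_of_int)
    qed
    then have "(\<forall>v. ?y $ v \<in> \<int>) \<or> (\<forall>v. ?y $ v - 1/2 \<in> \<int>)"
      unfolding all[of "\<lambda>v. ?y $ v \<in> \<int>"] all[of "\<lambda>v. ?y $ v - 1/2 \<in> \<int>"] by (cases c) auto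
    moreover have "(\<Sum>v\<in>UNIV. ?y $ v) = 0"
    proof -
      have "(\<Sum>v\<in>UNIV. ?y $ v) = (\<Sum>v\<in>UNIV. (1/2) * (\<Sum>i\<in>S. pt i $ v))" by simp
      also have "\<dots> = (1/2) * (\<Sum>v\<in>UNIV. \<Sum>i\<in>S. pt i $ v)" by (rule sum_distrib_left[symmetric])
      also have "(\<Sum>v\<in>UNIV. \<Sum>i\<in>S. pt i $ v) = (\<Sum>i\<in>S. \<Sum>v\<in>UNIV. pt i $ v)" by (rule sum.swap)
      also have "(\<Sum>i\<in>S. \<Sum>v\<in>UNIV. pt i $ v) = 0"
        using E7_dualD(1)[OF pt_in_E7_dual] assms(1) by (intro sum.neutral) auto
      finally show ?thesis by simp
    qed
    ultimately have "?y \<in> E7_lattice" unfolding E7_lattice_iff by blast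
    then show "half S" unfolding half_def by (rule E7_lattice_subset_dual)
  qed
qed

lemma balanced_iff_pair_class:
  assumes "{x, y, a, b} \<subseteq> {..<28}" "distinct [x, y, a, b]"
  shows "balanced {x, y, a, b} \<longleftrightarrow> pair_class x y = pair_class a b"
proof -
  have card: "card {x, y, a, b} = 4" using assms(2) by simp
  have deg: "odd (card {i \<in> {x, y, a, b}. P i}) = (((P x \<noteq> P y) \<noteq> P a) \<noteq> P b)" for P
  proof -
    have "card {i \<in> {x, y, a, b}. P i} = (\<Sum>i\<in>{x, y, a, b}. of_bool (P i))"
      by (simp add: sum.If_cases of_bool_def Int_def)
    also have "\<dots> = of_bool (P x) + (of_bool (P y) + (of_bool (P a) + of_bool (P b)))" using assms(2) by simp
    finally show ?thesis by simp
  qed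
  have "balanced {x, y, a, b} \<longleftrightarrow> half {x, y, a, b}"
    using balanced_imp_half[OF assms(1)] half_4_imp_balanced[OF assms(1) card] by blast
  also have "\<dots> \<longleftrightarrow> (\<exists>c. \<forall>k<8. ((k \<in> ends x) \<noteq> (k \<in> ends y)) = (((k \<in> ends a) \<noteq> (k \<in> ends b)) \<noteq> c))"
    unfolding half_iff_degrees_same_parity[OF assms(1) card] deg by (intro ex_cong1 all_cong) blast
  also have "\<dots> \<longleftrightarrow> pair_class x y = pair_class a b"
    by (rule pair_class_eq_iff[symmetric]) (use assms(1) in auto)
  finally show ?thesis .
qed

text \<open>
  The edges \<open>y\<close> and \<open>b\<close> are equal or complementary, and two edges do not cover 8 vertices.
\<close>

lemma pair_class_cancel:
  assumes "x < 28" "y < 28" "b < 28" "pair_class x y = pair_class x b"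
  shows "y = b"
proof -
  obtain c where c: "\<forall>k<8. ((k \<in> ends x) \<noteq> (k \<in> ends y)) = (((k \<in> ends x) \<noteq> (k \<in> ends b)) \<noteq> c)"
    using assms(4) pair_class_eq_iff[OF assms(1,2,1,3)] by blast
  have "\<not> c"
  proof
    assume c
    then have "{..<8} \<subseteq> ends y \<union> ends b" using c by blast
    moreover have "finite (ends y)" "finite (ends b)" using card_ends assms by (auto intro: card_ge_0_finite)
    ultimately have "card {..<8::nat} \<le> card (ends y \<union> ends b)" by (intro card_mono) auto
    also have "\<dots> \<le> 4" using card_Un_le[of "ends y" "ends b"] assms by (simp add: card_ends)
    finally show False by simp
  qed
  then have "\<forall>k<8. k \<in> ends y \<longleftrightarrow> k \<in> ends b" using c by blast
  then have "ends y = ends b" using ends_subset assms by (auto simp: subset_iff)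
  then show ?thesis using ends_inj assms by blast
qed

definition class_size :: "nat set \<Rightarrow> nat \<Rightarrow> nat" where
  "class_size J d = card {(i, j). i < j \<and> i \<in> J \<and> j \<in> J \<and> pair_class i j = d}"

text \<open>
  A triple \<open>{y, i, j}\<close> completed by \<open>x\<close> corresponds to a pair \<open>{i, j}\<close> in the class of \<open>{x, y}\<close>.
  The pair \<open>{x, y}\<close> belongs to that class too but gives no triple; it lies in \<open>J\<close> exactly if \<open>x\<close>
  does.
\<close>

lemma card_completed_through:
  assumes "J \<subseteq> {..<28}" "x < 28" "y \<in> J" "x \<noteq> y"
  shows "int (card {t \<in> completed J x. y \<in> t}) = int (class_size J (pair_class x y)) - of_bool (x \<in> J)"
proof -
  have fin: "finite J" using assms(1) by (rule finite_points)
  have y: "y < 28" using assms by auto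
  let ?R = "{(i, j). i < j \<and> i \<in> J \<and> j \<in> J \<and> pair_class i j = pair_class x y}"
  let ?Q = "{(i, j) \<in> ?R. i \<notin> {x, y} \<and> j \<notin> {x, y}}"
  let ?xy = "if x \<in> J then {(min x y, max x y)} else {}"
  have finR: "finite ?R" by (rule finite_subset[of _ "J \<times> J"]) (use fin in auto)
  have "?R = ?Q \<union> ?xy"
  proof (intro equalityI subsetI)
    fix q assume "q \<in> ?R"
    then obtain i j where q: "q = (i, j)" "i < j" "i \<in> J" "j \<in> J" "pair_class i j = pair_class x y" by auto
    have lt: "i < 28" "j < 28" using q assms(1) by auto
    consider "i \<notin> {x, y} \<and> j \<notin> {x, y}" | "i = x" | "i = y" | "j = x" | "j = y" by blast
    then show "q \<in> ?Q \<union> ?xy"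
    proof cases
      case 1 then show ?thesis using q by auto
    next
      case 2
      then have "j = y" using pair_class_cancel[of x j y] q lt y by simp
      then show ?thesis using 2 q by simp
    next
      case 3
      then have "j = x" using pair_class_cancel[of y j x] q lt assms(2) pair_class_commute[of x y] by simp
      then show ?thesis using 3 q by simp
    next
      case 4
      then have "i = y" using pair_class_cancel[of x i y] q lt y pair_class_commute[of i x] by simp
      then show ?thesis using 4 q by simp
    next
      case 5
      then have "i = x" using pair_class_cancel[of y i x] q lt assms(2) pair_class_commute[of x y] pair_class_commute[of i y] by simp
      then show ?thesis using 5 q by simp
    qed
  next
    fix q assume "q \<in> ?Q \<union> ?xy"
    then show "q \<in> ?R" using assms(3,4) pair_class_commute[of x y] by (auto simp: min_def max_def split: if_splits)
  qed
  moreover have "?Q \<inter> ?xy = {}" by (auto simp: min_def max_def)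
  ultimately have "card ?R = card ?Q + card ?xy"
    using finR by (metis (no_types, lifting) card_Un_disjoint finite_Un)
  moreover have "card ?Q = card {t \<in> completed J x. y \<in> t}"
  proof (rule bij_betw_same_card)
    show "bij_betw (\<lambda>(i, j). {y, i, j}) ?Q {t \<in> completed J x. y \<in> t}"
      unfolding bij_betw_def
    proof (intro conjI equalityI subsetI)
      show "inj_on (\<lambda>(i, j). {y, i, j}) ?Q"
      proof (rule inj_onI)
        fix u v assume uv: "u \<in> ?Q" "v \<in> ?Q" "(\<lambda>(i, j). {y, i, j}) u = (\<lambda>(i, j). {y, i, j}) v"
        obtain i j i' j' where eq: "u = (i, j)" "v = (i', j')" by (cases u, cases v)
        have ne: "y \<notin> {i, j}" "y \<notin> {i', j'}" and lt: "i < j" "i' < j'" using uv(1,2) unfolding eq by auto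
        have "{y, i, j} = {y, i', j'}" using uv(3) unfolding eq by simp
        then have "{i, j} = {i', j'}" using insert_ident[OF ne] by (rule iffD1[rotated])
        then show "u = v" using lt unfolding eq by (auto simp: doubleton_eq_iff)
      qed
    next
      fix t assume "t \<in> (\<lambda>(i, j). {y, i, j}) ` ?Q"
      then obtain i j where t: "t = {y, i, j}" "i < j" "i \<in> J" "j \<in> J" "pair_class i j = pair_class x y"
        "i \<notin> {x, y}" "j \<notin> {x, y}" by auto
      have sub: "{x, y, i, j} \<subseteq> {..<28}" using t assms y by auto
      then have "balanced {x, y, i, j}" using t assms by (subst balanced_iff_pair_class) auto
      then have "completes x t" using t sub assms(4) by (simp add: completes_def)
      then show "t \<in> {t \<in> completed J x. y \<in> t}" using t assms by (simp add: completed_def)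
    next
      fix t assume "t \<in> {t \<in> completed J x. y \<in> t}"
      then have t: "t \<subseteq> J" "completes x t" "y \<in> t" by (auto simp: completed_def)
      note d = t(2)[unfolded completes_def]
      have "card (t - {y}) = 2" using d t(3) by simp
      then obtain p q where "t - {y} = {p, q}" "p \<noteq> q" by (auto simp: card_2_iff)
      then obtain i j where ij: "t - {y} = {i, j}" "i < j" by (metis insert_commute linorder_neqE_nat)
      then have t_eq: "t = {y, i, j}" and ne: "i \<noteq> y" "j \<noteq> y" using t(3) by auto
      have ne': "i \<noteq> x" "j \<noteq> x" using d t_eq by auto
      have sub: "{x, y, i, j} \<subseteq> {..<28}" using d t_eq by auto
      have "insert x t = {x, y, i, j}" unfolding t_eq ..
      then have "balanced {x, y, i, j}" using d by simp
      then have "pair_class x y = pair_class i j"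
        using balanced_iff_pair_class[OF sub] ne ne' ij(2) assms(4) by auto
      then show "t \<in> (\<lambda>(i, j). {y, i, j}) ` ?Q"
        using t_eq ij(2) t(1) ne ne' by (intro image_eqI[of _ _ "(i, j)"]) auto
    qed
  qed
  moreover have "card ?xy = of_bool (x \<in> J)" by simp
  ultimately have "class_size J (pair_class x y) = card {t \<in> completed J x. y \<in> t} + of_bool (x \<in> J)"
    by (simp only: class_size_def)
  then show ?thesis by simp
qed

section \<open>Circuits of size seven\<close>

text \<open>
  As \<open>sg i0 i = e i0 * e i\<close>, the product of the three signs is the product of the two normalised
  signs with \<open>y\<close>.
\<close>

lemma neg_triples_sign_changes:
  assumes "S \<subseteq> {..<28}" "i0 \<in> S" "y < 28" "y \<notin> S" "signing e"
    "\<And>i j. i \<in> S \<Longrightarrow> j \<in> S \<Longrightarrow> i \<noteq> j \<Longrightarrow> e i * e j * sg i j = 1"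
  shows "{i \<in> S. neg y i0 i} = {i \<in> S. e i * sg i y \<noteq> e i0 * sg i0 y}"
proof -
  have "neg y i0 i \<longleftrightarrow> e i * sg i y \<noteq> e i0 * sg i0 y" if i: "i \<in> S" for i
  proof (cases "i = i0")
    case True then show ?thesis by (simp add: neg_def)
  next
    case False
    have "neg y i0 i \<longleftrightarrow> sg y i0 * sg i0 i * sg y i = - 1" using False i assms by (auto simp: neg_def)
    also have "sg i0 i = e i0 * e i"
    proof -
      have "e i0 * e i * (e i0 * e i * sg i0 i) = (e i0 * e i0) * (e i * e i) * sg i0 i" by (simp add: mult_ac)
      then show ?thesis using assms(6)[OF assms(2) i] False by (simp add: signing_square[OF assms(5)])
    qed
    also have "sg y i0 * (e i0 * e i) * sg y i = (e i * sg i y) * (e i0 * sg i0 y)"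
      by (simp add: sg_commute[of y] mult_ac)
    also have "(e i * sg i y) * (e i0 * sg i0 y) = - 1 \<longleftrightarrow> e i * sg i y \<noteq> e i0 * sg i0 y"
      using signed_sg_cases[OF assms(5), of i y] signed_sg_cases[OF assms(5), of i0 y] by auto
    finally show ?thesis .
  qed
  then show ?thesis by blast
qed

text \<open>
  Six vectors with all pairwise inner products \<open>1/2\<close> and a seventh one with inner products
  \<open>p i / 2\<close>. In the relation let \<open>c y\<close> be the coefficient of the seventh, \<open>s\<close> the sum of the
  others up to the normalised signs, and \<open>P\<close> the sum of the signs \<open>p i\<close>. Adding the six Gram rows
  gives \<open>8 * s + P * c y = 0\<close>; adding them with weights \<open>p i\<close> and using the seventh row gives
  \<open>P * s = 0\<close>. As the six vectors are independent, \<open>c y \<noteq> 0\<close>, and both equations force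
  \<open>P = 0\<close>. If \<open>P = 0\<close>, the coefficients \<open>2\<close> and \<open>- p i\<close> solve the equations.
\<close>

lemma dep_insert_iff_signs_cancel:
  assumes "S \<subseteq> {..<28}" "card S = 6" "y < 28" "y \<notin> S" "signing e"
    "\<And>i j. i \<in> S \<Longrightarrow> j \<in> S \<Longrightarrow> i \<noteq> j \<Longrightarrow> e i * e j * sg i j = 1"
  shows "dep (insert y S) \<longleftrightarrow> (\<Sum>i\<in>S. e i * sg i y) = 0"
proof -
  have fin: "finite S" using assms(1) by (rule finite_points)
  have sub: "insert y S \<subseteq> {..<28}" using assms by simp
  have yS: "insert y S - {y} = S" using assms(4) by auto
  define p where "p i = e i * sg i y" for i
  define P where "P = (\<Sum>i\<in>S. p i)"
  have pp: "p i * p i = 1" for i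
  proof -
    have "p i * p i = (e i * e i) * (sg i y * sg i y)" by (simp add: p_def mult_ac)
    then show ?thesis by (simp add: signing_square[OF assms(5)] sg_square)
  qed
  have S_row: "(\<Sum>i\<in>insert y S - {j}. c i * sg i j) * e j = (\<Sum>i\<in>S - {j}. e i * c i) + p j * c y"
    if j: "j \<in> S" for c :: "nat \<Rightarrow> rat" and j
  proof -
    have ne: "y \<noteq> j" using j assms(4) by blast
    have "insert y S - {j} = insert y (S - {j})" using ne by blast
    then have "(\<Sum>i\<in>insert y S - {j}. c i * sg i j) * e j = c y * sg y j * e j + (\<Sum>i\<in>S - {j}. c i * sg i j * e j)"
      using fin assms(4) by (simp add: distrib_right sum_distrib_right)
    also have "(\<Sum>i\<in>S - {j}. c i * sg i j * e j) = (\<Sum>i\<in>S - {j}. e i * c i)"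
    proof (rule sum.cong)
      fix i assume i: "i \<in> S - {j}"
      have "e j * sg i j = e i * (e i * e j * sg i j)" using signing_square[OF assms(5), of i] by (simp flip: mult.assoc)
      also have "\<dots> = e i" by (subst assms(6)) (use i j in auto)
      finally have "e j * sg i j = e i" .
      then show "c i * sg i j * e j = e i * c i" by (simp add: mult_ac)
    qed simp
    finally show ?thesis by (simp add: p_def sg_commute[of y j] mult_ac)
  qed
  show ?thesis
  proof
    assume "dep (insert y S)"
    then obtain c where c: "\<exists>i\<in>insert y S. c i \<noteq> 0" "(\<Sum>i\<in>insert y S. c i *s pt i) = 0"
      unfolding dep_def by blast
    define s where "s = (\<Sum>i\<in>S. e i * c i)"
    have cy: "c y \<noteq> 0"
    proof
      assume "c y = 0"
      then have "(\<Sum>i\<in>S. c i *s pt i) = 0" using c(2) fin assms(4) by simp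
      moreover have "\<exists>i\<in>S. c i \<noteq> 0" using c(1) \<open>c y = 0\<close> by auto
      ultimately have "dep S" unfolding dep_def by blast
      moreover have "\<not> neg i j k" if "i \<in> S" "j \<in> S" "k \<in> S" for i j k
      proof
        assume n: "neg i j k"
        then have d: "distinct [i, j, k]" by (auto simp: neg_def)
        show False using n[unfolded signs_neg_iff[OF assms(5) d]] assms(6) that d by simp
      qed
      ultimately show False using no_neg_imp_indep[OF assms(1)] by blast
    qed
    have row: "2 * (e j * c j) + s + p j * c y = 0" if j: "j \<in> S" for j
    proof -
      have "(3 * c j + (\<Sum>i\<in>insert y S - {j}. c i * sg i j)) * e j = 0"
        using gram_row[OF sub c(2)] j by simp
      then have "3 * c j * e j + ((\<Sum>i\<in>S - {j}. e i * c i) + p j * c y) = 0"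
        unfolding distrib_right S_row[OF j] .
      then have "3 * (e j * c j) + ((\<Sum>i\<in>S - {j}. e i * c i) + p j * c y) = 0"
        by (simp add: mult_ac)
      then show ?thesis using sum.remove[OF fin j, of "\<lambda>i. e i * c i"] unfolding s_def by linarith
    qed
    have "(\<Sum>j\<in>S. 2 * (e j * c j) + s + p j * c y) = 0" using row by simp
    then have A: "8 * s + P * c y = 0"
      using assms(2) by (simp add: sum.distrib s_def P_def flip: sum_distrib_left sum_distrib_right)
    have "(\<Sum>j\<in>S. p j * (2 * (e j * c j) + s + p j * c y)) = 0" using row by simp
    also have "(\<Sum>j\<in>S. p j * (2 * (e j * c j) + s + p j * c y)) = (\<Sum>j\<in>S. 2 * (p j * (e j * c j)) + p j * s + c y)"
      using pp by (intro sum.cong refl) (simp add: distrib_left flip: mult.assoc)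
    also have "\<dots> = 2 * (\<Sum>j\<in>S. p j * (e j * c j)) + P * s + 6 * c y"
      using assms(2) by (simp add: sum.distrib P_def flip: sum_distrib_left sum_distrib_right)
    also have "(\<Sum>j\<in>S. p j * (e j * c j)) = (\<Sum>i\<in>S. c i * sg i y)"
    proof (rule sum.cong)
      fix i
      have "p i * (e i * c i) = (e i * e i) * (c i * sg i y)" by (simp add: p_def mult_ac)
      then show "p i * (e i * c i) = c i * sg i y" by (simp add: signing_square[OF assms(5)])
    qed simp
    finally have "2 * (\<Sum>i\<in>S. c i * sg i y) + P * s + 6 * c y = 0" .
    moreover have "3 * c y + (\<Sum>i\<in>S. c i * sg i y) = 0" using gram_row[OF sub c(2), of y] yS by simp
    ultimately have "P * s = 0" by linarith
    then have "P * (8 * s) = 0" by simp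
    moreover have "8 * s = - (P * c y)" using A by linarith
    ultimately have "P * (P * c y) = 0" by simp
    then show "(\<Sum>i\<in>S. e i * sg i y) = 0" using cy by (simp add: P_def p_def)
  next
    assume "(\<Sum>i\<in>S. e i * sg i y) = 0"
    then have P0: "P = 0" by (simp add: P_def p_def)
    define c where "c = (\<lambda>i. if i = y then 2 else - (e i * p i))"
    have ec: "e i * c i = - p i" if "i \<in> S" for i
    proof -
      have "e i * c i = - ((e i * e i) * p i)" using that assms(4) by (auto simp: c_def)
      then show ?thesis by (simp add: signing_square[OF assms(5)])
    qed
    have "(\<Sum>i\<in>insert y S. c i *s pt i) = 0"
    proof (rule gram_rows_imp_zero[OF sub])
      fix j assume "j \<in> insert y S"
      then consider "j = y" | "j \<in> S" by blast
      then show "3 * c j + (\<Sum>i\<in>insert y S - {j}. c i * sg i j) = 0"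
      proof cases
        case 1
        have "(\<Sum>i\<in>S. c i * sg i y) = (\<Sum>i\<in>S. - 1)"
        proof (rule sum.cong)
          fix i assume i: "i \<in> S"
          have "c i * sg i y = - (p i * (e i * sg i y))" using i assms(4) by (auto simp: c_def mult_ac)
          then show "c i * sg i y = - 1" using pp[of i] by (simp add: p_def)
        qed simp
        then show ?thesis using 1 yS assms(2) by (simp add: c_def)
      next
        case 2
        have "(\<Sum>i\<in>S - {j}. e i * c i) = (\<Sum>i\<in>S - {j}. - p i)" using ec by (intro sum.cong) auto
        also have "\<dots> = p j" using P0 sum.remove[OF fin 2, of p] by (simp add: P_def sum_negf)
        finally have s: "(\<Sum>i\<in>S - {j}. e i * c i) = p j" .
        have "(3 * c j + (\<Sum>i\<in>insert y S - {j}. c i * sg i j)) * e j = 3 * (e j * c j) + (p j + p j * c y)"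
          unfolding distrib_right S_row[OF 2] s by (simp add: mult_ac)
        also have "\<dots> = 0" unfolding ec[OF 2] by (simp add: c_def)
        finally have "(3 * c j + (\<Sum>i\<in>insert y S - {j}. c i * sg i j)) * e j = 0" .
        then show ?thesis using signing_square[OF assms(5), of j] by auto
      qed
    qed
    then show "dep (insert y S)" unfolding dep_def by (intro exI[of _ c]) (auto simp: c_def)
  qed
qed

definition clear :: "nat set \<Rightarrow> bool" where
  "clear H \<longleftrightarrow> (\<forall>i\<in>H. \<forall>j\<in>H. \<forall>k\<in>H. \<not> neg i j k)"

text \<open>
  If \<open>H\<close> has six points and no negative triple, the points \<open>i\<close> with \<open>neg y h i\<close> are those whose
  normalised sign with \<open>y\<close> differs from that of \<open>h\<close>. The condition says that \<open>H\<close> has three points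
  of each sign.
\<close>

definition halves :: "nat \<Rightarrow> nat set \<Rightarrow> bool" where
  "halves y H \<longleftrightarrow> (\<forall>h\<in>H. card {i \<in> H. neg y h i} = 3)"

lemma clear_6_dep_iff:
  assumes "H \<subseteq> {..<28}" "card H = 6" "y < 28" "y \<notin> H" "clear H" "h \<in> H"
  shows "dep (insert y H) \<longleftrightarrow> card {i \<in> H. neg y h i} = 3"
proof -
  have fin: "finite H" using assms(1) by (rule finite_points)
  obtain e where e: "signing e" "\<And>i j. i \<in> H \<Longrightarrow> j \<in> H \<Longrightarrow> i \<noteq> j \<Longrightarrow> e i * e j * sg i j = 1"
    using no_neg_signs[OF assms(6)] assms(5) unfolding clear_def by blast
  define p where "p i = e i * sg i y" for i
  have pm: "p k = 1 \<or> p k = - 1" for k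
    unfolding p_def using e(1) by (rule signed_sg_cases)
  have set: "{i \<in> H. neg y h i} = {i \<in> H. p i \<noteq> p h}"
    unfolding p_def by (rule neg_triples_sign_changes[OF assms(1,6,3,4) e])
  have "(\<Sum>i\<in>H. p i) = (\<Sum>i\<in>H. p h * (1 - 2 * of_bool (p i \<noteq> p h)))"
  proof (rule sum.cong)
    fix i show "p i = p h * (1 - 2 * of_bool (p i \<noteq> p h))" using pm[of i] pm[of h] by auto
  qed simp
  also have "\<dots> = p h * (6 - 2 * of_nat (card {i \<in> H. p i \<noteq> p h}))"
    using fin assms(2)
    by (simp add: sum_subtractf sum.If_cases of_bool_def Int_def if_distrib[of "\<lambda>t. 2 * t"] flip: sum_distrib_left cong: if_cong)
  finally have sum: "(\<Sum>i\<in>H. p i) = p h * (6 - 2 * of_nat (card {i \<in> H. p i \<noteq> p h}))" .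
  have "dep (insert y H) \<longleftrightarrow> (\<Sum>i\<in>H. p i) = 0"
    unfolding p_def by (rule dep_insert_iff_signs_cancel[OF assms(1-4) e])
  also have "\<dots> \<longleftrightarrow> (6 - 2 * of_nat (card {i \<in> H. p i \<noteq> p h}) :: rat) = 0"
    unfolding sum using pm[of h] by auto
  also have "\<dots> \<longleftrightarrow> of_nat (card {i \<in> H. p i \<noteq> p h}) = (of_nat 3 :: rat)" by auto
  also have "\<dots> \<longleftrightarrow> card {i \<in> H. neg y h i} = 3" unfolding set of_nat_eq_iff ..
  finally show ?thesis .
qed

lemma balanced_4_not_clear:
  assumes "T \<subseteq> {..<28}" "card T = 4" "balanced T" "U \<subseteq> T" "card U = 3"
  shows "\<not> clear U"
proof -
  obtain i j k where "U = {i, j, k}" "distinct [i, j, k]"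
    using assms(5) by (auto simp: card_Suc_eq numeral_eq_Suc)
  then show ?thesis using balanced_4_neg[OF assms(1-3), of i j k] assms(4) unfolding clear_def by blast
qed

lemma clear_mono: "clear H \<Longrightarrow> T \<subseteq> H \<Longrightarrow> clear T"
  unfolding clear_def by blast

text \<open>
  The odd coefficients of a 7-circuit form a set of size 6, since a smaller one would be a
  balanced quadruple. It has no negative triple, as otherwise it would be balanced. The remaining
  point, which has an even coefficient, is \<open>y\<close>.
\<close>

lemma circuit_7_imp_clear:
  assumes "S \<subseteq> {..<28}" "card S = 7" "circuit S"
  shows "\<exists>y\<in>S. clear (S - {y}) \<and> halves y (S - {y})"
proof -
  have dep: "dep S" using assms(3) unfolding circuit_def by blast
  obtain T where T: "T \<subseteq> S" "T \<noteq> {}" "even (card T)" "half T"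
    using dep by (rule dep_imp_half[OF assms(1)])
  have fin: "finite S" using assms(1) by (rule finite_points)
  have T28: "T \<subseteq> {..<28}" using T(1) assms(1) by blast
  have "4 \<le> card T" using T T28 by (intro half_card_ge_4) auto
  moreover have "card T \<noteq> 4"
  proof
    assume 4: "card T = 4"
    then have "balanced T" using T(4) T28 by (intro half_4_imp_balanced)
    then show False using circuit_no_balanced_4[OF assms(1,3) T(1) 4] 4 assms(2) by simp
  qed
  moreover have "card T \<le> 7" using card_mono[OF fin T(1)] assms(2) by simp
  ultimately have T6: "card T = 6" using T(3) by presburger
  then have "card (S - T) = 1" using card_Diff_subset[OF finite_subset[OF T(1) fin] T(1)] assms(2) by simp
  then obtain y where y: "S - T = {y}" by (rule card_1_singletonE)
  then have yS: "y \<in> S" "T = S - {y}" "y \<notin> T" "insert y T = S" using T(1) by auto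
  have "clear T"
  proof (rule ccontr)
    assume "\<not> clear T"
    then obtain a b c where abc: "a \<in> T" "b \<in> T" "c \<in> T" "neg a b c" unfolding clear_def by blast
    have "x \<notin> T" if "completes x {a, b, c}" for x
    proof -
      have "{a, b, c} \<subseteq> S" using abc T(1) by blast
      then have "x \<notin> S" using circuit_completion_outside[OF assms(1,3) _ _ that] assms(2) by simp
      then show ?thesis using T(1) by blast
    qed
    then have "balanced T" by (rule half_6_with_neg_imp_balanced[OF T28 T6 T(4) abc])
    then have "dep T" using T(2) by (rule balanced_imp_dep)
    then show False using assms(3) yS unfolding circuit_def by blast
  qed
  moreover have "halves y T"
    unfolding halves_def using clear_6_dep_iff[OF T28 T6 _ yS(3) \<open>clear T\<close>] dep yS assms(1) by auto
  ultimately show ?thesis using yS by blast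
qed

text \<open>
  If removing \<open>h\<close> left a dependent set, its odd coefficients could not form a quadruple, as three
  of its points would lie in \<open>H\<close> and be negative. So they form the whole set. A negative triple
  \<open>{y, h0, i}\<close>, which exists by \<open>halves\<close>, is then complemented by a negative triple inside \<open>H\<close>.
\<close>

lemma clear_halves_imp_circuit:
  assumes "H \<subseteq> {..<28}" "card H = 6" "y < 28" "y \<notin> H" "clear H" "halves y H"
  shows "circuit (insert y H)"
proof -
  have fin: "finite H" using assms(1) by (rule finite_points)
  have H0: "H \<noteq> {}" using assms(2) by auto
  then have "dep (insert y H)" using clear_6_dep_iff[OF assms(1-5)] assms(6) unfolding halves_def by blast
  moreover have "\<not> dep (insert y H - {h})" if h: "h \<in> insert y H" for h
  proof (cases "h = y")
    case True
    then have "insert y H - {h} = H" using assms(4) by auto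
    then show ?thesis using no_neg_imp_indep[OF assms(1)] assms(5) unfolding clear_def by metis
  next
    case False
    then have hH: "h \<in> H" using h by blast
    let ?S = "insert y H - {h}"
    have S28: "?S \<subseteq> {..<28}" using assms by auto
    have S6: "card ?S = 6" using assms(2,4) fin h by simp
    show ?thesis
    proof
      assume "dep ?S"
      then obtain T where T: "T \<subseteq> ?S" "T \<noteq> {}" "even (card T)" "half T" by (rule dep_imp_half[OF S28])
      have T28: "T \<subseteq> {..<28}" using T(1) S28 by blast
      have finT: "finite T" using T28 by (rule finite_points)
      have "4 \<le> card T" using T T28 by (intro half_card_ge_4) auto
      moreover have "card T \<noteq> 4"
      proof
        assume 4: "card T = 4"
        then have "balanced T" using T(4) T28 by (intro half_4_imp_balanced)
        have "3 \<le> card (T - {y})" using 4 finT by (simp add: card_Diff_singleton_if)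
        then obtain U where U: "U \<subseteq> T - {y}" "card U = 3" by (rule obtain_subset_with_card_n)
        then have "\<not> clear U" using balanced_4_not_clear[OF T28 4 \<open>balanced T\<close>] by blast
        moreover have "U \<subseteq> H" using U T(1) by blast
        ultimately show False using clear_mono[OF assms(5)] by blast
      qed
      moreover have "card T \<le> 6" using card_mono[OF _ T(1)] S6 fin by simp
      ultimately have "card T = 6" using T(3) by presburger
      then have TS: "T = ?S" using T(1) S6 fin by (intro card_seteq) auto
      obtain h0 where h0: "h0 \<in> H" "h0 \<noteq> h" using ex_not_in_list[of "[h]" H] assms(2) by auto
      have "card {i \<in> H. neg y h0 i} = 3" using assms(6) h0(1) unfolding halves_def by blast
      then obtain i where i: "i \<in> H" "neg y h0 i" "i \<noteq> h"
        using ex_not_in_list[of "[h]" "{i \<in> H. neg y h0 i}"] by auto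
      have lt: "h0 < 28" "i < 28" using h0 i assms(1) by auto
      obtain x where x: "completes x {y, h0, i}" using neg_imp_completes[OF i(2) assms(3) lt] .
      have "x \<notin> ?S"
      proof
        assume "x \<in> ?S"
        then have xH: "x \<in> H" using x by (auto simp: completes_def)
        have ne: "y \<noteq> h0" "h0 \<noteq> i" "y \<noteq> i" using i(2) by (auto simp: neg_def)
        have "x \<notin> {y, h0, i}" using x by (simp add: completes_def)
        then have "neg x h0 i"
          using x ne lt assms(3) by (intro balanced_4_neg[of "insert x {y, h0, i}"]) (auto simp: completes_def)
        then show False using assms(5) xH h0(1) i(1) unfolding clear_def by blast
      qed
      moreover have "{y, h0, i} \<subseteq> ?S" using h0 i False by auto
      ultimately have c: "completes x (?S - {y, h0, i})"
        using completes_complement[OF S28 S6 _ _ x] T(4) TS by simp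
      then have "card (?S - {y, h0, i}) = 3" by (simp add: completes_def)
      then obtain p q r where pqr: "?S - {y, h0, i} = {p, q, r}" "distinct [p, q, r]"
        by (auto simp: card_Suc_eq numeral_eq_Suc)
      have "neg p q r" using c pqr by (intro completes_imp_neg[OF c]) auto
      moreover have "{p, q, r} \<subseteq> H" unfolding pqr(1)[symmetric] by blast
      ultimately show False using assms(5) unfolding clear_def by blast
    qed
  qed
  ultimately show ?thesis unfolding circuit_def by blast
qed

text \<open>
  The point \<open>y\<close> is in negative triples even after removing any other point, so it is determined by
  the circuit.
\<close>

lemma clear_halves_unique:
  assumes "insert y H = insert z K" "y \<notin> H" "z \<notin> K" "card H = 6" "halves y H" "clear K"
  shows "y = z \<and> H = K"
proof -
  have "y = z"
  proof (rule ccontr)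
    assume "y \<noteq> z"
    then have y: "y \<in> K" using assms(1) by blast
    obtain h where h: "h \<in> H" "h \<noteq> z" using ex_not_in_list[of "[z]" H] assms(4) by auto
    have "card {i \<in> H. neg y h i} = 3" using assms(5) h(1) unfolding halves_def by blast
    then obtain i where i: "i \<in> H" "neg y h i" "i \<noteq> z"
      using ex_not_in_list[of "[z]" "{i \<in> H. neg y h i}"] by auto
    have "h \<in> K" "i \<in> K" using h i assms(1) by auto
    then show False using assms(6) y i(2) unfolding clear_def by blast
  qed
  then show ?thesis using assms(1-3) by (metis insert_ident)
qed

lemma card_circuits_7:
  assumes "J \<subseteq> {..<28}"
  shows "card {S. S \<subseteq> J \<and> card S = 7 \<and> circuit S}
    = (\<Sum>H | H \<subseteq> J \<and> card H = 6 \<and> clear H. card {y \<in> J. y \<notin> H \<and> halves y H})"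
proof -
  have fin: "finite J" using assms by (rule finite_points)
  let ?H = "{H. H \<subseteq> J \<and> card H = 6 \<and> clear H}"
  let ?P = "SIGMA H:?H. {y \<in> J. y \<notin> H \<and> halves y H}"
  have "{S. S \<subseteq> J \<and> card S = 7 \<and> circuit S} = (\<lambda>(H, y). insert y H) ` ?P"
  proof (intro equalityI subsetI)
    fix S assume "S \<in> {S. S \<subseteq> J \<and> card S = 7 \<and> circuit S}"
    then have S: "S \<subseteq> J" "card S = 7" "circuit S" by auto
    then obtain y where y: "y \<in> S" "clear (S - {y})" "halves y (S - {y})"
      using circuit_7_imp_clear[of S] assms by blast
    have "card (S - {y}) = 6" using S(2) y(1) by simp
    then show "S \<in> (\<lambda>(H, y). insert y H) ` ?P"
      using S y by (intro image_eqI[of _ _ "(S - {y}, y)"]) auto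
  next
    fix S assume "S \<in> (\<lambda>(H, y). insert y H) ` ?P"
    then obtain H y where H: "S = insert y H" "H \<subseteq> J" "card H = 6" "clear H" "y \<in> J" "y \<notin> H" "halves y H" by auto
    have "circuit S" unfolding H(1) using H assms by (intro clear_halves_imp_circuit) auto
    moreover have "card S = 7" using H finite_subset[OF H(2) fin] by simp
    ultimately show "S \<in> {S. S \<subseteq> J \<and> card S = 7 \<and> circuit S}" using H by auto
  qed
  moreover have "inj_on (\<lambda>(H, y). insert y H) ?P"
  proof (rule inj_onI)
    fix u v assume uv: "u \<in> ?P" "v \<in> ?P" "(\<lambda>(H, y). insert y H) u = (\<lambda>(H, y). insert y H) v"
    obtain H y K z where eq: "u = (H, y)" "v = (K, z)" by (cases u, cases v)
    have "y = z \<and> H = K" using uv unfolding eq by (intro clear_halves_unique) auto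
    then show "u = v" unfolding eq by simp
  qed
  ultimately have "card {S. S \<subseteq> J \<and> card S = 7 \<and> circuit S} = card ?P" by (simp add: card_image)
  also have "\<dots> = (\<Sum>H\<in>?H. card {y \<in> J. y \<notin> H \<and> halves y H})"
    using fin by (intro card_SigmaI) auto
  finally show ?thesis .
qed

section \<open>Evaluation of the invariants\<close>

text \<open>
  The counts are evaluated by rewriting with numerals only. The function \<open>core\<close> is first unrolled
  on a list of 28 variables, by schematic equations, so that its value on a concrete subset is a
  mere substitution. The computation is cut into the stages \<open>core\<close>, \<open>core_classes\<close> and \<open>combine\<close>:
  the arguments of a stage are rewritten to numerals before its equation copies them many times.
\<close>

lemma upt_literal: "[0..<28] = [0, 1, 2, 3, 4, 5, 6, 7, 8, 9, 10, 11, 12, 13, 14, 15, 16, 17, 18, 19, 20, 21, 22, 23, 24,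
     25, 26, 27]"
  by (simp add: upt_conv_Cons)

definition classes :: "nat list" where
  "classes =
    [3, 5, 6, 9, 10, 12, 15, 17, 18, 20, 23, 24, 27, 29, 30, 33, 34, 36, 39, 40, 43, 45, 46,
     48, 51, 53, 54, 57, 58, 60, 63, 65, 66, 68, 71, 72, 75, 77, 78, 80, 83, 85, 86, 89, 90,
     92, 95, 96, 99, 101, 102, 105, 106, 108, 111, 113, 114, 116, 119, 120, 123, 125, 126]"

definition class_table :: "(nat \<times> (nat \<times> nat) list) list" where
  "class_table = [(x, [(y, pair_class x y). y \<leftarrow> [0..<28], y \<noteq> x]). x \<leftarrow> [0..<28]]"

definition class_pairs :: "(nat \<times> nat) list list" where
  "class_pairs = [[(x, y). (x, ys) \<leftarrow> class_table, (y, c) \<leftarrow> ys, c = d \<and> x < y]. d \<leftarrow> classes]"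

definition lookup :: "int list \<Rightarrow> nat \<Rightarrow> int" where
  "lookup rs c = the (map_of (zip classes rs) c)"

text \<open>
  Here \<open>ss\<close> lists three times the number of triples completed by each point, and \<open>w\<close> is the sum of
  the squares in \<open>eight_circuits_6_sum\<close>. That identity is multiplied by 9, since
  \<open>9 * (n\<^sup>2 + 2 * n) = s\<^sup>2 + 6 * s\<close> for \<open>s = 3 * n\<close>.
\<close>

definition combine :: "int list \<Rightarrow> int \<Rightarrow> int list \<Rightarrow> int \<times> int" where
  "combine bs w ss = ((\<Sum>s\<leftarrow>ss. s\<^sup>2 + 6 * s) - 9 * w, (\<Sum>(b, s)\<leftarrow>zip bs ss. b * s ^ 4))"

text \<open>
  The list \<open>rs\<close> gives the sizes of the classes, \<open>bs\<close> the characteristic function of the subset;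
  \<open>lookup rs c - bs ! x\<close> is the number of triples through \<open>y\<close> completed by \<open>x\<close>. Summing over \<open>y\<close>
  counts every triple three times.
\<close>

definition core_classes :: "int list \<Rightarrow> int list \<Rightarrow> int \<times> int" where
  "core_classes bs rs = combine bs
     (\<Sum>(x, ys)\<leftarrow>class_table. \<Sum>(y, c)\<leftarrow>ys. bs ! y * (lookup rs c - bs ! x)\<^sup>2)
     (map (\<lambda>(x, ys). \<Sum>(y, c)\<leftarrow>ys. bs ! y * (lookup rs c - bs ! x)) class_table)"

definition core :: "int list \<Rightarrow> int \<times> int" where
  "core bs = core_classes bs (map (\<lambda>pairs. \<Sum>(i, j)\<leftarrow>pairs. bs ! i * bs ! j) class_pairs)"

schematic_goal class_table_eval: "class_table = ?r"
  by (simp add: class_table_def upt_literal pair_class_def masks_literal numeral_3_eq_3[symmetric] del: One_nat_def)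

schematic_goal class_pairs_eval: "class_pairs = ?r"
  by (simp add: class_pairs_def class_table_eval classes_def del: One_nat_def)

schematic_goal core_unrolled: "core
    [b0, b1, b2, b3, b4, b5, b6, b7, b8, b9, b10, b11, b12, b13, b14, b15, b16, b17, b18, b19,
     b20, b21, b22, b23, b24, b25, b26, b27] = ?r"
  by (simp add: core_def class_pairs_eval)

schematic_goal map_lookup: "map (lookup
    [r0, r1, r2, r3, r4, r5, r6, r7, r8, r9, r10, r11, r12, r13, r14, r15, r16, r17, r18, r19,
     r20, r21, r22, r23, r24, r25, r26, r27, r28, r29, r30, r31, r32, r33, r34, r35, r36, r37,
     r38, r39, r40, r41, r42, r43, r44, r45, r46, r47, r48, r49, r50, r51, r52, r53, r54, r55,
     r56, r57, r58, r59, r60, r61, r62]) classes = ?r"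
  by (simp add: lookup_def classes_def)

lemmas lookup_eval = map_lookup[unfolded classes_def list.map list.inject simp_thms]

schematic_goal core_classes_unrolled: "core_classes
    [b0, b1, b2, b3, b4, b5, b6, b7, b8, b9, b10, b11, b12, b13, b14, b15, b16, b17, b18, b19,
     b20, b21, b22, b23, b24, b25, b26, b27]
    [r0, r1, r2, r3, r4, r5, r6, r7, r8, r9, r10, r11, r12, r13, r14, r15, r16, r17, r18, r19,
     r20, r21, r22, r23, r24, r25, r26, r27, r28, r29, r30, r31, r32, r33, r34, r35, r36, r37,
     r38, r39, r40, r41, r42, r43, r44, r45, r46, r47, r48, r49, r50, r51, r52, r53, r54, r55,
     r56, r57, r58, r59, r60, r61, r62] = ?r"
  by (simp add: core_classes_def class_table_eval lookup_eval)

schematic_goal combine_unrolled: "combine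
    [b0, b1, b2, b3, b4, b5, b6, b7, b8, b9, b10, b11, b12, b13, b14, b15, b16, b17, b18, b19,
     b20, b21, b22, b23, b24, b25, b26, b27] w
    [s0, s1, s2, s3, s4, s5, s6, s7, s8, s9, s10, s11, s12, s13, s14, s15, s16, s17, s18, s19,
     s20, s21, s22, s23, s24, s25, s26, s27] = ?r"
  by (simp add: combine_def)

primrec bits :: "nat \<Rightarrow> nat \<Rightarrow> int list" where
  "bits 0 m = []"
| "bits (Suc k) m = of_bool (odd m) # bits k (m div 2)"

lemma bits_numeral: "bits (numeral k) m = of_bool (odd m) # bits (pred_numeral k) (m div 2)"
  by (simp add: numeral_eq_Suc)

lemma bits_eval:
  "bits (numeral k) 0 = 0 # bits (pred_numeral k) 0"
  "bits (numeral k) 1 = 1 # bits (pred_numeral k) 0"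
  "bits (numeral k) (numeral (Num.Bit0 n)) = 0 # bits (pred_numeral k) (numeral n)"
  "bits (numeral k) (numeral (Num.Bit1 n)) = 1 # bits (pred_numeral k) (numeral n)"
  "bits 1 0 = [0]" "bits 1 1 = [1]"
  by (simp_all add: bits_numeral)

text \<open>
  The number of 6-circuits through a point is the number that is lost when the point is removed.
\<close>

definition removals :: "int list \<Rightarrow> int \<Rightarrow> int" where
  "removals bs c = (\<Sum>i\<leftarrow>[0..<28]. if bs ! i = 0 then 0 else (c - fst (core (map (\<lambda>j. if j = i then 0 else bs ! j) [0..<28])))\<^sup>2)"

definition meets :: "nat \<Rightarrow> nat \<Rightarrow> bool" where
  "meets i j \<longleftrightarrow> and (masks ! i) (masks ! j) \<noteq> 0"

text \<open>
  A triple is negative if an odd number of its three pairs of edges is disjoint. Repeated entries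
  give \<open>False\<close>, because an edge meets itself.
\<close>

definition odd_triple :: "nat \<Rightarrow> nat \<Rightarrow> nat \<Rightarrow> bool" where
  "odd_triple i j k \<longleftrightarrow> (meets i j \<noteq> meets j k) = meets i k"

primrec extends :: "nat \<Rightarrow> nat list \<Rightarrow> bool" where
  "extends x [] = True"
| "extends x (a # as) = (if list_ex (odd_triple x a) as then False else extends x as)"

text \<open>For six points without negative triple one \<open>h\<close> suffices to decide \<open>halves\<close>.\<close>

definition splits :: "nat list \<Rightarrow> nat \<Rightarrow> int" where
  "splits cur y = (if (\<Sum>i\<leftarrow>cur. if odd_triple y (hd cur) i then 1 else 0 :: int) = 3 then 1 else 0)"

text \<open>
  Enumerates the extensions of \<open>cur\<close> by \<open>k\<close> elements of the last list without negative triple, and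
  counts the points of \<open>ys\<close> that turn them into a circuit.
\<close>

fun hexads :: "nat \<Rightarrow> nat list \<Rightarrow> nat list \<Rightarrow> nat list \<Rightarrow> int" where
  "hexads 0 ys cur xs = (\<Sum>y\<leftarrow>ys. splits cur y)"
| "hexads (Suc k) ys cur [] = 0"
| "hexads (Suc k) ys cur (x # xs) =
     (if extends x cur then hexads k ys (x # cur) xs else 0) + hexads (Suc k) ys cur xs"

definition points :: "int list \<Rightarrow> nat list" where
  "points bs = map fst (filter (\<lambda>p. snd p \<noteq> 0) (zip [0..<28] bs))"

text \<open>
  The depth 6 is written with successors to match the recursion equations of \<open>hexads\<close>.
\<close>

definition sevens :: "int list \<Rightarrow> int \<Rightarrow> int" where
  "sevens bs c = hexads (Suc (Suc (Suc (Suc (Suc (Suc 0)))))) (points bs) [] (points bs)"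

definition less_core :: "int \<times> int \<Rightarrow> int \<times> int \<Rightarrow> bool" where
  "less_core a b \<longleftrightarrow> fst a < fst b \<or> fst a = fst b \<and> snd a < snd b"

text \<open>
  The function \<open>f\<close> is a tie breaker, evaluated only if neighbours agree in \<open>core\<close>. Nested
  conditionals instead of conjunctions ensure this, since a conditional is rewritten in its
  condition first.
\<close>

primrec ascending :: "(int list \<Rightarrow> int \<Rightarrow> int) \<Rightarrow> int \<Rightarrow> int list \<Rightarrow> int \<times> int \<Rightarrow> nat list \<Rightarrow> bool" where
  "ascending f r as a [] = True"
| "ascending f r as a (m # ms) =
    (let bs = bits 28 m; b = core bs in
      (if sum_list bs = r then
        (if (if a = b then f as (fst a) < f bs (fst b) else less_core a b)
         then ascending f r bs b ms else False) else False))"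

text \<open>
  Two tie breakers: the number of 7-circuits, whose enumeration grows fast with the number of
  points, and the squared numbers of 6-circuits through the points, at one evaluation of \<open>core\<close>
  per point.
\<close>

definition extra :: "bool \<Rightarrow> int list \<Rightarrow> int \<Rightarrow> int" where
  "extra b = (if b then sevens else removals)"

text \<open>
  The initial pair lies below every value of \<open>core\<close>, as its first component is nonnegative.
\<close>

definition certificate :: "(int list \<Rightarrow> int \<Rightarrow> int) \<Rightarrow> int \<Rightarrow> nat list \<Rightarrow> bool" where
  "certificate f r ms = ascending f r [] (- 1, 0) ms"

schematic_goal removals_unrolled: "removals
    [b0, b1, b2, b3, b4, b5, b6, b7, b8, b9, b10, b11, b12, b13, b14, b15, b16, b17, b18, b19,
     b20, b21, b22, b23, b24, b25, b26, b27] c = ?r"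
  by (simp add: removals_def upt_literal cong del: if_weak_cong)

schematic_goal meets_table: "map (\<lambda>i. map (\<lambda>j. meets i j) [0..<28]) [0..<28] = ?r"
  by (simp add: upt_literal meets_def masks_literal)

lemmas meets_eval = meets_table[unfolded upt_literal list.map list.inject simp_thms]

lemmas arith_eval = mult_zero_left mult_zero_right mult_1_left mult_1_right add_0_left add_0_right
  diff_0_right diff_self arith_simps arith_extra_simps arith_special rel_simps
  power_zero_numeral power_one power_numeral pow.simps sqr.simps power2_minus
  zero_neq_one one_neq_zero eq_numeral_simps

lemmas core_eval = core_unrolled core_classes_unrolled combine_unrolled

lemmas certificate_eval = certificate_def extra_def ascending.simps bits_eval core_eval less_core_def Let_def pred_numeral_simps BitM.simps numeral_One
  fst_conv snd_conv prod.inject if_True if_False simp_thms sum_list.Nil sum_list.Cons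
  removals_unrolled arith_eval
  sevens_def points_def upt_literal zip.simps(1) zip_Cons_Cons filter.simps list.map hexads.simps extends.simps
  list_ex_Nil_iff list_ex_Cons_iff odd_triple_def meets_eval splits_def list.sel

text \<open>
  With these the simplifier evaluates a branch only after its condition is decided.
\<close>

lemmas weak_congs = if_weak_cong let_weak_cong

section \<open>Correctness of the evaluation\<close>

definition indicates :: "int list \<Rightarrow> nat set \<Rightarrow> bool" where
  "indicates bs J \<longleftrightarrow> length bs = 28 \<and> J \<subseteq> {..<28} \<and> (\<forall>i<28. bs ! i = of_bool (i \<in> J))"

definition mask_points :: "nat \<Rightarrow> nat set" where
  "mask_points m = {i. i < 28 \<and> bit m i}"

lemma length_bits: "length (bits k m) = k"
  by (induction k arbitrary: m) auto

lemma nth_bits: "i < k \<Longrightarrow> bits k m ! i = of_bool (bit m i)"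
proof (induction k arbitrary: m i)
  case (Suc k)
  then show ?case by (cases i) (auto simp: bit_0 bit_Suc)
qed simp

lemma indicates_bits: "indicates (bits 28 m) (mask_points m)"
  by (auto simp: indicates_def mask_points_def length_bits nth_bits)

lemma sum_list_bits: "sum_list (bits 28 m) = int (card (mask_points m))"
proof -
  have "sum_list (bits 28 m) = (\<Sum>i<28. bits 28 m ! i)"
    by (simp add: sum_list_sum_nth length_bits atLeast0LessThan)
  also have "\<dots> = (\<Sum>i<28. of_bool (bit m i))" by (intro sum.cong) (auto simp: nth_bits)
  also have "\<dots> = int (card (mask_points m))"
    by (simp add: sum.If_cases of_bool_def Int_def mask_points_def)
  finally show ?thesis .
qed

lemma indicates_sum:
  assumes "indicates bs J"
  shows "(\<Sum>y\<in>{..<28} - {x}. bs ! y * h y) = (\<Sum>y\<in>J - {x}. h y)"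
proof -
  have "(\<Sum>y\<in>{..<28} - {x}. bs ! y * h y) = (\<Sum>y\<in>{..<28} - {x}. if y \<in> J then h y else 0)"
    using assms by (intro sum.cong) (auto simp: indicates_def)
  also have "\<dots> = (\<Sum>y\<in>({..<28} - {x}) \<inter> J. h y)" by (simp add: sum.inter_restrict)
  also have "({..<28} - {x}) \<inter> J = J - {x}" using assms by (auto simp: indicates_def)
  finally show ?thesis .
qed

lemma sum_list_filtered:
  "(\<Sum>p\<leftarrow>concat (map (\<lambda>y. if P y then [g y] else []) xs). h p) = (\<Sum>y\<leftarrow>xs. if P y then h (g y) else 0)"
  by (induction xs) auto

lemma sum_list_upt_except:
  "(\<Sum>y\<leftarrow>[0..<28]. if y \<noteq> x then h y else 0) = (\<Sum>y\<in>{..<28} - {x}. h y)" for h :: "nat \<Rightarrow> int"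
proof -
  have "(\<Sum>y\<leftarrow>[0..<28]. if y \<noteq> x then h y else 0) = (\<Sum>y\<in>{..<28}. if y \<noteq> x then h y else 0)"
    by (simp add: interv_sum_list_conv_sum_set_nat atLeast0LessThan)
  also have "\<dots> = (\<Sum>y\<in>{..<28} \<inter> {y. y \<noteq> x}. h y)" by (simp add: sum.inter_restrict flip: sum.inter_filter)
  also have "{..<28} \<inter> {y. y \<noteq> x} = {..<28} - {x}" by auto
  finally show ?thesis .
qed

lemma class_table_rows:
  fixes h :: "nat \<Rightarrow> nat \<Rightarrow> nat \<Rightarrow> int"
  shows "map (\<lambda>(x, ys). \<Sum>(y, c)\<leftarrow>ys. h x y c) class_table
    = map (\<lambda>x. \<Sum>y\<in>{..<28} - {x}. h x y (pair_class x y)) [0..<28]"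
proof -
  have "(\<Sum>(y, c)\<leftarrow>concat (map (\<lambda>y. if y \<noteq> x then [(y, pair_class x y)] else []) [0..<28]). h x y c)
    = (\<Sum>y\<in>{..<28} - {x}. h x y (pair_class x y))" for x
    unfolding sum_list_filtered by (simp add: sum_list_upt_except)
  then show ?thesis unfolding class_table_def by simp
qed

lemma class_table_sum:
  fixes h :: "nat \<Rightarrow> nat \<Rightarrow> nat \<Rightarrow> int"
  shows "(\<Sum>(x, ys)\<leftarrow>class_table. \<Sum>(y, c)\<leftarrow>ys. h x y c)
    = (\<Sum>x<28. \<Sum>y\<in>{..<28} - {x}. h x y (pair_class x y))"
  unfolding class_table_rows by (simp add: interv_sum_list_conv_sum_set_nat atLeast0LessThan)

lemma class_pairs_sums:
  assumes "indicates bs J"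
  shows "map (\<lambda>pairs. \<Sum>(i, j)\<leftarrow>pairs. bs ! i * bs ! j) class_pairs
    = map (\<lambda>d. int (class_size J d)) classes"
proof -
  have J: "J \<subseteq> {..<28}" and fin: "finite J" using assms finite_points by (auto simp: indicates_def)
  have row: "(\<Sum>(i, j)\<leftarrow>concat (map (\<lambda>(y, c). if c = d \<and> x < y then [(x, y)] else []) ys). bs ! i * bs ! j)
    = (\<Sum>(y, c)\<leftarrow>ys. if c = d \<and> x < y then bs ! x * bs ! y else 0)" for x d and ys :: "(nat \<times> nat) list"
    by (induction ys) auto
  have sum: "(\<Sum>(i, j)\<leftarrow>concat (map (\<lambda>(x, ys). concat (map (\<lambda>(y, c). if c = d \<and> x < y then [(x, y)] else []) ys)) T). bs ! i * bs ! j)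
    = (\<Sum>(x, ys)\<leftarrow>T. \<Sum>(y, c)\<leftarrow>ys. if c = d \<and> x < y then bs ! x * bs ! y else 0)"
    for d and T :: "(nat \<times> (nat \<times> nat) list) list"
    by (induction T) (auto simp: row)
  have "(\<Sum>x<28. \<Sum>y\<in>{..<28} - {x}. if pair_class x y = d \<and> x < y then bs ! x * bs ! y else 0) = int (class_size J d)" for d
  proof -
    have "(\<Sum>x<28. \<Sum>y\<in>{..<28} - {x}. if pair_class x y = d \<and> x < y then bs ! x * bs ! y else 0)
      = (\<Sum>x<28. \<Sum>y<28. of_bool (x < y \<and> x \<in> J \<and> y \<in> J \<and> pair_class x y = d))"
    proof (rule sum.cong)
      fix x :: nat assume x: "x \<in> {..<28}"
      show "(\<Sum>y\<in>{..<28} - {x}. if pair_class x y = d \<and> x < y then bs ! x * bs ! y else 0)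
        = (\<Sum>y<28. of_bool (x < y \<and> x \<in> J \<and> y \<in> J \<and> pair_class x y = d))"
        by (rule sum.mono_neutral_cong_left) (use assms x in \<open>auto simp: indicates_def\<close>)
    qed simp
    also have "\<dots> = (\<Sum>(x, y)\<in>{..<28} \<times> {..<28}. of_bool (x < y \<and> x \<in> J \<and> y \<in> J \<and> pair_class x y = d))"
      by (rule sum.cartesian_product)
    also have "\<dots> = int (card (({..<28} \<times> {..<28}) \<inter> {(x, y). x < y \<and> x \<in> J \<and> y \<in> J \<and> pair_class x y = d}))"
      by (simp add: case_prod_unfold sum.If_cases of_bool_def)
    also have "({..<28} \<times> {..<28}) \<inter> {(x, y). x < y \<and> x \<in> J \<and> y \<in> J \<and> pair_class x y = d}
      = {(x, y). x < y \<and> x \<in> J \<and> y \<in> J \<and> pair_class x y = d}" using J by auto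
    finally show ?thesis by (simp add: class_size_def)
  qed
  then show ?thesis unfolding class_pairs_def by (simp add: sum class_table_sum)
qed

lemma list_all_mem: "xs = ys \<Longrightarrow> list_all (\<lambda>c. c \<in> set xs) ys"
  by (simp add: list_all_iff)

lemmas classes_members = list_all_mem[OF classes_def, unfolded list.pred_inject simp_thms]

lemma class_table_classes: "list_all (\<lambda>(x, ys). list_all (\<lambda>(y, c). c \<in> set classes) ys) class_table"
  unfolding class_table_eval by (simp only: list.pred_inject prod.case classes_members simp_thms)

lemma pair_class_in_classes:
  assumes "x < 28" "y < 28" "x \<noteq> y"
  shows "pair_class x y \<in> set classes"
proof -
  define ys where "ys = concat (map (\<lambda>y. if y \<noteq> x then [(y, pair_class x y)] else []) [0..<28])"
  have "(x, ys) \<in> set class_table"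
    unfolding class_table_def set_map ys_def by (rule image_eqI[where x = x]) (use assms(1) in simp_all)
  then have "list_all (\<lambda>(y, c). c \<in> set classes) ys"
    using class_table_classes unfolding list_all_iff by blast
  moreover have "(y, pair_class x y) \<in> set ys" using assms(2,3) unfolding ys_def by simp
  ultimately show ?thesis unfolding list_all_iff by blast
qed

lemma lookup_map: "c \<in> set classes \<Longrightarrow> lookup (map f classes) c = f c"
  by (simp add: lookup_def map_of_zip_map)

text \<open>
  The factor 72 is 8 from \<open>eight_circuits_6_sum\<close> times the 9 in \<open>combine\<close>; the factor \<open>81 = 3 ^ 4\<close>
  comes from the row sums, which are three times the numbers of 4-circuits through a point.
\<close>

lemma core_correct:
  assumes "indicates bs J"
  shows "core bs = (72 * int (card {S. S \<subseteq> J \<and> card S = 6 \<and> circuit S}),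
    81 * (\<Sum>p\<in>J. int (card {S. S \<subseteq> J \<and> card S = 4 \<and> circuit S \<and> p \<in> S}) ^ 4))"
proof -
  have J: "J \<subseteq> {..<28}" and fin: "finite J" using assms finite_points by (auto simp: indicates_def)
  define rs where "rs = map (\<lambda>d. int (class_size J d)) classes"
  define delta where "delta x y = int (card {t \<in> completed J x. y \<in> t})" for x y
  define n where "n x = int (card (completed J x))" for x
  have through: "(\<Sum>y\<in>{..<28} - {x}. bs ! y * g (lookup rs (pair_class x y) - bs ! x)) = (\<Sum>y\<in>J. g (delta x y))"
    if x: "x < 28" and g: "g 0 = 0" for x and g :: "int \<Rightarrow> int"
  proof -
    have "(\<Sum>y\<in>{..<28} - {x}. bs ! y * g (lookup rs (pair_class x y) - bs ! x))
      = (\<Sum>y\<in>J - {x}. g (lookup rs (pair_class x y) - bs ! x))" by (rule indicates_sum[OF assms])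
    also have "\<dots> = (\<Sum>y\<in>J - {x}. g (delta x y))"
    proof (rule sum.cong)
      fix y assume y: "y \<in> J - {x}"
      have "lookup rs (pair_class x y) = int (class_size J (pair_class x y))"
        unfolding rs_def using x y J by (intro lookup_map pair_class_in_classes) auto
      moreover have "bs ! x = of_bool (x \<in> J)" using assms x by (simp add: indicates_def)
      ultimately show "g (lookup rs (pair_class x y) - bs ! x) = g (delta x y)"
        unfolding delta_def using card_completed_through[OF J x, of y] y by simp
    qed simp
    also have "\<dots> = (\<Sum>y\<in>J. g (delta x y))"
    proof (rule sum.mono_neutral_left)
      have none: "{t \<in> completed J x. x \<in> t} = {}" by (auto simp: completed_def completes_def)
      have "delta x x = 0" unfolding delta_def none by simp
      then show "\<forall>y\<in>J - (J - {x}). g (delta x y) = 0" using g by auto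
    qed (use fin in auto)
    finally show ?thesis .
  qed
  have delta_sum: "(\<Sum>y\<in>J. delta x y) = 3 * n x" for x
    unfolding delta_def n_def using sum_card_through[OF fin, of x] by (simp flip: of_nat_sum)
  have ss: "map (\<lambda>(x, ys). \<Sum>(y, c)\<leftarrow>ys. bs ! y * (lookup rs c - bs ! x)) class_table = map (\<lambda>x. 3 * n x) [0..<28]"
    unfolding class_table_rows using through[where g = "\<lambda>z. z"] delta_sum by simp
  have w: "(\<Sum>(x, ys)\<leftarrow>class_table. \<Sum>(y, c)\<leftarrow>ys. bs ! y * (lookup rs c - bs ! x)\<^sup>2)
    = (\<Sum>x<28. \<Sum>y\<in>J. (delta x y)\<^sup>2)"
    unfolding class_table_sum using through[where g = "\<lambda>z. z\<^sup>2"] by simp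
  have bs: "bs = map (\<lambda>i. of_bool (i \<in> J)) [0..<28]"
    using assms by (intro nth_equalityI) (auto simp: indicates_def)
  have "core bs = combine bs (\<Sum>x<28. \<Sum>y\<in>J. (delta x y)\<^sup>2) (map (\<lambda>x. 3 * n x) [0..<28])"
    unfolding core_def core_classes_def class_pairs_sums[OF assms] rs_def[symmetric] ss w ..
  also have "\<dots> = ((\<Sum>x<28. (3 * n x)\<^sup>2 + 6 * (3 * n x)) - 9 * (\<Sum>x<28. \<Sum>y\<in>J. (delta x y)\<^sup>2),
      (\<Sum>x<28. of_bool (x \<in> J) * (3 * n x) ^ 4))"
    by (subst bs) (simp add: combine_def interv_sum_list_conv_sum_set_nat atLeast0LessThan o_def zip_map_map zip_same_conv_map)
  also have "(\<Sum>x<28. (3 * n x)\<^sup>2 + 6 * (3 * n x)) - 9 * (\<Sum>x<28. \<Sum>y\<in>J. (delta x y)\<^sup>2)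
    = 9 * (\<Sum>x<28. (n x)\<^sup>2 + 2 * n x - (\<Sum>y\<in>J. (delta x y)\<^sup>2))"
    by (simp add: sum.distrib sum_subtractf sum_distrib_left power_mult_distrib)
  also have "\<dots> = 9 * (8 * int (card {S. S \<subseteq> J \<and> card S = 6 \<and> circuit S}))"
    unfolding eight_circuits_6_sum[OF J] n_def delta_def ..
  also have "(\<Sum>x<28. of_bool (x \<in> J) * (3 * n x) ^ 4) = (\<Sum>x\<in>J. (3 * n x) ^ 4)"
  proof -
    have "(\<Sum>x<28. of_bool (x \<in> J) * (3 * n x) ^ 4) = (\<Sum>x<28. if x \<in> J then (3 * n x) ^ 4 else 0)"
      by (intro sum.cong) auto
    also have "\<dots> = (\<Sum>x\<in>{..<28} \<inter> J. (3 * n x) ^ 4)" by (rule sum.inter_restrict[symmetric]) simp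
    finally show ?thesis using J by (simp add: Int_absorb1)
  qed
  also have "\<dots> = 81 * (\<Sum>p\<in>J. int (card {S. S \<subseteq> J \<and> card S = 4 \<and> circuit S \<and> p \<in> S}) ^ 4)"
    unfolding n_def by (simp add: circuits_4_through[OF J] power_mult_distrib sum_distrib_left)
  finally show ?thesis by simp
qed

lemma removals_correct:
  assumes "indicates bs J"
  shows "removals bs (fst (core bs)) =
    (\<Sum>p\<in>J. (72 * int (card {S. S \<subseteq> J \<and> card S = 6 \<and> circuit S \<and> p \<in> S}))\<^sup>2)"
proof -
  let ?r = "\<lambda>p. map (\<lambda>j. if j = p then 0 else bs ! j) [0..<28]"
  have J: "J \<subseteq> {..<28}" and fin: "finite J" using assms finite_points by (auto simp: indicates_def)
  have "removals bs (fst (core bs)) =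
    (\<Sum>p<28. if bs ! p = 0 then 0 else (fst (core bs) - fst (core (?r p)))\<^sup>2)"
    unfolding removals_def by (simp add: interv_sum_list_conv_sum_set_nat atLeast0LessThan)
  also have "\<dots> = (\<Sum>p\<in>J. (72 * int (card {S. S \<subseteq> J \<and> card S = 6 \<and> circuit S \<and> p \<in> S}))\<^sup>2)"
  proof (rule sum.mono_neutral_cong_right)
    show "\<forall>p\<in>{..<28} - J. (if bs ! p = 0 then 0 else (fst (core bs) - fst (core (?r p)))\<^sup>2) = 0"
      using assms by (auto simp: indicates_def)
  next
    fix p assume p: "p \<in> J"
    have ind: "indicates (?r p) (J - {p})"
      using assms by (auto simp: indicates_def)
    let ?A = "{S. S \<subseteq> J \<and> card S = 6 \<and> circuit S}"
    let ?B = "{S. S \<subseteq> J - {p} \<and> card S = 6 \<and> circuit S}"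
    let ?C = "{S. S \<subseteq> J \<and> card S = 6 \<and> circuit S \<and> p \<in> S}"
    have "?A = ?B \<union> ?C" "?B \<inter> ?C = {}" by auto
    moreover have "finite ?B" "finite ?C" using fin by auto
    ultimately have "card ?A = card ?B + card ?C" by (simp add: card_Un_disjoint)
    then have "fst (core bs) - fst (core (?r p)) = 72 * int (card ?C)"
      unfolding core_correct[OF assms] core_correct[OF ind] by simp
    moreover have "bs ! p \<noteq> 0" using assms p by (auto simp: indicates_def)
    ultimately show "(if bs ! p = 0 then 0 else (fst (core bs) - fst (core (?r p)))\<^sup>2)
      = (72 * int (card ?C))\<^sup>2" by simp
  qed (use J in auto)
  finally show ?thesis .
qed

lemma meets_iff: "meets i j \<longleftrightarrow> ends i \<inter> ends j \<noteq> {}"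
proof -
  have "and (masks ! i) (masks ! j) = 0 \<longleftrightarrow> (\<forall>k. \<not> (k \<in> ends i \<and> k \<in> ends j))"
    unfolding nat_eq_iff_bits bit_and_iff bit_masks_iff by simp
  also have "\<dots> \<longleftrightarrow> ends i \<inter> ends j = {}" by auto
  finally show ?thesis unfolding meets_def by (rule arg_cong)
qed

lemma odd_triple_iff_neg:
  assumes "i < 28" "j < 28" "k < 28"
  shows "odd_triple i j k \<longleftrightarrow> neg i j k"
proof -
  have self: "meets p p" if "p < 28" for p
    using card_ends[OF that] unfolding meets_iff by auto
  have sym: "meets p q = meets q p" for p q unfolding meets_iff by (simp add: Int_commute)
  have sg: "sg p q = (if meets p q then 1 else - 1)" for p q unfolding meets_iff sg_def by simp
  show ?thesis
  proof (cases "i \<noteq> j \<and> j \<noteq> k \<and> i \<noteq> k")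
    case True then show ?thesis unfolding odd_triple_def neg_def sg by auto
  next
    case False
    then have "\<not> odd_triple i j k" using self assms sym unfolding odd_triple_def by metis
    then show ?thesis using False unfolding neg_def by blast
  qed
qed

lemma extends_iff:
  assumes "x < 28" "set cur \<subseteq> {..<28}" "clear (set cur)"
  shows "extends x cur \<longleftrightarrow> clear (insert x (set cur))"
proof -
  have "extends x cur \<longleftrightarrow> (\<forall>a\<in>set cur. \<forall>b\<in>set cur. \<not> neg x a b)"
    using assms(2)
  proof (induction cur)
    case Nil then show ?case by simp
  next
    case (Cons a as)
    have "list_ex (odd_triple x a) as \<longleftrightarrow> (\<exists>b\<in>set as. neg x a b)"
    proof -
      have "odd_triple x a b \<longleftrightarrow> neg x a b" if "b \<in> set as" for b
        using odd_triple_iff_neg[of x a b] Cons.prems assms(1) that by auto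
      then show ?thesis by (simp add: list_ex_iff cong: bex_cong)
    qed
    then have step: "extends x (a # as) \<longleftrightarrow> (\<forall>b\<in>set as. \<not> neg x a b) \<and> extends x as" by simp
    have IH: "extends x as \<longleftrightarrow> (\<forall>a\<in>set as. \<forall>b\<in>set as. \<not> neg x a b)" using Cons by simp
    have sym: "neg x b a \<longleftrightarrow> neg x a b" for b using neg_commute by blast
    have self: "\<not> neg x a a" by (simp add: neg_def)
    show ?case unfolding step IH list.set(2) using self sym by blast
  qed
  also have "\<dots> \<longleftrightarrow> clear (insert x (set cur))"
  proof
    assume a: "\<forall>a\<in>set cur. \<forall>b\<in>set cur. \<not> neg x a b"
    have "\<not> neg i j k" if "i \<in> insert x (set cur)" "j \<in> insert x (set cur)" "k \<in> insert x (set cur)" for i j k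
    proof
      assume n: "neg i j k"
      then have "i \<noteq> j" "j \<noteq> k" "i \<noteq> k" by (auto simp: neg_def)
      moreover have "neg j i k" "neg k i j" using n neg_commute by blast+
      ultimately show False using that n a assms(3) unfolding clear_def by blast
    qed
    then show "clear (insert x (set cur))" unfolding clear_def by blast
  next
    assume "clear (insert x (set cur))"
    then show "\<forall>a\<in>set cur. \<forall>b\<in>set cur. \<not> neg x a b" unfolding clear_def by blast
  qed
  finally show ?thesis .
qed

text \<open>
  By \<open>clear_6_dep_iff\<close> the count is 3 for one \<open>h\<close> exactly if adding \<open>y\<close> makes the six points
  dependent, hence exactly if it is 3 for all \<open>h\<close>. If \<open>y\<close> is one of the six, the count is 0.
\<close>

lemma splits_correct:
  assumes "distinct cur" "length cur = 6" "set cur \<subseteq> {..<28}" "clear (set cur)" "y < 28"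
  shows "splits cur y = of_bool (y \<notin> set cur \<and> halves y (set cur))"
proof -
  have ne: "cur \<noteq> []" using assms(2) by auto
  then have hd: "hd cur \<in> set cur" by simp
  have card: "card (set cur) = 6" using distinct_card[OF assms(1)] assms(2) by simp
  have "(\<Sum>i\<leftarrow>cur. if odd_triple y (hd cur) i then 1 else 0 :: int)
    = (\<Sum>i\<in>set cur. if odd_triple y (hd cur) i then 1 else 0)"
    using assms(1) by (rule sum_list_distinct_conv_sum_set)
  also have "\<dots> = (\<Sum>i\<in>set cur. if neg y (hd cur) i then 1 else 0)"
    using assms(3,5) hd odd_triple_iff_neg by (intro sum.cong) (auto simp: subset_iff)
  also have "\<dots> = int (card {i \<in> set cur. neg y (hd cur) i})"
    by (simp add: sum.If_cases Int_def)
  finally have s: "splits cur y = of_bool (card {i \<in> set cur. neg y (hd cur) i} = 3)"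
    unfolding splits_def by simp
  show ?thesis
  proof (cases "y \<in> set cur")
    case True
    then have none: "{i \<in> set cur. neg y (hd cur) i} = {}" using assms(4) hd unfolding clear_def by blast
    show ?thesis unfolding s none using True by simp
  next
    case False
    note iff = clear_6_dep_iff[OF assms(3) card assms(5) False assms(4)]
    have "card {i \<in> set cur. neg y (hd cur) i} = 3 \<longleftrightarrow> halves y (set cur)"
      unfolding halves_def using iff hd by blast
    then show ?thesis unfolding s using False by simp
  qed
qed

lemma hexads_correct:
  assumes "distinct (cur @ xs)" "set (cur @ xs) \<subseteq> {..<28}" "distinct ys" "set ys \<subseteq> {..<28}"
    "clear (set cur)" "length cur + k = 6"
  shows "hexads k ys cur xs = (\<Sum>T | T \<subseteq> set xs \<and> card T = k \<and> clear (set cur \<union> T).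
    int (card {y \<in> set ys. y \<notin> set cur \<union> T \<and> halves y (set cur \<union> T)}))"
  using assms
proof (induction k ys cur xs rule: hexads.induct)
  case (1 ys cur xs)
  have "{T. T \<subseteq> set xs \<and> card T = 0 \<and> clear (set cur \<union> T)} = {{}}"
    using 1(5) finite_subset[OF _ finite_set] by (auto simp: card_eq_0_iff)
  moreover have "(\<Sum>y\<leftarrow>ys. splits cur y) = (\<Sum>y\<in>set ys. splits cur y)"
    using 1(3) by (rule sum_list_distinct_conv_sum_set)
  moreover have "(\<Sum>y\<in>set ys. splits cur y) = (\<Sum>y\<in>set ys. of_bool (y \<notin> set cur \<and> halves y (set cur)))"
    using 1 by (intro sum.cong splits_correct) auto
  moreover have "\<dots> = int (card {y \<in> set ys. y \<notin> set cur \<and> halves y (set cur)})"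
    by (simp add: sum.If_cases of_bool_def Int_def)
  ultimately show ?case by simp
next
  case (2 k ys cur)
  then show ?case by (auto intro!: sum.neutral[symmetric])
next
  case (3 k ys cur x xs)
  let ?g = "\<lambda>H. int (card {y \<in> set ys. y \<notin> H \<and> halves y H})"
  let ?A = "{T. T \<subseteq> set (x # xs) \<and> card T = Suc k \<and> clear (set cur \<union> T)}"
  let ?B = "{T. T \<subseteq> set xs \<and> card T = k \<and> clear (set (x # cur) \<union> T)}"
  let ?C = "{T. T \<subseteq> set xs \<and> card T = Suc k \<and> clear (set cur \<union> T)}"
  have x: "x \<notin> set xs" "x \<notin> set cur" "x < 28" using 3(3,4) by auto
  have A: "?A = insert x ` ?B \<union> ?C"
  proof (intro equalityI subsetI)
    fix T assume T: "T \<in> ?A"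
    then have fin: "finite T" by (auto intro: card_ge_0_finite)
    show "T \<in> insert x ` ?B \<union> ?C"
    proof (cases "x \<in> T")
      case True
      then have T_eq: "T = insert x (T - {x})" by (rule insert_Diff[symmetric])
      have "set (x # cur) \<union> (T - {x}) = set cur \<union> T" using True by auto
      moreover have "T - {x} \<subseteq> set xs" "card (T - {x}) = k" using T True by auto
      ultimately have "T - {x} \<in> ?B" using T by simp
      with T_eq have "T \<in> insert x ` ?B" by (rule image_eqI)
      then show ?thesis ..
    next
      case False then show ?thesis using T by auto
    qed
  next
    fix T assume "T \<in> insert x ` ?B \<union> ?C"
    then show "T \<in> ?A"
    proof
      assume "T \<in> insert x ` ?B"
      then obtain U where U: "T = insert x U" "U \<in> ?B" by blast
      then have "x \<notin> U" "finite U" using x(1) finite_subset[of U "set xs"] by auto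
      then show ?thesis using U by auto
    qed auto
  qed
  have "(\<Sum>T\<in>?A. ?g (set cur \<union> T)) = (\<Sum>T\<in>insert x ` ?B. ?g (set cur \<union> T)) + (\<Sum>T\<in>?C. ?g (set cur \<union> T))"
    unfolding A by (rule sum.union_disjoint) (use x(1) in auto)
  also have "(\<Sum>T\<in>insert x ` ?B. ?g (set cur \<union> T)) = (\<Sum>T\<in>?B. ?g (set (x # cur) \<union> T))"
  proof -
    have "inj_on (insert x) ?B" using x(1) by (auto simp: inj_on_def insert_ident subset_iff)
    then have "(\<Sum>T\<in>insert x ` ?B. ?g (set cur \<union> T)) = (\<Sum>T\<in>?B. ?g (set cur \<union> insert x T))"
      by (simp only: sum.reindex o_def)
    moreover have "set cur \<union> insert x T = set (x # cur) \<union> T" for T by auto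
    ultimately show ?thesis by (simp only:)
  qed
  also have "(\<Sum>T\<in>?C. ?g (set cur \<union> T)) = hexads (Suc k) ys cur xs"
    using 3(2)[symmetric] 3(3-) by simp
  also have "(\<Sum>T\<in>?B. ?g (set (x # cur) \<union> T)) = (if extends x cur then hexads k ys (x # cur) xs else 0)"
  proof (cases "extends x cur")
    case True
    then have "clear (set (x # cur))" using extends_iff[of x cur] x 3 by simp
    then show ?thesis using 3(1)[OF True] 3(3-) True by simp
  next
    case False
    then have "\<not> clear (insert x (set cur))" using extends_iff[of x cur] x 3 by simp
    then have "\<not> clear (set (x # cur) \<union> T)" for T using clear_mono[of "set (x # cur) \<union> T" "insert x (set cur)"] by auto
    then have empty: "?B = {}" by blast
    show ?thesis unfolding empty using False by simp
  qed
  finally show ?case by simp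
qed

lemma sevens_correct:
  assumes "indicates bs J"
  shows "sevens bs c = int (card {S. S \<subseteq> J \<and> card S = 7 \<and> circuit S})"
proof -
  have J: "J \<subseteq> {..<28}" and fin: "finite J" using assms finite_points by (auto simp: indicates_def)
  have bs: "bs = map (\<lambda>i. of_bool (i \<in> J)) [0..<28]"
    using assms by (intro nth_equalityI) (auto simp: indicates_def)
  have "points bs = filter (\<lambda>i. i \<in> J) [0..<28]"
    by (subst bs) (simp add: points_def zip_map2 zip_same_conv_map filter_map o_def)
  then have p: "distinct (points bs)" "set (points bs) = J" using J by auto
  have "sevens bs c = (\<Sum>T | T \<subseteq> J \<and> card T = 6 \<and> clear T. int (card {y \<in> J. y \<notin> T \<and> halves y T}))"
    unfolding sevens_def using hexads_correct[of "[]" "points bs" "points bs" "Suc (Suc (Suc (Suc (Suc (Suc 0)))))"] p J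
    by (simp add: clear_def eval_nat_numeral)
  also have "\<dots> = int (card {S. S \<subseteq> J \<and> card S = 7 \<and> circuit S})"
    unfolding card_circuits_7[OF J] by simp
  finally show ?thesis .
qed

section \<open>Circuit invariants of matroids\<close>

definition matroid_circuits :: "nat \<Rightarrow> 'a matroid_structure \<Rightarrow> 'a set set" where
  "matroid_circuits k M = {C. C \<subseteq> fst M \<and> card C = k \<and> C \<notin> snd M \<and> (\<forall>x\<in>C. C - {x} \<in> snd M)}"

text \<open>
  The powers are a cheap way to record how the circuits are distributed among the elements: the
  first powers would only add up to a multiple of the total number.
\<close>

definition circuit_invariant :: "'a matroid_structure \<Rightarrow> nat \<times> nat \<times> nat \<times> nat" where
  "circuit_invariant M =
    (card (matroid_circuits 6 M),
     \<Sum>p\<in>fst M. card {C \<in> matroid_circuits 4 M. p \<in> C} ^ 4,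
     card (matroid_circuits 7 M),
     \<Sum>p\<in>fst M. (card {C \<in> matroid_circuits 6 M. p \<in> C})\<^sup>2)"

lemma matroid_circuits_image:
  assumes "bij_betw \<phi> E E'" "\<And>I. I \<subseteq> E \<Longrightarrow> I \<in> A \<longleftrightarrow> \<phi> ` I \<in> A'"
  shows "bij_betw ((`) \<phi>) (matroid_circuits k (E, A)) (matroid_circuits k (E', A'))"
proof -
  have inj: "inj_on \<phi> E" and im: "\<phi> ` E = E'" using assms(1) by (auto simp: bij_betw_def)
  have iff: "C \<in> matroid_circuits k (E, A) \<longleftrightarrow> \<phi> ` C \<in> matroid_circuits k (E', A')" if C: "C \<subseteq> E" for C
  proof -
    have "card (\<phi> ` C) = card C" using inj_on_subset[OF inj C] by (rule card_image)
    moreover have "C - {x} \<in> A \<longleftrightarrow> \<phi> ` C - {\<phi> x} \<in> A'" if "x \<in> C" for x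
    proof -
      have "\<phi> ` (C - {x}) = \<phi> ` C - {\<phi> x}"
        using inj_on_image_set_diff[OF inj, of C "{x}"] C that by auto
      then show ?thesis using assms(2)[of "C - {x}"] C by auto
    qed
    ultimately show ?thesis using assms(2)[OF C] C im by (auto simp: matroid_circuits_def)
  qed
  show ?thesis unfolding bij_betw_def
  proof (intro conjI equalityI subsetI)
    show "inj_on ((`) \<phi>) (matroid_circuits k (E, A))"
      by (rule inj_on_subset[OF inj_on_image_Pow[OF inj]]) (auto simp: matroid_circuits_def)
  next
    fix D assume "D \<in> (`) \<phi> ` matroid_circuits k (E, A)"
    then obtain C where "C \<in> matroid_circuits k (E, A)" "D = \<phi> ` C" by blast
    moreover from this have "C \<subseteq> E" by (simp add: matroid_circuits_def)
    ultimately show "D \<in> matroid_circuits k (E', A')" using iff by blast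
  next
    fix D assume D: "D \<in> matroid_circuits k (E', A')"
    then have "D \<subseteq> \<phi> ` E" using im by (simp add: matroid_circuits_def)
    then obtain C where "C \<subseteq> E" "D = \<phi> ` C" by (auto simp: subset_image_iff)
    then show "D \<in> (`) \<phi> ` matroid_circuits k (E, A)" using iff D by blast
  qed
qed

lemma circuit_invariant_equiv:
  assumes "matroid_equiv M M'"
  shows "circuit_invariant M = circuit_invariant M'"
proof -
  obtain E A E' A' where M: "M = (E, A)" "M' = (E', A')" by (cases M, cases M')
  obtain \<phi> where phi: "bij_betw \<phi> E E'" "\<And>I. I \<subseteq> E \<Longrightarrow> I \<in> A \<longleftrightarrow> \<phi> ` I \<in> A'"
    using assms unfolding matroid_equiv_def M by auto
  have inj: "inj_on \<phi> E" using phi(1) by (simp add: bij_betw_def)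
  note bij = matroid_circuits_image[OF phi]
  have cards: "card (matroid_circuits k M) = card (matroid_circuits k M')" for k
    unfolding M by (rule bij_betw_same_card[OF bij])
  have deg: "card {C \<in> matroid_circuits k M. p \<in> C} = card {C \<in> matroid_circuits k M'. \<phi> p \<in> C}" if p: "p \<in> E" for k p
  proof (rule bij_betw_same_card)
    have im: "(`) \<phi> ` matroid_circuits k (E, A) = matroid_circuits k (E', A')"
      and injC: "inj_on ((`) \<phi>) (matroid_circuits k (E, A))" using bij[of k] by (simp_all add: bij_betw_def)
    have mem: "\<phi> p \<in> \<phi> ` C \<longleftrightarrow> p \<in> C" if "C \<in> matroid_circuits k (E, A)" for C
      using inj_on_image_mem_iff[OF inj p, of C] that by (simp add: matroid_circuits_def)
    show "bij_betw ((`) \<phi>) {C \<in> matroid_circuits k M. p \<in> C} {C \<in> matroid_circuits k M'. \<phi> p \<in> C}"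
      unfolding bij_betw_def M
    proof
      show "inj_on ((`) \<phi>) {C \<in> matroid_circuits k (E, A). p \<in> C}" by (rule inj_on_subset[OF injC]) blast
      show "(`) \<phi> ` {C \<in> matroid_circuits k (E, A). p \<in> C} = {C \<in> matroid_circuits k (E', A'). \<phi> p \<in> C}"
        unfolding im[symmetric] using mem by blast
    qed
  qed
  have sums: "(\<Sum>p\<in>fst M. f (card {C \<in> matroid_circuits k M. p \<in> C}))
    = (\<Sum>p\<in>fst M'. f (card {C \<in> matroid_circuits k M'. p \<in> C}))" for k and f :: "nat \<Rightarrow> nat"
  proof -
    have "(\<Sum>p\<in>fst M. f (card {C \<in> matroid_circuits k M. p \<in> C}))
      = (\<Sum>p\<in>E. f (card {C \<in> matroid_circuits k M'. \<phi> p \<in> C}))"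
      unfolding M(1) fst_conv by (intro sum.cong refl) (simp only: deg[unfolded M(1)])
    also have "\<dots> = (\<Sum>p\<in>E'. f (card {C \<in> matroid_circuits k M'. p \<in> C}))"
      by (rule sum.reindex_bij_betw[OF phi(1)])
    finally show ?thesis by (simp add: M(2))
  qed
  show ?thesis unfolding circuit_invariant_def cards
    using sums[of "\<lambda>n. n ^ 4" 4] sums[of "\<lambda>n. n\<^sup>2" 6] by simp
qed

text \<open>A copy of the linear matroid on the labels of the points.\<close>

definition point_matroid :: "nat set \<Rightarrow> nat matroid_structure" where
  "point_matroid J = (J, {I. I \<subseteq> J \<and> \<not> dep I})"

lemma circuits_point_matroid:
  "matroid_circuits k (point_matroid J) = {S. S \<subseteq> J \<and> card S = k \<and> circuit S}"
  by (auto simp: matroid_circuits_def point_matroid_def circuit_def)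

lemma dependent_image_iff:
  fixes f :: "'b \<Rightarrow> rat ^ 'n"
  assumes "finite I" "inj_on f I"
  shows "vec.dependent (f ` I) \<longleftrightarrow> (\<exists>c. (\<exists>i\<in>I. c i \<noteq> 0) \<and> (\<Sum>i\<in>I. c i *s f i) = 0)"
proof
  assume "vec.dependent (f ` I)"
  then obtain u where u: "\<exists>v\<in>f ` I. u v \<noteq> 0" "(\<Sum>v\<in>f ` I. u v *s v) = 0"
    using vec.dependent_finite[of "f ` I"] assms(1) by auto
  have "(\<Sum>i\<in>I. u (f i) *s f i) = 0" using u(2) by (simp add: sum.reindex[OF assms(2)])
  then show "\<exists>c. (\<exists>i\<in>I. c i \<noteq> 0) \<and> (\<Sum>i\<in>I. c i *s f i) = 0"
    using u(1) by (intro exI[of _ "\<lambda>i. u (f i)"]) auto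
next
  assume "\<exists>c. (\<exists>i\<in>I. c i \<noteq> 0) \<and> (\<Sum>i\<in>I. c i *s f i) = 0"
  then obtain c where c: "\<exists>i\<in>I. c i \<noteq> 0" "(\<Sum>i\<in>I. c i *s f i) = 0" by blast
  let ?u = "\<lambda>v. c (the_inv_into I f v)"
  have u: "?u (f i) = c i" if "i \<in> I" for i using the_inv_into_f_f[OF assms(2) that] by simp
  have "(\<Sum>v\<in>f ` I. ?u v *s v) = (\<Sum>i\<in>I. c i *s f i)"
    using u by (simp add: sum.reindex[OF assms(2)])
  moreover have "\<exists>v\<in>f ` I. ?u v \<noteq> 0" using c(1) u by auto
  ultimately have "\<exists>u. (\<exists>v\<in>f ` I. u v \<noteq> 0) \<and> (\<Sum>v\<in>f ` I. u v *s v) = 0" using c(2) by (intro exI[of _ ?u]) simp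
  then show "vec.dependent (f ` I)" using vec.dependent_finite[of "f ` I"] assms(1) by auto
qed

text \<open>A sign can be moved from the vector into its coefficient.\<close>

lemma dependent_pm_pt_iff:
  assumes "I \<subseteq> {..<28}" "\<And>i. i \<in> I \<Longrightarrow> f i = pt i \<or> f i = - pt i" "inj_on f I"
  shows "vec.dependent (f ` I) \<longleftrightarrow> dep I"
proof -
  have fin: "finite I" using assms(1) by (rule finite_points)
  define e where "e = (\<lambda>i. if f i = pt i then 1 else - 1 :: rat)"
  have f: "f i = e i *s pt i" if "i \<in> I" for i using assms(2)[OF that] by (auto simp: e_def)
  have ee: "e i * e i = 1" for i by (simp add: e_def)
  have "(\<exists>c. (\<exists>i\<in>I. c i \<noteq> 0) \<and> (\<Sum>i\<in>I. c i *s f i) = 0) \<longleftrightarrow> dep I"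
  proof
    assume "\<exists>c. (\<exists>i\<in>I. c i \<noteq> 0) \<and> (\<Sum>i\<in>I. c i *s f i) = 0"
    then obtain c i where c: "i \<in> I" "c i \<noteq> 0" "(\<Sum>i\<in>I. c i *s f i) = 0" by blast
    have "(\<Sum>i\<in>I. (c i * e i) *s pt i) = (\<Sum>i\<in>I. c i *s f i)" by (intro sum.cong) (simp_all add: f)
    moreover have "c i * e i \<noteq> 0" using c(2) by (simp add: e_def)
    ultimately show "dep I" unfolding dep_def using c by (intro exI[of _ "\<lambda>i. c i * e i"]) auto
  next
    assume "dep I"
    then obtain c i where c: "i \<in> I" "c i \<noteq> 0" "(\<Sum>i\<in>I. c i *s pt i) = 0" unfolding dep_def by blast
    have "(\<Sum>i\<in>I. (c i * e i) *s f i) = (\<Sum>i\<in>I. c i *s pt i)"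
      by (intro sum.cong) (simp_all add: f ee mult.assoc)
    moreover have "c i * e i \<noteq> 0" using c(2) by (simp add: e_def)
    ultimately show "\<exists>c. (\<exists>i\<in>I. c i \<noteq> 0) \<and> (\<Sum>i\<in>I. c i *s f i) = 0"
      using c by (intro exI[of _ "\<lambda>i. c i * e i"]) auto
  qed
  then show ?thesis using dependent_image_iff[OF fin assms(3)] by simp
qed

lemma pt_pm_inj:
  assumes "i < 28" "j < 28" "pt i = pt j \<or> pt i = - pt j"
  shows "i = j"
proof (rule ccontr)
  assume "i \<noteq> j"
  then have "ip (pt i) (pt j) = sg i j / 2" using assms ip_pt by blast
  moreover have "ip (pt i) (pt j) = 3/2 \<or> ip (pt i) (pt j) = - 3/2"
    using assms by (auto simp: ip_pt_same ip_uminus_left)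
  ultimately show False using sg_cases[of i j] by auto
qed

lemma representatives:
  assumes "bij_betw (\<lambda>i. {l i, - l i}) {1..28} {{v, - v} | v. v \<in> min_vectors E7_dual}"
  obtains \<sigma> :: "nat \<Rightarrow> nat" where "\<And>i. i < 28 \<Longrightarrow> \<sigma> i \<in> {1..28} \<and> (l (\<sigma> i) = pt i \<or> l (\<sigma> i) = - pt i)"
proof -
  have "\<exists>a\<in>{1..28}. l a = pt i \<or> l a = - pt i" if "i < 28" for i
  proof -
    have "pt i \<in> min_vectors E7_dual" using pt_eq_min_vec[OF that] min_vectors_E7_dual by auto
    then have "{pt i, - pt i} \<in> (\<lambda>i. {l i, - l i}) ` {1..28}"
      using assms unfolding bij_betw_def by blast
    then obtain a where "a \<in> {1..28}" "{pt i, - pt i} = {l a, - l a}" by blast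
    then show ?thesis by (auto simp: doubleton_eq_iff)
  qed
  then have "\<forall>i\<in>{..<28}. \<exists>a. a \<in> {1..28} \<and> (l a = pt i \<or> l a = - pt i)" by blast
  from bchoice[OF this] obtain \<sigma> where "\<forall>i\<in>{..<28}. \<sigma> i \<in> {1..28} \<and> (l (\<sigma> i) = pt i \<or> l (\<sigma> i) = - pt i)" by (rule exE)
  then show ?thesis using that by blast
qed

lemma point_matroid_realised:
  assumes "bij_betw (\<lambda>i. {l i, - l i}) {1..28} {{v, - v} | v. v \<in> min_vectors E7_dual}"
    and "J \<subseteq> {..<28}"
  shows "\<exists>M\<in>matroid_structures l 28 (card J). matroid_equiv (point_matroid J) M"
proof -
  obtain \<sigma> where s: "\<And>i. i < 28 \<Longrightarrow> \<sigma> i \<in> {1..28} \<and> (l (\<sigma> i) = pt i \<or> l (\<sigma> i) = - pt i)"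
    using representatives[OF assms(1)] by blast
  define f where "f = (\<lambda>i. l (\<sigma> i))"
  have f: "f i = pt i \<or> f i = - pt i" if "i \<in> J" for i using s[of i] that assms(2) by (auto simp: f_def)
  have inj: "inj_on f J"
  proof (rule inj_onI)
    fix i j assume "i \<in> J" "j \<in> J" "f i = f j"
    then have "pt i = pt j \<or> pt i = - pt j" using f[of i] f[of j] by auto
    then show "i = j" using pt_pm_inj \<open>i \<in> J\<close> \<open>j \<in> J\<close> assms(2) by blast
  qed
  then have "inj_on \<sigma> J" unfolding f_def by (auto simp: inj_on_def)
  then have card: "card (\<sigma> ` J) = card J" by (rule card_image)
  have sub: "\<sigma> ` J \<subseteq> {1..28}" using s assms(2) by blast
  have "l ` \<sigma> ` J = f ` J" by (simp add: f_def image_image)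
  moreover have "linear_matroid (l ` \<sigma> ` J) \<in> matroid_structures l 28 (card J)"
    unfolding matroid_structures_def by (intro CollectI exI[of _ "\<sigma> ` J"] conjI refl sub card)
  ultimately have "linear_matroid (f ` J) \<in> matroid_structures l 28 (card J)" by simp
  moreover have "matroid_equiv (point_matroid J) (linear_matroid (f ` J))"
  proof -
    have "I \<in> {I. I \<subseteq> J \<and> \<not> dep I} \<longleftrightarrow> f ` I \<in> {I. I \<subseteq> f ` J \<and> vec.independent I}" if I: "I \<subseteq> J" for I
    proof -
      have "vec.dependent (f ` I) \<longleftrightarrow> dep I"
        using f I assms(2) inj_on_subset[OF inj I] by (intro dependent_pm_pt_iff) auto
      then show ?thesis using I by auto
    qed
    moreover have "bij_betw f J (f ` J)" using inj by (simp add: bij_betw_def)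
    ultimately show ?thesis unfolding matroid_equiv_def point_matroid_def linear_matroid_def by blast
  qed
  ultimately show ?thesis by blast
qed

lemma matroid_equiv_refl: "matroid_equiv M M"
  unfolding matroid_equiv_def by (cases M) (auto intro!: exI[of _ id])

lemma card_invariants_le_classes:
  assumes "finite A" "\<And>M M'. M \<in> A \<Longrightarrow> M' \<in> A \<Longrightarrow> R M M' \<Longrightarrow> f M = f M'" "\<And>M. M \<in> A \<Longrightarrow> R M M"
  shows "card (f ` A) \<le> card (A // {(M, M'). M \<in> A \<and> M' \<in> A \<and> R M M'})"
proof -
  let ?R = "{(M, M'). M \<in> A \<and> M' \<in> A \<and> R M M'}"
  let ?h = "\<lambda>X. f (SOME M. M \<in> X)"
  have "f M = ?h (?R `` {M})" if M: "M \<in> A" for M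
  proof -
    have "M \<in> ?R `` {M}" using M assms(3) by blast
    then have "(SOME M'. M' \<in> ?R `` {M}) \<in> ?R `` {M}" by (rule someI[where P = "\<lambda>M'. M' \<in> ?R `` {M}"])
    then show ?thesis using assms(2) by blast
  qed
  then have "f ` A \<subseteq> ?h ` (A // ?R)" unfolding quotient_def by blast
  moreover have fin: "finite (A // ?R)" unfolding quotient_def using assms(1) by simp
  ultimately have "card (f ` A) \<le> card (?h ` (A // ?R))" by (intro card_mono) auto
  also have "\<dots> \<le> card (A // ?R)" using fin by (rule card_image_le)
  finally show ?thesis .
qed

lemma finite_matroid_structures: "finite (matroid_structures l n r)"
proof (rule finite_subset)
  show "matroid_structures l n r \<subseteq> (\<lambda>J. linear_matroid (l ` J)) ` Pow {1..n}"
    unfolding matroid_structures_def by blast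
qed simp

lemma card_circuit_invariants_le:
  "card (circuit_invariant ` matroid_structures l n r) \<le> num_matroid_structures l n r"
  unfolding num_matroid_structures_def
  by (rule card_invariants_le_classes) (auto intro: finite_matroid_structures circuit_invariant_equiv matroid_equiv_refl)

section \<open>Subsets with different invariants\<close>

text \<open>
  The multiples of the invariants that the evaluation produces; \<open>5184 = 72\<^sup>2\<close>. Different
  multiples imply different invariants.
\<close>

definition scaled :: "bool \<Rightarrow> nat \<times> nat \<times> nat \<times> nat \<Rightarrow> (int \<times> int) \<times> int" where
  "scaled b v = (case v of (c6, d4, c7, d6) \<Rightarrow>
     ((72 * int c6, 81 * int d4), if b then int c7 else 5184 * int d6))"

definition key :: "bool \<Rightarrow> int list \<Rightarrow> (int \<times> int) \<times> int" where
  "key b bs = (core bs, extra b bs (fst (core bs)))"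

lemma key_eq_scaled_invariant:
  assumes "indicates bs J"
  shows "key b bs = scaled b (circuit_invariant (point_matroid J))"
proof -
  have J: "fst (point_matroid J) = J" by (simp add: point_matroid_def)
  have through: "{C \<in> {S. S \<subseteq> J \<and> card S = k \<and> circuit S}. p \<in> C} = {S. S \<subseteq> J \<and> card S = k \<and> circuit S \<and> p \<in> S}" for k p
    by blast
  show ?thesis
    unfolding key_def extra_def scaled_def circuit_invariant_def circuits_point_matroid J through
    using core_correct[OF assms] removals_correct[OF assms] sevens_correct[OF assms]
    by (simp add: power_mult_distrib sum_distrib_left)
qed

definition less_key :: "(int \<times> int) \<times> int \<Rightarrow> (int \<times> int) \<times> int \<Rightarrow> bool" where
  "less_key x y \<longleftrightarrow> (if fst x = fst y then snd x < snd y else less_core (fst x) (fst y))"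

lemma less_key_trans: "less_key x y \<Longrightarrow> less_key y z \<Longrightarrow> less_key x z"
  unfolding less_key_def less_core_def by (auto split: if_splits simp: prod_eq_iff)

lemma less_key_irrefl: "\<not> less_key x x"
  by (simp add: less_key_def)

lemma ascending_sound:
  assumes "ascending (extra b) r as a ms" "a = core as"
  shows "sorted_wrt less_key (map (\<lambda>m. key b (bits 28 m)) ms) \<and>
    (\<forall>m\<in>set ms. less_key (key b as) (key b (bits 28 m)) \<and> sum_list (bits 28 m) = r)"
  using assms
proof (induction ms arbitrary: as a)
  case Nil then show ?case by simp
next
  case (Cons m ms)
  let ?bs = "bits 28 m"
  have step: "sum_list ?bs = r" "less_key (key b as) (key b ?bs)" "ascending (extra b) r ?bs (core ?bs) ms"
    using Cons.prems by (auto simp: Let_def less_key_def key_def split: if_splits)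
  then show ?case using Cons.IH[OF step(3) refl] less_key_trans[OF step(2)] by auto
qed

lemma sorted_wrt_irrefl_imp_distinct: "sorted_wrt P xs \<Longrightarrow> (\<And>x. \<not> P x x) \<Longrightarrow> distinct xs"
  by (induction xs) auto

text \<open>
  Ascending values are distinct. They belong to the matroids of subsets with \<open>r\<close> points, whichever
  representatives are chosen.
\<close>

lemma certificate_bound:
  assumes "bij_betw (\<lambda>i. {l i, - l i}) {1..28} {{v, - v} | v. v \<in> min_vectors E7_dual}"
    and "certificate (extra b) k ms" and "k = int r"
  shows "length ms \<le> num_matroid_structures l 28 r"
proof -
  have sorted: "sorted_wrt less_key (map (\<lambda>m. key b (bits 28 m)) ms)"
    and weight: "\<And>m. m \<in> set ms \<Longrightarrow> sum_list (bits 28 m) = int r"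
  proof -
    have "sorted_wrt less_key (map (\<lambda>m. key b (bits 28 m)) ms) \<and> (\<forall>m\<in>set ms. sum_list (bits 28 m) = int r)"
    proof (cases ms)
      case (Cons m ms')
      have "ascending (extra b) (int r) (bits 28 m) (core (bits 28 m)) ms'" "sum_list (bits 28 m) = int r"
        using assms(2,3) unfolding certificate_def Cons by (auto simp: Let_def split: if_splits)
      then show ?thesis using ascending_sound[of b "int r" "bits 28 m" _ ms'] unfolding Cons by auto
    qed simp
    then show "sorted_wrt less_key (map (\<lambda>m. key b (bits 28 m)) ms)"
      "\<And>m. m \<in> set ms \<Longrightarrow> sum_list (bits 28 m) = int r" by blast+
  qed
  let ?v = "\<lambda>m. circuit_invariant (point_matroid (mask_points m))"
  have key: "key b (bits 28 m) = scaled b (?v m)" for m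
    by (rule key_eq_scaled_invariant[OF indicates_bits])
  have "distinct (map (\<lambda>m. key b (bits 28 m)) ms)"
    using sorted less_key_irrefl by (rule sorted_wrt_irrefl_imp_distinct)
  then have "distinct (map (scaled b) (map ?v ms))" by (simp add: key o_def)
  then have "distinct (map ?v ms)" using distinct_map[of "scaled b" "map ?v ms"] by blast
  then have "length ms = card (?v ` set ms)" using distinct_card[of "map ?v ms"] by simp
  also have "\<dots> \<le> card (circuit_invariant ` matroid_structures l 28 r)"
  proof (rule card_mono)
    show "finite (circuit_invariant ` matroid_structures l 28 r)" by (simp add: finite_matroid_structures)
    show "?v ` set ms \<subseteq> circuit_invariant ` matroid_structures l 28 r"
    proof
      fix v assume "v \<in> ?v ` set ms"
      then obtain m where m: "m \<in> set ms" "v = ?v m" by blast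
      have "card (mask_points m) = r" using weight[OF m(1)] by (simp add: sum_list_bits)
      moreover have "mask_points m \<subseteq> {..<28}" by (auto simp: mask_points_def)
      ultimately obtain M where "M \<in> matroid_structures l 28 r" "matroid_equiv (point_matroid (mask_points m)) M"
        using point_matroid_realised[OF assms(1), of "mask_points m"] by auto
      then show "v \<in> circuit_invariant ` matroid_structures l 28 r" using circuit_invariant_equiv m(2) by blast
    qed
  qed
  also have "\<dots> \<le> num_matroid_structures l 28 r" by (rule card_circuit_invariants_le)
  finally show ?thesis .
qed

text \<open>Bit \<open>i\<close> of a mask says whether point \<open>i\<close> belongs to the subset.\<close>

lemma certificate_1: "certificate (extra True) 1
    [1]"
  by (simp only: certificate_eval cong: weak_congs)

lemma certificate_2: "certificate (extra True) 2
    [3]"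
  by (simp only: certificate_eval cong: weak_congs)

lemma certificate_3: "certificate (extra True) 3
    [11]"
  by (simp only: certificate_eval cong: weak_congs)

lemma certificate_4: "certificate (extra True) 4
    [75, 51]"
  by (simp only: certificate_eval cong: weak_congs)

lemma certificate_5: "certificate (extra True) 5
    [1099, 31]"
  by (simp only: certificate_eval cong: weak_congs)

lemma certificate_6: "certificate (extra True) 6
    [33867, 95, 63, 591]"
  by (simp only: certificate_eval cong: weak_congs)

lemma certificate_7: "certificate (extra True) 7
    [2131019, 134218831, 1119, 223, 1615, 351]"
  by (simp only: certificate_eval cong: weak_congs)

lemma certificate_8: "certificate (extra True) 8
    [2131023, 16811087, 33887, 18527, 1247, 30795, 34383, 134218847, 1375, 17503, 255]"
  by (simp only: certificate_eval cong: weak_congs)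

lemma certificate_9: "certificate (extra True) 9
    [2131039, 4228191, 50365519, 590943, 34015, 3295, 2131535, 8455263, 33588319, 34143,
     4228687, 50271, 5343, 1279, 1082959, 134219103, 134218975, 9567, 511]"
  by (simp only: certificate_eval cong: weak_congs)

lemma certificate_10: "certificate (extra True) 10
    [2131071, 2131167, 4228223, 4228319, 1115359, 36063, 2032715, 37782623, 2131295, 8422623,
     201360975, 100697183, 4228447, 16844127, 8455391, 38111, 34047, 2147423, 3180111,
     16811359, 67143007, 33817951, 1082591, 67142879, 4244575, 574559, 1082719, 42335, 3327,
     33604703, 134221023, 5375, 134219615, 1535, 17663, 25951, 1023]"
  by (simp only: certificate_eval cong: weak_congs)

lemma certificate_11: "certificate (extra True) 11
    [2133215, 4230367, 101599, 2131199, 2131807, 71337183, 2135263, 4228351, 8424671, 167135,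
     4232415, 8422655, 169183, 33621247, 36095, 71337311, 4244607, 16815327, 201360735,
     4228959, 33686783, 2139487, 3179871, 4236639, 3179743, 2147455, 201360607, 8426719,
     300255, 1083231, 33588479, 134253791, 38143, 67143519, 34303, 136365151, 67146975,
     1086687, 50431, 2671711, 4244831, 566623, 33596767, 4768863, 68191583, 68191455, 58719,
     3583, 19711, 9727, 21759, 2047]"
  by (simp only: certificate_eval cong: weak_congs)

lemma certificate_12: "certificate (extra False) 12
    [2198751, 264275019, 2133247, 138448095, 2264287, 4230399, 2131455, 8490207, 101631,
     2135295, 16911615, 67636479, 205554911, 2266335, 2143455, 4228607, 2397407, 4244735,
     136350943, 16815359, 3180383, 138462335, 8424703, 560383, 167167, 658687, 16844287,
     201361247, 4363487, 2147583, 4232447, 16946399, 71337823, 177375, 16811519, 4494559,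
     136352991, 8439039, 8555743, 41977087, 574719, 570591, 8434911, 34637055, 300287,
     33600735, 8455679, 36351, 3183839, 136357215, 1099007, 136365183, 142644447, 67155167,
     562431, 1094879, 2663775, 70288735, 8688863, 67409119, 68192095, 52479, 42495, 2671743,
     70288607, 2155871, 68195551, 1348831, 33604863, 67159295, 54527, 34815, 5293407, 1615199,
     4253023, 38323295, 7679, 4095, 134237439, 11775]"
  by (simp only: certificate_eval cong: weak_congs)

lemma certificate_13: "certificate (extra False) 13
    [6393055, 2198783, 10587359, 2133503, 2131967, 2657535, 2264319, 10652895, 2397439,
     19041503, 2526431, 4246783, 8490239, 2159839, 4230655, 118015, 101887, 2139647, 2274527,
     2149631, 16944383, 138462463, 67669247, 439519, 790015, 4769023, 35951839, 2667743,
     4236799, 8424959, 16813567, 167423, 4229119, 8456191, 136482015, 19043551, 2659583,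
     71353599, 8555775, 2151679, 17339647, 8948991, 70289247, 701663, 136361183, 142656767,
     691455, 50365951, 33731807, 429311, 298495, 8451295, 3192031, 4494591, 4756735, 136365311,
     16954591, 4248831, 183551, 16831743, 33596927, 142652639, 2671871, 69506271, 34114815,
     8441087, 578815, 316671, 4240639, 67671295, 134788319, 40447, 3196159, 69780607, 69772639,
     1619167, 9213151, 136373599, 566783, 70292703, 3445983, 137401567, 34116863, 1611007,
     33608959, 204506335, 142906591, 75547903, 36863, 3712351, 134270207, 44543, 72402271,
     8191, 28159]"
  by (simp only: certificate_eval cong: weak_congs)

lemma certificate_14: "certificate (extra False) 14
    [268419072, 268394496, 268374528, 134158848, 268333056, 268267520, 268329472, 268259840,
     125766432, 201267712, 134034176, 267328000, 260009984, 259617536, 132057888, 129970944,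
     266279424, 132068096, 264715008, 264204288, 123564832, 266301440, 117385984, 264182272,
     267866624, 268132864, 260002304, 268325376, 217020928, 132066048, 265898784, 198654720,
     264196608, 265771520, 232221440, 266293760, 265908992, 267612672, 267727616, 251490816,
     263662336, 259355392, 198667008, 198658848, 265759488, 251556352, 64437120, 259944960,
     264200704, 265384736, 131691296, 266297856, 234441504, 263674368, 196569856, 134099712,
     251359744, 249383712, 215837472, 257520416, 266154752, 232223488, 267641344, 251474688,
     265636640, 64711456, 232606496, 131549984, 197880608, 259928832, 264729344, 266039808,
     257782528, 133901056, 200887072, 218067456, 234582528, 217541376, 64445088, 226439936,
     259748352, 264727296, 266021632, 198669056, 232354592, 115176224, 265646848, 266170880,
     234564352, 266820096, 182283040, 267979552, 231435040, 264719136, 249393920, 267594496,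
     250956576, 263924480, 125004576, 266236416, 266220288, 262042368]"
  by (simp only: certificate_eval cong: weak_congs)

lemma certificate_15: "certificate (extra False) 15
    [268407296, 268427264, 268398592, 134165248, 134155040, 268376576, 268390912, 268395008,
     268006144, 134163200, 268165632, 264206336, 268268032, 63929120, 266303488, 267868672,
     259984160, 268251904, 198654848, 266275616, 259979264, 125778688, 267856640, 268136960,
     129972992, 132070144, 264194816, 263666432, 265763584, 266295808, 268333568, 125782816,
     234826496, 234838528, 267744000, 264198656, 259994368, 197081856, 265239296, 259879680,
     198142752, 200764160, 218069504, 251621888, 264186624, 132074272, 131033888, 260010496,
     266283776, 265243424, 267645440, 251603712, 267995936, 234318592, 234320640, 198146208,
     266160928, 265775872, 234703648, 200766208, 198662816, 251491072, 263678720, 265767712,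
     198929184, 249391904, 268317440, 264188672, 266285824, 234615296, 251480864, 192887552,
     264723104, 259486464, 259945216, 264204800, 131953440, 257782560, 266301952, 268118784,
     133647136, 251095808, 266824448, 132061856, 232483616, 196033184, 264989472, 266038016,
     265909024, 259222304, 265777920, 266171136, 259476256, 266816288, 125528864, 263940864,
     249393952, 267733792, 266236672, 262042400]"
  by (simp only: certificate_eval cong: weak_congs)

lemma certificate_16: "certificate (extra False) 16
    [134198016, 268431360, 268423680, 268427776, 268400640, 268367872, 268392960, 268372768,
     134167296, 268382976, 268399104, 134171424, 268380928, 67074208, 267860736, 268169728,
     267340576, 132070272, 265763712, 129973120, 268268288, 201276160, 251623936, 134159008,
     234830592, 264206848, 259879712, 198146848, 62880544, 266304000, 267776768, 234834720,
     233798400, 260000544, 267873024, 267336448, 200239904, 266287872, 230112160, 251591168,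
     268258080, 197097632, 251489056, 259996416, 125791008, 267875072, 201280288, 265255072,
     198146720, 264190720, 264071968, 266292000, 200798976, 251523840, 226458368, 132078240,
     265771680, 260010752, 132082464, 264203008, 265251616, 268135168, 264182432, 251620096,
     259979776, 266169120, 266300160, 267086624, 201026336, 263142048, 266279584, 266038048,
     267643648, 226425600, 200243360, 259746592, 268333824, 234580768, 267864864, 263157920,
     263940896, 266820256, 259945248, 129987360, 132084512, 264205056, 266302208, 266171168,
     266236704, 4160436]"
  by (simp only: certificate_eval cong: weak_congs)

lemma certificate_17: "certificate (extra False) 17
    [268433408, 268425728, 268415744, 268431872, 268413696, 268401152, 268171776, 268368384,
     134167424, 268301056, 268385024, 201291936, 268389152, 268397312, 267907840, 134179616,
     200244000, 67074848, 134181664, 266288000, 267905792, 134175392, 67074720, 267348768,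
     268266272, 268399360, 234846976, 268376736, 264206496, 264190848, 268268320, 265763744,
     266303648, 268167936, 234748672, 234814208, 234838688, 201288480, 132070304, 260012800,
     260008736, 263666592, 251620128, 264198816, 197098144, 264190624, 265255584, 266295968,
     260010784, 264207104, 197098272, 265255712, 266304256, 251521824, 267868832, 268135200,
     259980032, 200243872, 251525888, 250575520, 263158432, 264203040, 266300192, 258931360,
     267352224, 234613536, 268333856, 264205088, 266302240, 138378164]"
  by (simp only: certificate_eval cong: weak_congs)

lemma certificate_18: "certificate (extra False) 18
    [268434432, 268433920, 134214432, 134215840, 268417792, 268432128, 268430080, 268409504,
     268301088, 268400800, 268385152, 268401408, 267909888, 268303104, 268368640, 268299040,
     267352864, 201292576, 201292448, 134167456, 268393120, 268397344, 267320096, 267860896,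
     67074480, 267384992, 234617504, 234830752, 167738272, 264207232, 266304384, 268167968,
     268360352, 251624096, 260012832, 265255344, 266288032, 264207008, 264190880, 230652832,
     251591328, 259979936, 259980064, 266304160, 268399392, 259980160, 267352736, 263158192,
     234614560, 251509664, 264207136, 266304288, 266402740, 205487028]"
  by (simp only: certificate_eval cong: weak_congs)

lemma certificate_19: "certificate (extra False) 19
    [268434944, 268434176, 268433568, 134216480, 268432160, 134216352, 268430112, 268425888,
     268401536, 267385632, 268368768, 268303136, 268401312, 268171936, 268368544, 267844512,
     268385184, 234847136, 268401440, 268168992, 234814368, 201292208, 268368672, 267385504,
     251591088, 264206768, 260012960, 266303920, 251526048, 251525024, 259980192, 218069936,
     264207264, 266304416, 267352496, 267451316, 239041460]"
  by (simp only: certificate_eval cong: weak_congs)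

lemma certificate_20: "certificate (extra False) 20
    [268435200, 268434304, 268431136, 268434208, 268404660, 268434080, 134216608, 268416928,
     268417952, 267910048, 268303264, 268401568, 268368800, 268401072, 268302240, 268368304,
     251624368, 267385264, 267975604, 259980208, 264207280, 266304432, 255818676]"
  by (simp only: certificate_eval cong: weak_congs)

lemma certificate_21: "certificate (extra False) 21
    [268435232, 268435104, 268421044, 268434336, 268431264, 268433312, 268433840, 134216624,
     268171184, 268172208, 268368816, 268401584, 268302256, 268237748, 264207284, 266304436]"
  by (simp only: certificate_eval cong: weak_congs)

lemma certificate_22: "certificate (extra False) 22
    [268435392, 268435360, 268434864, 268429236, 268433328, 268434352, 268431216, 268368820,
     268401588, 134216628]"
  by (simp only: certificate_eval cong: weak_congs)

lemma certificate_23: "certificate (extra False) 23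
    [268435424, 268435312, 268435376, 268433332, 268434356]"
  by (simp only: certificate_eval cong: weak_congs)

lemma certificate_24: "certificate (extra False) 24
    [268435404, 268435440, 268435380]"
  by (simp only: certificate_eval cong: weak_congs)

lemma certificate_25: "certificate (extra False) 25
    [268435436, 268435444]"
  by (simp only: certificate_eval cong: weak_congs)

lemma certificate_26: "certificate (extra False) 26
    [268435452]"
  by (simp only: certificate_eval cong: weak_congs)

lemma certificate_27: "certificate (extra False) 27
    [268435454]"
  by (simp only: certificate_eval cong: weak_congs)

lemma certificate_28: "certificate (extra False) 28
    [268435455]"
  by (simp only: certificate_eval cong: weak_congs)

theorem proposition1p4:
  fixes l :: "nat \<Rightarrow> rat ^ 8" and r :: nat
  assumes "bij_betw (\<lambda>i. {l i, - l i}) {1..28} {{v, - v} | v. v \<in> min_vectors E7_dual}"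
    and "1 \<le> r" and "r \<le> 28"
  shows "num_matroid_structures l 28 r \<ge>
    [1, 1, 1, 2, 2, 4, 6, 11, 19, 37, 52, 80, 95, 102, 100, 90, 70, 54, 37, 23, 16, 10, 5, 3, 2, 1, 1, 1]
      ! (r - 1)"
proof -
  note bound = certificate_bound[OF assms(1)]
  have "r = 1 \<or> r = 2 \<or> r = 3 \<or> r = 4 \<or> r = 5 \<or> r = 6 \<or> r = 7 \<or> r = 8 \<or> r = 9 \<or> r = 10 \<or> r = 11 \<or> r = 12
    \<or> r = 13 \<or> r = 14 \<or> r = 15 \<or> r = 16 \<or> r = 17 \<or> r = 18 \<or> r = 19 \<or> r = 20 \<or> r = 21 \<or> r = 22 \<or> r = 23
    \<or> r = 24 \<or> r = 25 \<or> r = 26 \<or> r = 27 \<or> r = 28"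
    using assms(2,3) by presburger
  then show ?thesis
  proof (elim disjE)
  assume "r = 1" then show ?thesis using bound[OF certificate_1, of r] by simp
  next assume "r = 2" then show ?thesis using bound[OF certificate_2, of r] by simp
  next assume "r = 3" then show ?thesis using bound[OF certificate_3, of r] by simp
  next assume "r = 4" then show ?thesis using bound[OF certificate_4, of r] by simp
  next assume "r = 5" then show ?thesis using bound[OF certificate_5, of r] by simp
  next assume "r = 6" then show ?thesis using bound[OF certificate_6, of r] by simp
  next assume "r = 7" then show ?thesis using bound[OF certificate_7, of r] by simp
  next assume "r = 8" then show ?thesis using bound[OF certificate_8, of r] by simp
  next assume "r = 9" then show ?thesis using bound[OF certificate_9, of r] by simp
  next assume "r = 10" then show ?thesis using bound[OF certificate_10, of r] by simp
  next assume "r = 11" then show ?thesis using bound[OF certificate_11, of r] by simp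
  next assume "r = 12" then show ?thesis using bound[OF certificate_12, of r] by simp
  next assume "r = 13" then show ?thesis using bound[OF certificate_13, of r] by simp
  next assume "r = 14" then show ?thesis using bound[OF certificate_14, of r] by simp
  next assume "r = 15" then show ?thesis using bound[OF certificate_15, of r] by simp
  next assume "r = 16" then show ?thesis using bound[OF certificate_16, of r] by simp
  next assume "r = 17" then show ?thesis using bound[OF certificate_17, of r] by simp
  next assume "r = 18" then show ?thesis using bound[OF certificate_18, of r] by simp
  next assume "r = 19" then show ?thesis using bound[OF certificate_19, of r] by simp
  next assume "r = 20" then show ?thesis using bound[OF certificate_20, of r] by simp
  next assume "r = 21" then show ?thesis using bound[OF certificate_21, of r] by simp
  next assume "r = 22" then show ?thesis using bound[OF certificate_22, of r] by simp
  next assume "r = 23" then show ?thesis using bound[OF certificate_23, of r] by simp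
  next assume "r = 24" then show ?thesis using bound[OF certificate_24, of r] by simp
  next assume "r = 25" then show ?thesis using bound[OF certificate_25, of r] by simp
  next assume "r = 26" then show ?thesis using bound[OF certificate_26, of r] by simp
  next assume "r = 27" then show ?thesis using bound[OF certificate_27, of r] by simp
  next assume "r = 28" then show ?thesis using bound[OF certificate_28, of r] by simp
  qed
qed

end
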